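(* Let $m=N$ and let $\mathfrak G_{trig}$ be the Lie algebra generated by the entries of the coefficients of the matrix series $\tilde L(u)=\sum_{k\ge1}\tilde L[k]u^{-k}$, with bracket $$[\tilde L_1(u),\tilde L_2(v)]=\Big[P,\frac{u\tilde L_1(u)-v\tilde L_1(v)}{u-v}\Big].$$ Then the elements $$QH_k(u)=\mathrm{Tr}_{(1\dots m)}\,\mathcal P_-^{(m)}(\tilde L_1(u)-I\partial_u)(\tilde L_2(u)-I\partial_u)\cdots(\tilde L_k(u)-I\partial_u)\,1,\qquad 1\le k\le m,$$ where $\partial_u=u\frac{d}{du}$, commute with each other in the enveloping algebra $U(\mathfrak G_{trig})$, i.e. $[QH_k(u),QH_l(v)]=0$ for all $1\le k,l\le m$ and all values of $u,v$.
   Context: Ground field $\mathbb K=\mathbb C$ or $\mathbb R$; $V$ is a vector space with $\dim V=N$, and $m=N$. $\tilde L[k]=\|\tilde l_i^j[k]\|_{1\le i,j\le N}$, and the $\tilde l_i^j[k]$ ($k\ge1$, $1\le i,j\le N$) form a basis of $\mathfrak G_{trig}$; lower index = row, upper index = column; $\tilde L_p(u)$ is $\tilde L(u)$ placed in the $p$-th tensor factor of $\mathrm{End}(V)^{\otimes m}$, and $P$ is the flip on $V^{\otimes2}$. On the left of the bracket relation, the entries of $\tilde L_1(u)$ and $\tilde L_2(v)$ are paired by the Lie bracket; on the right is a matrix commutator; both sides are compared coefficientwise in powers of $u^{-1},v^{-1}$. (Equivalently the right-hand side is $[\frac{P}{u-v},u\tilde L_1(u)+v\tilde L_2(v)]$.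 $U(\mathfrak G_{trig})$ is the $q\to1$ limit of the braided $q$-Yangian with generating matrix $L(u)=(q-q^{-1})\tilde L(u)+I$.) $\mathrm{Tr}$ is the ordinary trace and $\mathcal P_-^{(m)}=\frac1{m!}\sum_{\sigma\in S_m}\mathrm{sgn}(\sigma)\sigma$ is the ordinary skew-symmetrizer on $V^{\otimes m}$. The product of first-order differential operators in $u$ with coefficients in $U(\mathfrak G_{trig})$ is applied to the constant function $1$, giving a series in $u^{-1}$ with coefficients in $U(\mathfrak G_{trig})$. *)

theory Defs
  imports
    Complex_Main
    "HOL-Library.Cardinality"
    "HOL-Library.Poly_Mapping"
    "HOL-Combinatorics.Permutations"
    "HOL-Computational_Algebra.Formal_Power_Series"
begin

section \<open>Lie algebras and the enveloping ideal\<close>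

locale lie_algebra = vector_space scale
  for scale :: "'k::field \<Rightarrow> 'g::ab_group_add \<Rightarrow> 'g" (infixr "*s" 75) +
  fixes br :: "'g \<Rightarrow> 'g \<Rightarrow> 'g"
  assumes br_add_left: "br (x + y) z = br x z + br y z"
    and br_add_right: "br x (y + z) = br x y + br x z"
    and br_scale_left: "br (c *s x) y = c *s br x y"
    and br_scale_right: "br x (c *s y) = c *s br x y"
    and br_self: "br x x = 0"
    and jacobi: "br x (br y z) + br y (br z x) + br z (br x y) = 0"

text \<open>
  Words, i.e. the free monoid under concatenation.  The monoid algebra
  \<^typ>\<open>'b \<Rightarrow>\<^sub>0 'k\<close> for \<open>'b = 'g word_monoid\<close> is the free unital associative
  algebra on the set \<open>'g\<close>.
\<close>

datatype 'g word_monoid = Word (letters: "'g list")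

instantiation word_monoid :: (type) monoid_add
begin

definition "0 = Word []"
definition "v + w = Word (letters v @ letters w)"

instance
  by standard (auto simp: zero_word_monoid_def plus_word_monoid_def)

end

type_synonym ('g, 'k) free_algebra = "'g word_monoid \<Rightarrow>\<^sub>0 'k"

definition gen :: "'g \<Rightarrow> ('g, 'k::field) free_algebra"
  where "gen x = Poly_Mapping.single (Word [x]) 1"

definition const :: "'k \<Rightarrow> ('g, 'k::field) free_algebra"
  where "const c = Poly_Mapping.single 0 c"

text \<open>
  The two-sided ideal whose quotient is the enveloping algebra.  Since the generators of the
  free algebra are all the elements of the Lie algebra, the relations \<open>gen_add\<close> and
  \<open>gen_scale\<close> are needed to pass to the tensor algebra of the underlying vector space.
\<close>

inductive_set env_ideal ::
    "('k::field \<Rightarrow> 'g::ab_group_add \<Rightarrow> 'g) \<Rightarrow> ('g \<Rightarrow> 'g \<Rightarrow> 'g) \<Rightarrow> ('g, 'k) free_algebra set"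
  for scale br where
  gen_add: "gen (x + y) - gen x - gen y \<in> env_ideal scale br"
| gen_scale: "gen (scale c x) - const c * gen x \<in> env_ideal scale br"
| gen_br: "gen x * gen y - gen y * gen x - gen (br x y) \<in> env_ideal scale br"
| zero: "0 \<in> env_ideal scale br"
| add: "a \<in> env_ideal scale br \<Longrightarrow> b \<in> env_ideal scale br \<Longrightarrow> a + b \<in> env_ideal scale br"
| mult: "a \<in> env_ideal scale br \<Longrightarrow> b * a * c \<in> env_ideal scale br"

lemma env_ideal_uminus: "a \<in> env_ideal s br \<Longrightarrow> - a \<in> env_ideal s br"
  using env_ideal.mult[of a s br "-1" 1] by simp

lemma env_ideal_diff:
  "a \<in> env_ideal s br \<Longrightarrow> b \<in> env_ideal s br \<Longrightarrow> a - b \<in> env_ideal s br"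
  using env_ideal.add[of a s br "- b"] env_ideal_uminus by fastforce

lemma env_ideal_mult_cong:
  assumes "a - a' \<in> env_ideal s br" "b - b' \<in> env_ideal s br"
  shows "a * b - a' * b' \<in> env_ideal s br"
proof -
  have "a * b - a' * b' = 1 * (a - a') * b + a' * (b - b') * 1"
    by (simp add: algebra_simps)
  then show ?thesis
    using assms env_ideal.add env_ideal.mult by metis
qed

lemma lookup_mult_word_0:
  fixes f g :: "('g, 'k::field) free_algebra"
  shows "Poly_Mapping.lookup (f * g) 0 = Poly_Mapping.lookup f 0 * Poly_Mapping.lookup g 0"
proof -
  have eq: "0 = v + w \<longleftrightarrow> v = 0 \<and> w = 0" for v w :: "'g word_monoid"
    by (cases v; cases w) (auto simp: zero_word_monoid_def plus_word_monoid_def)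
  have "Poly_Mapping.lookup (f * g) 0
      = (\<Sum>v. Poly_Mapping.lookup f v * (\<Sum>w. Poly_Mapping.lookup g w when 0 = v + w))"
    by (simp add: times_poly_mapping.rep_eq prod_fun_def)
  also have "\<dots> = (\<Sum>v. (Poly_Mapping.lookup f 0 * Poly_Mapping.lookup g 0 when v = (0 :: 'g word_monoid)))"
  proof (rule Sum_any.cong)
    fix v :: "'g word_monoid"
    show "Poly_Mapping.lookup f v * (\<Sum>w. Poly_Mapping.lookup g w when 0 = v + w)
        = (Poly_Mapping.lookup f 0 * Poly_Mapping.lookup g 0 when v = 0)"
      by (cases "v = 0") (simp_all add: eq)
  qed
  finally show ?thesis by simp
qed

lemma word_neq_0: "Word [x] \<noteq> 0"
  by (simp add: zero_word_monoid_def)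

lemma env_ideal_augmentation:
  "a \<in> env_ideal s br \<Longrightarrow> Poly_Mapping.lookup a 0 = 0"
  by (induction rule: env_ideal.induct)
     (simp_all add: lookup_minus lookup_add lookup_mult_word_0 gen_def lookup_single word_neq_0)

lemma one_notin_env_ideal: "1 \<notin> env_ideal s br"
  using env_ideal_augmentation[of 1 s br] by (auto simp: lookup_one)


section \<open>The Lie algebra\<close>

text \<open>
  A basis of \<open>V\<close> is indexed by \<open>'n\<close>, so \<open>N = CARD('n)\<close>.  The basis element
  \<open>Lt k i j\<close> of the Lie algebra (\<open>k \<ge> 1\<close>, row \<open>i\<close>, column \<open>j\<close>) is stored under the key \<open>(k - 1, i, j)\<close>.
\<close>

type_synonym ('k, 'n) gtrig = "(nat \<times> 'n \<times> 'n) \<Rightarrow>\<^sub>0 'k"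

definition gscale :: "'k::field \<Rightarrow> ('b \<Rightarrow>\<^sub>0 'k) \<Rightarrow> ('b \<Rightarrow>\<^sub>0 'k)"
  where "gscale c = Poly_Mapping.map ((*) c)"

text \<open>\<open>Lt k\<close> is the coefficient matrix of \<open>u\<^sup>-\<^sup>k\<close>; in particular \<open>Lt 0 = 0\<close>.\<close>

definition Lt :: "nat \<Rightarrow> 'n \<Rightarrow> 'n \<Rightarrow> ('k::field, 'n) gtrig"
  where "Lt k i j = (if k = 0 then 0 else Poly_Mapping.single (k - 1, i, j) 1)"

definition first_leg :: "('n \<Rightarrow> 'n \<Rightarrow> 'g::zero) \<Rightarrow> 'n \<times> 'n \<Rightarrow> 'n \<times> 'n \<Rightarrow> 'g"
  where "first_leg X = (\<lambda>(i, p) (j, q). if p = q then X i j else 0)"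

definition flip :: "'n \<times> 'n \<Rightarrow> 'n \<times> 'n \<Rightarrow> 'k::field"
  where "flip = (\<lambda>(i, p) (j, q). if i = q \<and> p = j then 1 else 0)"

definition flip_commutator ::
    "('n::finite \<times> 'n \<Rightarrow> 'n \<times> 'n \<Rightarrow> ('b \<Rightarrow>\<^sub>0 'k::field)) \<Rightarrow> 'n \<times> 'n \<Rightarrow> 'n \<times> 'n \<Rightarrow> ('b \<Rightarrow>\<^sub>0 'k)"
  where "flip_commutator X I J =
    (\<Sum>K\<in>UNIV. gscale (flip I K) (X K J)) - (\<Sum>K\<in>UNIV. gscale (flip K J) (X I K))"

text \<open>
  Because \<open>(u\<^sup>1\<^sup>-\<^sup>k - v\<^sup>1\<^sup>-\<^sup>k) / (u - v) = - (\<Sum>a + b = k. u\<^sup>-\<^sup>a v\<^sup>-\<^sup>b)\<close> with \<open>a, b \<ge> 1\<close>, the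
  coefficient of \<open>u\<^sup>-\<^sup>a v\<^sup>-\<^sup>b\<close> in \<open>(u L(u) - v L(v)) / (u - v)\<close> is \<open>- L[a + b]\<close>.  The entry of
  \<open>[L\<^sub>1(u), L\<^sub>2(v)]\<close> in row \<open>(i, p)\<close> and column \<open>(j, q)\<close> is the bracket of the \<open>(i, j)\<close> entry of
  \<open>L(u)\<close> with the \<open>(p, q)\<close> entry of \<open>L(v)\<close>.
\<close>

definition gbr_basis :: "nat \<times> 'n \<times> 'n \<Rightarrow> nat \<times> 'n \<times> 'n \<Rightarrow> ('k::field, 'n::finite) gtrig"
  where "gbr_basis = (\<lambda>(a, i, j) (b, p, q).
    flip_commutator (first_leg (\<lambda>i j. - Lt (Suc a + Suc b) i j)) (i, p) (j, q))"

definition gbr :: "('k::field, 'n::finite) gtrig \<Rightarrow> ('k, 'n) gtrig \<Rightarrow> ('k, 'n) gtrig"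
  where "gbr x y = (\<Sum>s\<in>Poly_Mapping.keys x. \<Sum>t\<in>Poly_Mapping.keys y.
    gscale (Poly_Mapping.lookup x s * Poly_Mapping.lookup y t) (gbr_basis s t))"

lemma lookup_gscale [simp]: "Poly_Mapping.lookup (gscale c x) s = c * Poly_Mapping.lookup x s"
  by (auto simp: gscale_def map.rep_eq when_def)

lemma vector_space_gscale: "vector_space (gscale :: 'k::field \<Rightarrow> ('b \<Rightarrow>\<^sub>0 'k) \<Rightarrow> _)"
  by standard (auto intro!: poly_mapping_eqI simp: lookup_add algebra_simps)

interpretation gs: vector_space "gscale :: 'k::field \<Rightarrow> ('b \<Rightarrow>\<^sub>0 'k) \<Rightarrow> _"
  by (rule vector_space_gscale)

lemma gtrig_expand:
  fixes x :: "'b \<Rightarrow>\<^sub>0 'k::field"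
  shows "x = (\<Sum>s\<in>Poly_Mapping.keys x.
    gscale (Poly_Mapping.lookup x s) (Poly_Mapping.single s 1))"
proof (rule poly_mapping_eqI)
  fix t
  have "Poly_Mapping.lookup x t = (\<Sum>s\<in>Poly_Mapping.keys x. Poly_Mapping.lookup x s when s = t)"
    by (cases "t \<in> Poly_Mapping.keys x") (auto simp: when_def in_keys_iff sum.delta)
  then show "Poly_Mapping.lookup x t = Poly_Mapping.lookup (\<Sum>s\<in>Poly_Mapping.keys x.
    gscale (Poly_Mapping.lookup x s) (Poly_Mapping.single s 1)) t"
    by (simp add: lookup_sum lookup_single when_def if_distrib cong: if_cong)
qed

lemma gbr_superset:
  assumes "finite A" "finite B" "Poly_Mapping.keys x \<subseteq> A" "Poly_Mapping.keys y \<subseteq> B"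
  shows "gbr x y = (\<Sum>s\<in>A. \<Sum>t\<in>B.
    gscale (Poly_Mapping.lookup x s * Poly_Mapping.lookup y t) (gbr_basis s t))"
proof -
  have "gbr x y = (\<Sum>s\<in>Poly_Mapping.keys x. \<Sum>t\<in>B.
    gscale (Poly_Mapping.lookup x s * Poly_Mapping.lookup y t) (gbr_basis s t))"
    unfolding gbr_def
    by (intro sum.cong refl sum.mono_neutral_left) (use assms in \<open>auto simp: in_keys_iff\<close>)
  also have "\<dots> = (\<Sum>s\<in>A. \<Sum>t\<in>B.
    gscale (Poly_Mapping.lookup x s * Poly_Mapping.lookup y t) (gbr_basis s t))"
    by (intro sum.mono_neutral_left) (use assms in \<open>auto simp: in_keys_iff\<close>)
  finally show ?thesis .
qed

lemma gbr_add_left: "gbr (x + y) z = gbr x z + gbr y z"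
proof -
  let ?A = "Poly_Mapping.keys x \<union> Poly_Mapping.keys y"
  let ?B = "Poly_Mapping.keys z"
  have *: "Poly_Mapping.keys (x + y) \<subseteq> ?A"
    by (rule Poly_Mapping.keys_add)
  show ?thesis
    by (subst (1 2 3) gbr_superset[where A = ?A and B = ?B])
       (use * in \<open>auto simp: lookup_add algebra_simps sum.distrib gs.scale_left_distrib\<close>)
qed

lemma gbr_add_right: "gbr z (x + y) = gbr z x + gbr z y"
proof -
  let ?A = "Poly_Mapping.keys x \<union> Poly_Mapping.keys y"
  let ?B = "Poly_Mapping.keys z"
  have *: "Poly_Mapping.keys (x + y) \<subseteq> ?A"
    by (rule Poly_Mapping.keys_add)
  show ?thesis
    by (subst (1 2 3) gbr_superset[where B = ?A and A = ?B])
       (use * in \<open>auto simp: lookup_add algebra_simps sum.distrib gs.scale_left_distrib\<close>)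
qed

lemma keys_gscale: "Poly_Mapping.keys (gscale c x) \<subseteq> Poly_Mapping.keys x"
  by (auto simp: in_keys_iff)

lemma gbr_scale_left: "gbr (gscale c x) y = gscale c (gbr x y)"
  by (subst (1 2) gbr_superset[where A = "Poly_Mapping.keys x" and B = "Poly_Mapping.keys y"])
     (auto simp: keys_gscale gs.scale_sum_right mult.assoc)

lemma gbr_scale_right: "gbr x (gscale c y) = gscale c (gbr x y)"
  by (subst (1 2) gbr_superset[where A = "Poly_Mapping.keys x" and B = "Poly_Mapping.keys y"])
     (auto simp: keys_gscale gs.scale_sum_right mult_ac)

lemma gbr_zero [simp]: "gbr 0 x = 0" "gbr x 0 = 0"
  by (simp_all add: gbr_def)

lemma gbr_sum_left: "gbr (sum f A) y = (\<Sum>s\<in>A. gbr (f s) y)"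
  by (induction A rule: infinite_finite_induct) (auto simp: gbr_add_left)

lemma gbr_sum_right: "gbr y (sum f A) = (\<Sum>s\<in>A. gbr y (f s))"
  by (induction A rule: infinite_finite_induct) (auto simp: gbr_add_right)

lemma gbr_single:
  "gbr (Poly_Mapping.single s 1) (Poly_Mapping.single t 1) = gbr_basis s t"
  by (simp add: gbr_def)

lemma gbr_Lt:
  assumes "a \<ge> 1" "b \<ge> 1"
  shows "gbr (Lt a i j) (Lt b p q)
    = flip_commutator (first_leg (\<lambda>i j. - Lt (a + b) i j)) (i, p) (j, q)"
  using assms by (cases a; cases b) (auto simp: Lt_def gbr_single gbr_basis_def)

lemma flip_commutator_first_leg:
  "flip_commutator (first_leg X) (i, p) (j, q)
    = (if i = q then X p j else 0) - (if p = j then X i q else 0)"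
proof -
  have 1: "(\<Sum>K\<in>UNIV. gscale (flip (i, p) K) (first_leg X K (j, q)))
      = first_leg X (p, i) (j, q)"
    by (subst sum.remove[of _ "(p, i)"]) (auto simp: flip_def intro!: sum.neutral split: if_splits)
  have 2: "(\<Sum>K\<in>UNIV. gscale (flip K (j, q)) (first_leg X (i, p) K))
      = first_leg X (i, p) (q, j)"
    by (subst sum.remove[of _ "(q, j)"]) (auto simp: flip_def intro!: sum.neutral split: if_splits)
  show ?thesis
    unfolding flip_commutator_def 1 2 by (auto simp: first_leg_def)
qed

lemma gbr_Lt_explicit:
  assumes "a \<ge> 1" "b \<ge> 1"
  shows "gbr (Lt a i j) (Lt b p q)
    = (if p = j then Lt (a + b) i q else 0) - (if i = q then Lt (a + b) p j else 0)"
  unfolding gbr_Lt[OF assms] flip_commutator_first_leg by auto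

text \<open>
  The defining relation multiplied by \<open>u - v\<close>, at \<open>u\<^sup>-\<^sup>a v\<^sup>-\<^sup>b\<close>.
\<close>

theorem gtrig_relation:
  fixes i j p q :: "'n::finite"
  shows "gbr (Lt (a + 1) i j) (Lt b p q) - gbr (Lt a i j) (Lt (b + 1) p q)
    = (flip_commutator (first_leg (\<lambda>i j.
        (if b = 0 then Lt (a + 1) i j else 0) - (if a = 0 then Lt (b + 1) i j else 0)))
      (i, p) (j, q) :: ('k::field, 'n) gtrig)"
proof -
  have Lt0: "Lt 0 i j = (0 :: ('k, 'n) gtrig)" for i j
    by (simp add: Lt_def)
  show ?thesis
    unfolding flip_commutator_first_leg
    by (cases "a = 0"; cases "b = 0") (auto simp: gbr_Lt_explicit Lt0)
qed

lemma gtrig_induct [case_names Lt add scale]: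
  fixes x :: "('k::field, 'n) gtrig"
  assumes "\<And>k i j. k \<ge> 1 \<Longrightarrow> P (Lt k i j)"
    and "\<And>x y. P x \<Longrightarrow> P y \<Longrightarrow> P (x + y)"
    and "\<And>c x. P x \<Longrightarrow> P (gscale c x)"
  shows "P x"
proof -
  have single: "P (Poly_Mapping.single s 1)" for s
    using assms(1)[of "Suc (fst s)" "fst (snd s)" "snd (snd s)"] by (simp add: Lt_def)
  have zero: "P 0"
    using assms(3)[OF single, of 0] by simp
  have "P (\<Sum>s\<in>A. gscale (Poly_Mapping.lookup x s) (Poly_Mapping.single s 1))"
    for A
    by (induction A rule: infinite_finite_induct) (auto simp: zero intro: assms single)
  then show ?thesis
    using gtrig_expand[of x] by metis
qed

lemma gbr_antisym: "gbr x y = - gbr y x"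
proof (induction x rule: gtrig_induct)
  case (Lt k i j)
  show ?case
    using Lt
    by (induction y rule: gtrig_induct)
       (auto simp: gbr_Lt_explicit gbr_add_left gbr_add_right gbr_scale_left gbr_scale_right
          add.commute)
qed (auto simp: gbr_add_left gbr_add_right gbr_scale_left gbr_scale_right)

lemma gbr_self: "gbr x x = 0"
proof (induction x rule: gtrig_induct)
  case (Lt k i j)
  then show ?case by (auto simp: gbr_Lt_explicit)
next
  case (add x y)
  then show ?case
    using gbr_antisym[of x y] by (simp add: gbr_add_left gbr_add_right)
qed (simp add: gbr_scale_left gbr_scale_right)

lemma gbr_jacobi:
  fixes x y z :: "('a::field, 'b::finite) gtrig"
  shows "gbr x (gbr y z) + gbr y (gbr z x) + gbr z (gbr x y) = 0"
proof -
  note bilin = gbr_add_left gbr_add_right gbr_scale_left gbr_scale_right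
  have diff: "gbr u (v - w) = gbr u v - gbr u w" for u v w :: "('a, 'b) gtrig"
    using gbr_add_right[of u "v - w" w] by (simp add: algebra_simps)
  define d :: "'b \<Rightarrow> 'b \<Rightarrow> 'a" where "d i j = (if i = j then 1 else 0)" for i j
  have br: "gbr (Lt a i j) (Lt b p q) = gscale (d p j) (Lt (a + b) i q) - gscale (d i q) (Lt (a + b) p j)"
    if "a > 0" "b > 0" for a b i j p q
    using that by (simp add: gbr_Lt_explicit d_def)
  have basis: "gbr (Lt a i j) (gbr (Lt b p q) (Lt c r s))
      + gbr (Lt b p q) (gbr (Lt c r s) (Lt a i j))
      + gbr (Lt c r s) (gbr (Lt a i j) (Lt b p q)) = (0 :: ('a, 'b) gtrig)"
    if "a \<ge> 1" "b \<ge> 1" "c \<ge> 1" for a b c i j p q r s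
    using that
    by (simp add: br diff bilin gs.scale_right_diff_distrib mult.commute add_ac)
  have basis2: "gbr (Lt a i j) (gbr (Lt b p q) z) + gbr (Lt b p q) (gbr z (Lt a i j))
      + gbr z (gbr (Lt a i j) (Lt b p q)) = 0" if "a \<ge> 1" "b \<ge> 1" for a b i j p q
  proof (induction z rule: gtrig_induct)
    case (Lt k i j)
    then show ?case using basis that by blast
  next
    case (add x y)
    from arg_cong2[where f = "(+)", OF add] show ?case by (simp add: bilin add_ac)
  next
    case (scale c x)
    from arg_cong[where f = "gscale c", OF scale] show ?case
      by (simp add: bilin gs.scale_right_distrib)
  qed
  have basis1: "gbr (Lt a i j) (gbr y z) + gbr y (gbr z (Lt a i j))
      + gbr z (gbr (Lt a i j) y) = 0" if "a \<ge> 1" for a i j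
  proof (induction y rule: gtrig_induct)
    case (Lt k i j)
    then show ?case using basis2 that by blast
  next
    case (add x y)
    from arg_cong2[where f = "(+)", OF add] show ?case by (simp add: bilin add_ac)
  next
    case (scale c x)
    from arg_cong[where f = "gscale c", OF scale] show ?case
      by (simp add: bilin gs.scale_right_distrib)
  qed
  show ?thesis
  proof (induction x rule: gtrig_induct)
    case (Lt k i j)
    then show ?case using basis1 by blast
  next
    case (add x y)
    from arg_cong2[where f = "(+)", OF add] show ?case by (simp add: bilin add_ac)
  next
    case (scale c x)
    from arg_cong[where f = "gscale c", OF scale] show ?case
      by (simp add: bilin gs.scale_right_distrib)
  qed
qed

theorem lie_algebra_gtrig:
  "lie_algebra (gscale :: 'k::field \<Rightarrow> ('k, 'n::finite) gtrig \<Rightarrow> _) gbr"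
  by unfold_locales
     (simp_all add: gbr_add_left gbr_add_right gbr_scale_left gbr_scale_right gbr_self gbr_jacobi
        gs.scale_right_distrib gs.scale_left_distrib)


section \<open>The enveloping algebra\<close>

definition env_rel ::
    "(('k::field, 'n::finite) gtrig, 'k) free_algebra \<Rightarrow> (('k, 'n) gtrig, 'k) free_algebra \<Rightarrow> bool"
  where "env_rel a b \<longleftrightarrow> a - b \<in> env_ideal gscale gbr"

quotient_type (overloaded) ('k, 'n) U_gtrig =
  "(('k::field, 'n::finite) gtrig, 'k) free_algebra" / env_rel
proof (rule equivpI)
  show "reflp env_rel"
    by (auto simp: reflp_def env_rel_def env_ideal.zero)
  show "symp env_rel"
    unfolding symp_def env_rel_def using env_ideal_uminus by fastforce
  show "transp env_rel"
    unfolding transp_def env_rel_def using env_ideal.add by fastforce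
qed

instantiation U_gtrig :: (field, finite) ring_1
begin

lift_definition zero_U_gtrig :: "('a, 'b) U_gtrig" is 0 .
lift_definition one_U_gtrig :: "('a, 'b) U_gtrig" is 1 .
lift_definition plus_U_gtrig :: "('a, 'b) U_gtrig \<Rightarrow> ('a, 'b) U_gtrig \<Rightarrow> ('a, 'b) U_gtrig"
  is "(+)"
  unfolding env_rel_def by (drule (1) env_ideal.add) (simp add: algebra_simps)
lift_definition uminus_U_gtrig :: "('a, 'b) U_gtrig \<Rightarrow> ('a, 'b) U_gtrig" is uminus
  unfolding env_rel_def by (drule env_ideal_uminus) (simp add: algebra_simps)
lift_definition minus_U_gtrig :: "('a, 'b) U_gtrig \<Rightarrow> ('a, 'b) U_gtrig \<Rightarrow> ('a, 'b) U_gtrig"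
  is "(-)"
  unfolding env_rel_def by (drule (1) env_ideal_diff) (simp add: algebra_simps)
lift_definition times_U_gtrig :: "('a, 'b) U_gtrig \<Rightarrow> ('a, 'b) U_gtrig \<Rightarrow> ('a, 'b) U_gtrig"
  is "(*)"
  unfolding env_rel_def by (rule env_ideal_mult_cong)

instance
proof
  show "(0 :: ('a, 'b) U_gtrig) \<noteq> 1"
    by transfer (use env_ideal_uminus one_notin_env_ideal in \<open>fastforce simp: env_rel_def\<close>)
qed (transfer; simp add: env_rel_def env_ideal.zero algebra_simps)+

end

definition U_of :: "('k::field, 'n::finite) gtrig \<Rightarrow> ('k, 'n) U_gtrig"
  where "U_of x = abs_U_gtrig (gen x)"

definition U_const :: "'k::field \<Rightarrow> ('k, 'n::finite) U_gtrig"
  where "U_const c = abs_U_gtrig (const c)"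


section \<open>Series in \<open>u\<^sup>-\<^sup>1\<close>, differential operators and the elements \<open>QH\<^sub>k(u)\<close>\<close>

text \<open>
  Here \<^const>\<open>fps_X\<close> stands for \<open>u\<^sup>-\<^sup>1\<close>; hence \<open>u d/du\<close> multiplies the coefficient of \<open>X\<^sup>n\<close> by \<open>-n\<close>.
\<close>

definition u_deriv :: "'a::ring_1 fps \<Rightarrow> 'a fps"
  where "u_deriv f = Abs_fps (\<lambda>n. - of_nat n * fps_nth f n)"

definition Lser :: "'n \<Rightarrow> 'n \<Rightarrow> ('k::field, 'n::finite) U_gtrig fps"
  where "Lser i j = Abs_fps (\<lambda>k. U_of (Lt k i j))"

definition LD :: "'n \<Rightarrow> 'n \<Rightarrow> ('k::field, 'n::finite) U_gtrig fps \<Rightarrow> ('k, 'n) U_gtrig fps"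
  where "LD i j f = Lser i j * f - (if i = j then u_deriv f else 0)"

text \<open>
  Matrices on \<open>V\<^sup>\<otimes>\<^sup>m\<close> whose entries are operators on series.  Rows and columns are
  multi-indices, i.e. lists of length \<open>m\<close>; tensor factors are numbered from \<open>0\<close>.
\<close>

type_synonym ('a, 'n) op_matrix = "'n list \<Rightarrow> 'n list \<Rightarrow> 'a fps \<Rightarrow> 'a fps"

definition multi_idx :: "nat \<Rightarrow> 'n list set"
  where "multi_idx m = {I. length I = m}"

definition op_id :: "('a::ring_1, 'n) op_matrix"
  where "op_id I J f = (if I = J then f else 0)"

definition op_mult ::
    "nat \<Rightarrow> ('a::ring_1, 'n) op_matrix \<Rightarrow> ('a, 'n) op_matrix \<Rightarrow> ('a, 'n) op_matrix"
  where "op_mult m A B I J f = (\<Sum>K\<in>multi_idx m. A I K (B K J f))"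

definition op_leg ::
    "nat \<Rightarrow> nat \<Rightarrow> ('n \<Rightarrow> 'n \<Rightarrow> 'a::ring_1 fps \<Rightarrow> 'a fps) \<Rightarrow> ('a, 'n) op_matrix"
  where "op_leg m p M I J f =
    (if \<forall>r<m. r \<noteq> p \<longrightarrow> I ! r = J ! r then M (I ! p) (J ! p) f else 0)"

definition LD_prod :: "nat \<Rightarrow> nat \<Rightarrow> (('k::field, 'n::finite) U_gtrig, 'n) op_matrix"
  where "LD_prod m k = foldr (\<lambda>p. op_mult m (op_leg m p LD)) [0..<k] op_id"

text \<open>A permutation moves the vector in factor \<open>r\<close> to factor \<open>\<sigma> r\<close>.\<close>

definition perm_entry :: "nat \<Rightarrow> (nat \<Rightarrow> nat) \<Rightarrow> 'n list \<Rightarrow> 'n list \<Rightarrow> 'k::field_char_0"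
  where "perm_entry m \<sigma> I J = (if \<forall>r<m. I ! \<sigma> r = J ! r then 1 else 0)"

definition skew_entry :: "nat \<Rightarrow> 'n list \<Rightarrow> 'n list \<Rightarrow> 'k::field_char_0"
  where "skew_entry m I J =
    (1 / fact m) * (\<Sum>\<sigma> | \<sigma> permutes {..<m}. of_int (sign \<sigma>) * perm_entry m \<sigma> I J)"

definition skew_symmetrizer ::
    "nat \<Rightarrow> (('k::field_char_0, 'n::finite) U_gtrig, 'n) op_matrix"
  where "skew_symmetrizer m I J f = fps_const (U_const (skew_entry m I J)) * f"

definition QH :: "nat \<Rightarrow> nat \<Rightarrow> ('k::field_char_0, 'n::finite) U_gtrig fps"
  where "QH m k = (\<Sum>I\<in>multi_idx m. op_mult m (skew_symmetrizer m) (LD_prod m k) I I 1)"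

end

theory Submission
  imports Defs "HOL-Library.FuncSet" "HOL-Library.Multiset"
begin

text \<open>
  The Lie algebra is \<open>t gl\<^sub>N[t]\<close>, with \<open>E\<^sub>i\<^sub>j t\<^sup>k\<close> for the coefficient of \<open>u\<^sup>-\<^sup>k\<close> in the \<open>(i, j)\<close>
  entry of the generating matrix.  For every \<open>n\<close> its enveloping algebra acts on the tensor power
  \<open>V\<^sup>\<otimes>\<^sup>n\<close> with coefficients in polynomials in \<open>t\<^sub>1, \<dots>, t\<^sub>n\<close>: the element \<open>E\<^sub>i\<^sub>j t\<^sup>k\<close> acts as the sum of
  the operators \<open>t\<^sub>s\<^sup>k E\<^sub>i\<^sub>j\<close> in the single slots \<open>s\<close>.  The commutators in question vanish because
  they vanish in all these representations.  Three facts are needed.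

  \<^item> The representations are jointly faithful (\<open>rep_jointly_faithful\<close>).  An element of degree \<open>d\<close> in the
    degree filtration is tested on \<open>d\<close> slots: in the part of the action that involves
    every slot, each slot receives exactly one factor, so that this part is the symmetrization
    of the top symbol, and in characteristic 0 the symbol vanishes with its symmetrization.

  \<^item> In the representations the elements \<open>QH\<^sub>k\<close> have a closed form.  Put \<open>w = u\<^sup>-\<^sup>1\<close> and
    \<open>g\<^sub>s(w) = \<Sum>k\<ge>1. t\<^sub>s\<^sup>k w\<^sup>k\<close>, so that the generating matrix acts as \<open>\<Sum>s. g\<^sub>s(w) E\<^sup>(\<^sup>s\<^sup>)\<close> and \<open>-u d/du\<close>
    is \<open>D = w d/dw\<close>.  The rule \<open>D g\<^sub>s = g\<^sub>s + g\<^sub>s\<^sup>2\<close> produces a term \<open>g\<^sub>s\<^sup>2\<close>.  Such a term also arises when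
    two entries of the matrix product act in the same slot, and after
    antisymmetrization the two contributions cancel (\<open>lax_op_normal_term\<close> and
    \<open>contraction_symmetric\<close>).  This is an identity of Capelli type, as in the work of Mukhin,
    Tarasov and Varchenko.  What remains are products of entries in pairwise different slots, and their
    trace is an antisymmetrizer of these slots.  Up to the factor \<open>1/m!\<close>, every \<open>QH\<^sub>k\<close> therefore acts as an
    integral combination of the series \<open>B\<^sub>j(w) = \<Sum>\<bar>S\<bar>=j. (\<Prod>s\<in>S. g\<^sub>s(w)) A\<^sub>S\<close>, where
    \<open>A\<^sub>S\<close> is the antisymmetrizer of the slots in \<open>S\<close> (\<open>signed_trace_reducible\<close>).

  \<^item> The series \<open>B\<^sub>j(w)\<close> and \<open>B\<^sub>l(z)\<close> commute (\<open>bethe_commute\<close>).  By the relation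
    \<open>(w - z) g\<^sub>s(w) g\<^sub>s(z) = z g\<^sub>s(w) - w g\<^sub>s(z)\<close>, products over overlapping sets of slots reduce to products
    over disjoint ones (\<open>sum_overlapping_products_eq_0\<close>).  The claim becomes that for disjoint \<open>A\<close>, \<open>B\<close> the sum of the commutators
    of \<open>A\<^bsub>A\<union>L\<^esub>\<close> and \<open>A\<^bsub>B\<union>K\<^esub>\<close>, over \<open>K \<subseteq> A\<close> and \<open>L \<subseteq> B\<close> of fixed sizes, is zero.  This is a count of
    factorizations of a permutation \<open>\<pi>\<close> of \<open>A \<union> B\<close>: their number depends only on the cardinality of
    \<open>\<pi>(A) \<inter> B\<close>, and this cardinality is the same for \<open>\<pi>\<close> and its inverse, hence for both orders of the
    factors (\<open>sum_comp_overlapping_symmetric_groups\<close>).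
\<close>

section \<open>Factorizations over two overlapping symmetric groups\<close>

lemma permutes_extension:
  assumes "finite C" "D \<subseteq> C" "inj_on f D" "f ` D \<subseteq> C"
  obtains \<pi> where "\<pi> permutes C" "\<And>x. x \<in> D \<Longrightarrow> \<pi> x = f x"
proof -
  have "card (C - D) = card (C - f ` D)"
    using assms by (simp add: card_Diff_subset finite_subset card_image)
  then obtain h where h: "bij_betw h (C - D) (C - f ` D)"
    using assms(1) finite_same_card_bij by blast
  define \<pi> where "\<pi> x = (if x \<in> D then f x else if x \<in> C then h x else x)" for x
  have "bij_betw \<pi> D (f ` D)"
    using assms(3) by (simp add: \<pi>_def bij_betw_def cong: inj_on_cong)
  moreover have "bij_betw \<pi> (C - D) (C - f ` D)"
    using h by (subst bij_betw_cong[of _ _ h]) (auto simp: \<pi>_def)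
  ultimately have "bij_betw \<pi> (D \<union> (C - D)) (f ` D \<union> (C - f ` D))"
    by (rule bij_betw_combine) auto
  moreover have "D \<union> (C - D) = C" "f ` D \<union> (C - f ` D) = C"
    using assms by auto
  ultimately have "bij_betw \<pi> C C" by simp
  then have "\<pi> permutes C"
    by (rule bij_imp_permutes) (use assms(2) in \<open>auto simp: \<pi>_def\<close>)
  then show ?thesis by (rule that) (simp add: \<pi>_def)
qed

lemma card_permutes_extending:
  assumes "finite C" "D \<subseteq> C" "inj_on f D" "f ` D \<subseteq> C"
  shows "card {\<sigma>. \<sigma> permutes C \<and> (\<forall>x\<in>D. \<sigma> x = f x)} = fact (card C - card D)"
proof -
  obtain \<pi> where \<pi>: "\<pi> permutes C" "\<And>x. x \<in> D \<Longrightarrow> \<pi> x = f x"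
    using permutes_extension[OF assms] by blast
  have "bij_betw ((\<circ>) \<pi>) {\<tau>. \<tau> permutes (C - D)} {\<sigma>. \<sigma> permutes C \<and> (\<forall>x\<in>D. \<sigma> x = f x)}"
  proof (rule bij_betw_byWitness[where f' = "(\<circ>) (inv \<pi>)"])
    show "(\<circ>) \<pi> ` {\<tau>. \<tau> permutes C - D} \<subseteq> {\<sigma>. \<sigma> permutes C \<and> (\<forall>x\<in>D. \<sigma> x = f x)}"
    proof safe
      fix \<tau> assume \<tau>: "\<tau> permutes C - D"
      show "\<pi> \<circ> \<tau> permutes C"
        using permutes_compose[OF permutes_subset[OF \<tau>] \<pi>(1)] by auto
      show "(\<pi> \<circ> \<tau>) x = f x" if "x \<in> D" for x
        using \<tau> that \<pi>(2) by (simp add: permutes_not_in)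
    qed
    show "(\<circ>) (inv \<pi>) ` {\<sigma>. \<sigma> permutes C \<and> (\<forall>x\<in>D. \<sigma> x = f x)} \<subseteq> {\<tau>. \<tau> permutes C - D}"
    proof safe
      fix \<sigma> assume \<sigma>: "\<sigma> permutes C" "\<forall>x\<in>D. \<sigma> x = f x"
      have "inv \<pi> \<circ> \<sigma> permutes C"
        using permutes_compose[OF \<sigma>(1) permutes_inv[OF \<pi>(1)]] .
      then show "inv \<pi> \<circ> \<sigma> permutes C - D"
      proof (rule permutes_superset)
        fix x assume "x \<in> C - (C - D)"
        then have "\<sigma> x = \<pi> x" using \<sigma>(2) \<pi>(2) by auto
        then show "(inv \<pi> \<circ> \<sigma>) x = x"
          using permutes_inverses(2)[OF \<pi>(1)] by simp
      qed
    qed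
  qed (use permutes_inv_o[OF \<pi>(1)] in \<open>auto simp: comp_assoc[symmetric] simp del: comp_apply\<close>)
  then have "card {\<sigma>. \<sigma> permutes C \<and> (\<forall>x\<in>D. \<sigma> x = f x)} = card {\<tau>. \<tau> permutes (C - D)}"
    by (rule bij_betw_same_card[symmetric])
  also have "\<dots> = fact (card C - card D)"
    using assms by (subst card_permutations[OF refl]) (auto simp: card_Diff_subset finite_subset)
  finally show ?thesis .
qed

text \<open>
  In a factorization \<open>\<pi> = \<sigma> \<circ> \<tau>\<close> the factor \<open>\<tau>\<close> fixes \<open>A - K\<close>, so \<open>\<sigma>\<close> agrees with \<open>\<pi>\<close> there,
  and \<open>\<sigma>\<close> fixes \<open>B - L\<close>. Conversely every permutation \<open>\<sigma>\<close> of \<open>A \<union> B\<close> with these two properties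
  occurs, with \<open>\<tau> = inv \<sigma> \<circ> \<pi>\<close>. So the factorizations are the extensions of a partial map to a
  permutation, and these exist exactly when the partial map is injective.
\<close>

lemma card_factorizations:
  assumes "finite A" "finite B" "A \<inter> B = {}" "K \<subseteq> A" "L \<subseteq> B" "\<pi> permutes A \<union> B"
  shows "card {(\<sigma>, \<tau>). \<sigma> permutes A \<union> L \<and> \<tau> permutes B \<union> K \<and> \<sigma> \<circ> \<tau> = \<pi>}
    = (if \<pi> ` (A - K) \<inter> (B - L) = {} then fact (card K + card L) else 0)"
proof -
  let ?D = "(A - K) \<union> (B - L)"
  define f where "f x = (if x \<in> A then \<pi> x else x)" for x
  let ?E = "{\<sigma>. \<sigma> permutes A \<union> B \<and> (\<forall>x\<in>?D. \<sigma> x = f x)}"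
  have "bij_betw fst {(\<sigma>, \<tau>). \<sigma> permutes A \<union> L \<and> \<tau> permutes B \<union> K \<and> \<sigma> \<circ> \<tau> = \<pi>} ?E"
  proof (rule bij_betw_byWitness[where f' = "\<lambda>\<sigma>. (\<sigma>, inv \<sigma> \<circ> \<pi>)"])
    show "\<forall>a\<in>{(\<sigma>, \<tau>). \<sigma> permutes A \<union> L \<and> \<tau> permutes B \<union> K \<and> \<sigma> \<circ> \<tau> = \<pi>}.
        (fst a, inv (fst a) \<circ> \<pi>) = a"
      by (auto simp: comp_assoc[symmetric] permutes_inv_o simp del: comp_apply)
    show "fst ` {(\<sigma>, \<tau>). \<sigma> permutes A \<union> L \<and> \<tau> permutes B \<union> K \<and> \<sigma> \<circ> \<tau> = \<pi>} \<subseteq> ?E"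
    proof (safe; simp)
      fix \<sigma> \<tau>
      assume *: "\<sigma> permutes A \<union> L" "\<tau> permutes B \<union> K" "\<pi> = \<sigma> \<circ> \<tau>"
      show "\<sigma> permutes A \<union> B" using *(1) assms permutes_subset by (metis Un_mono order_refl)
      show "\<sigma> x = f x" if "x \<in> A" "x \<notin> K" for x
      proof -
        have "x \<notin> B \<union> K" using that assms(3) by auto
        then show ?thesis using that * by (simp add: f_def permutes_not_in)
      qed
      show "\<sigma> x = f x" if "x \<in> B" "x \<notin> L" for x
      proof -
        have "x \<notin> A \<union> L" using that assms(3) by auto
        then show ?thesis using that * assms(3) by (auto simp: f_def permutes_not_in)
      qed
    qed
    show "(\<lambda>\<sigma>. (\<sigma>, inv \<sigma> \<circ> \<pi>)) ` ?E
      \<subseteq> {(\<sigma>, \<tau>). \<sigma> permutes A \<union> L \<and> \<tau> permutes B \<union> K \<and> \<sigma> \<circ> \<tau> = \<pi>}"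
    proof safe
      fix \<sigma> assume \<sigma>: "\<sigma> permutes A \<union> B" "\<forall>x\<in>?D. \<sigma> x = f x"
      show "\<sigma> permutes A \<union> L"
        by (rule permutes_superset[OF \<sigma>(1)]) (use \<sigma>(2) assms in \<open>auto simp: f_def\<close>)
      have "inv \<sigma> \<circ> \<pi> permutes A \<union> B"
        using permutes_compose[OF assms(6) permutes_inv[OF \<sigma>(1)]] .
      then show "inv \<sigma> \<circ> \<pi> permutes B \<union> K"
      proof (rule permutes_superset)
        fix x assume "x \<in> A \<union> B - (B \<union> K)"
        then have "\<pi> x = \<sigma> x" using \<sigma>(2) by (auto simp: f_def)
        then show "(inv \<sigma> \<circ> \<pi>) x = x"
          using permutes_inverses(2)[OF \<sigma>(1)] by simp
      qed
      show "\<sigma> \<circ> (inv \<sigma> \<circ> \<pi>) = \<pi>"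
        using permutes_inv_o[OF \<sigma>(1)] by (simp add: comp_assoc[symmetric] del: comp_apply)
    qed
  qed auto
  then have eq: "card {(\<sigma>, \<tau>). \<sigma> permutes A \<union> L \<and> \<tau> permutes B \<union> K \<and> \<sigma> \<circ> \<tau> = \<pi>} = card ?E"
    by (rule bij_betw_same_card)
  have inj: "inj \<pi>" using assms(6) permutes_inj by blast
  show ?thesis
  proof (cases "\<pi> ` (A - K) \<inter> (B - L) = {}")
    case True
    have "inj_on f ?D"
      using True assms(3) inj by (auto simp: inj_on_def f_def)
    moreover have "f ` ?D \<subseteq> A \<union> B"
      using permutes_in_image[OF assms(6)] by (auto simp: f_def)
    ultimately have "card ?E = fact (card (A \<union> B) - card ?D)"
      by (intro card_permutes_extending) (use assms in auto)
    moreover have "A \<union> B - ?D = K \<union> L" using assms by auto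
    then have "card (A \<union> B) - card ?D = card (K \<union> L)"
      using assms by (metis Diff_subset Un_mono card_Diff_subset finite_Diff finite_UnI)
    moreover have "card (K \<union> L) = card K + card L"
      using assms by (intro card_Un_disjoint) (auto intro: finite_subset)
    ultimately show ?thesis using True eq by simp
  next
    case False
    then obtain x where x: "x \<in> A - K" "\<pi> x \<in> B - L" by auto
    have "?E = {}"
    proof safe
      fix \<sigma> assume \<sigma>: "\<sigma> permutes A \<union> B" "\<forall>x\<in>?D. \<sigma> x = f x"
      have "\<pi> x \<notin> A" using x assms(3) by auto
      then have "\<sigma> x = \<pi> x" "\<sigma> (\<pi> x) = \<pi> x" using \<sigma>(2) x by (auto simp: f_def)
      then have "x = \<pi> x" using permutes_inj[OF \<sigma>(1)] by (metis injD)
      then show "\<sigma> \<in> {}" using x assms(3) by auto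
    qed
    then have "card ?E = 0" by (simp only: card.empty)
    then show ?thesis using False eq by simp
  qed
qed

text \<open>
  The condition on \<open>(K, L)\<close> only depends on the partial matching of points \<open>x\<close> of \<open>A\<close> with
  points \<open>\<pi> x\<close> of \<open>B\<close>. The matchings of \<open>\<pi>\<close> and of its inverse have the same number of pairs,
  because a permutation of \<open>A \<union> B\<close> moves as many points from \<open>A\<close> to \<open>B\<close> as from \<open>B\<close> to \<open>A\<close>.
  Hence a permutation of \<open>A\<close> and a permutation of \<open>B\<close> carry one matching to the other, and
  they transport the pairs \<open>(K, L)\<close>.
\<close>

lemma card_blockers_inv:
  assumes "finite A" "finite B" "A \<inter> B = {}" "\<pi> permutes A \<union> B"
  shows "card {(K, L). K \<subseteq> A \<and> card K = p \<and> L \<subseteq> B \<and> card L = q \<and> \<pi> ` (A - K) \<inter> (B - L) = {}}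
    = card {(K, L). K \<subseteq> A \<and> card K = p \<and> L \<subseteq> B \<and> card L = q \<and> inv \<pi> ` (A - K) \<inter> (B - L) = {}}"
    (is "card ?X = card ?Y")
proof -
  define M where "M = {x \<in> A. \<pi> x \<in> B}"
  define M' where "M' = {x \<in> A. inv \<pi> x \<in> B}"
  have inj: "inj \<pi>" using assms(4) permutes_inj by blast
  have inv1: "inv \<pi> (\<pi> x) = x" and inv2: "\<pi> (inv \<pi> x) = x" for x
    using permutes_inverses[OF assms(4)] by auto
  have inji: "inj (inv \<pi>)" by (metis injI inv2)
  have mem: "\<pi> x \<in> A \<union> B \<longleftrightarrow> x \<in> A \<union> B" "inv \<pi> x \<in> A \<union> B \<longleftrightarrow> x \<in> A \<union> B" for x
    using permutes_in_image[OF assms(4)] permutes_in_image[OF permutes_inv[OF assms(4)]] by auto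
  have fin: "finite M" "finite M'" using assms(1) by (auto simp: M_def M'_def)
  have "inv \<pi> ` (A - M') = A - M"
  proof
    show "inv \<pi> ` (A - M') \<subseteq> A - M"
      using mem assms(3) by (fastforce simp: M_def M'_def inv2)
    show "A - M \<subseteq> inv \<pi> ` (A - M')"
    proof
      fix x assume "x \<in> A - M"
      then have "\<pi> x \<in> A - M'" using mem(1)[of x] assms(3) by (auto simp: M_def M'_def inv1)
      then show "x \<in> inv \<pi> ` (A - M')" using inv1 by (metis imageI)
    qed
  qed
  then have "card (A - M') = card (A - M)"
    using card_image[OF inj_on_subset[OF inji subset_UNIV], of "A - M'"] by simp
  moreover have "M \<subseteq> A" "M' \<subseteq> A" by (auto simp: M_def M'_def)
  ultimately have "card M = card M'"
    using assms(1) fin by (metis card_Diff_subset card_mono diff_diff_cancel)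
  then obtain h where h: "bij_betw h M M'" using fin finite_same_card_bij by blast
  have "inj_on h M" "h ` M \<subseteq> A"
    using h by (auto simp: bij_betw_def M'_def)
  then obtain \<alpha> where \<alpha>: "\<alpha> permutes A" "\<And>x. x \<in> M \<Longrightarrow> \<alpha> x = h x"
    using permutes_extension[OF assms(1) \<open>M \<subseteq> A\<close>] by blast
  have \<alpha>M: "\<alpha> ` M = M'" using \<alpha>(2) h by (auto simp: bij_betw_def)
  have 1: "inj_on (\<lambda>y. inv \<pi> (\<alpha> (inv \<pi> y))) (\<pi> ` M)"
    by (rule inj_onI) (metis inv1 inv2 injD permutes_inj[OF \<alpha>(1)])
  have 2: "(\<lambda>y. inv \<pi> (\<alpha> (inv \<pi> y))) ` (\<pi> ` M) \<subseteq> B"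
    using \<alpha>M by (auto simp: inv1 M'_def)
  have "\<pi> ` M \<subseteq> B" by (auto simp: M_def)
  obtain \<beta> where \<beta>: "\<beta> permutes B"
      "\<And>y. y \<in> \<pi> ` M \<Longrightarrow> \<beta> y = inv \<pi> (\<alpha> (inv \<pi> y))"
    using permutes_extension[OF assms(2) \<open>\<pi> ` M \<subseteq> B\<close> 1 2] by blast
  have \<beta>\<pi>: "\<beta> (\<pi> x) = inv \<pi> (\<alpha> x)" if "x \<in> M" for x
    using \<beta>(2)[of "\<pi> x"] that by (simp add: inv1)
  have X: "\<pi> ` (A - K) \<inter> (B - L) = {} \<longleftrightarrow> (\<forall>x\<in>M - K. \<pi> x \<in> L)" for K L
    using \<open>\<pi> ` M \<subseteq> B\<close> by (auto simp: M_def)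
  have Y: "inv \<pi> ` (A - K) \<inter> (B - L) = {} \<longleftrightarrow> (\<forall>x\<in>M' - K. inv \<pi> x \<in> L)" for K L
    by (auto simp: M'_def)
  have key: "(\<forall>x\<in>M - K. \<pi> x \<in> L) \<longleftrightarrow> (\<forall>x\<in>M' - \<alpha> ` K. inv \<pi> x \<in> \<beta> ` L)" for K L
  proof -
    have "(\<forall>x\<in>M' - \<alpha> ` K. inv \<pi> x \<in> \<beta> ` L) \<longleftrightarrow> (\<forall>x\<in>M - K. inv \<pi> (\<alpha> x) \<in> \<beta> ` L)"
      unfolding \<alpha>M[symmetric] using permutes_inj[OF \<alpha>(1)] by (auto dest: injD)
    also have "\<dots> \<longleftrightarrow> (\<forall>x\<in>M - K. \<beta> (\<pi> x) \<in> \<beta> ` L)" by (auto simp: \<beta>\<pi>)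
    also have "\<dots> \<longleftrightarrow> (\<forall>x\<in>M - K. \<pi> x \<in> L)"
      using permutes_inj[OF \<beta>(1)] by (simp add: inj_image_mem_iff)
    finally show ?thesis by simp
  qed
  have cards: "card (\<alpha> ` K) = card K" "card (\<beta> ` L) = card L" for K L
    using permutes_inj[OF \<alpha>(1)] permutes_inj[OF \<beta>(1)] by (auto intro: card_image inj_on_subset)
  have subs: "\<alpha> ` K \<subseteq> A \<longleftrightarrow> K \<subseteq> A" "\<beta> ` L \<subseteq> B \<longleftrightarrow> L \<subseteq> B" for K L
    using permutes_in_image[OF \<alpha>(1)] permutes_in_image[OF \<beta>(1)] by auto
  have surj: "\<alpha> ` (inv \<alpha> ` K) = K" "\<beta> ` (inv \<beta> ` L) = L" for K L
    using permutes_surj[OF \<alpha>(1)] permutes_surj[OF \<beta>(1)] by (simp_all add: image_f_inv_f)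
  have "bij_betw (map_prod ((`) \<alpha>) ((`) \<beta>)) ?X ?Y"
  proof (rule bij_betw_byWitness[where f' = "map_prod ((`) (inv \<alpha>)) ((`) (inv \<beta>))"])
    show "\<forall>a\<in>?X. map_prod ((`) (inv \<alpha>)) ((`) (inv \<beta>)) (map_prod ((`) \<alpha>) ((`) \<beta>) a) = a"
      using permutes_inj[OF \<alpha>(1)] permutes_inj[OF \<beta>(1)] by (auto simp: image_inv_f_f)
    show "\<forall>a\<in>?Y. map_prod ((`) \<alpha>) ((`) \<beta>) (map_prod ((`) (inv \<alpha>)) ((`) (inv \<beta>)) a) = a"
      by (auto simp: surj)
    show "map_prod ((`) \<alpha>) ((`) \<beta>) ` ?X \<subseteq> ?Y"
      by (clarsimp simp: X Y cards subs key)
    show "map_prod ((`) (inv \<alpha>)) ((`) (inv \<beta>)) ` ?Y \<subseteq> ?X"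
    proof (clarsimp simp only: mem_Collect_eq case_prod_conv X Y map_prod_simp)
      fix K L assume *: "K \<subseteq> A" "L \<subseteq> B" "\<forall>x\<in>M' - K. inv \<pi> x \<in> L"
      show "inv \<alpha> ` K \<subseteq> A \<and> card (inv \<alpha> ` K) = card K \<and> inv \<beta> ` L \<subseteq> B \<and> card (inv \<beta> ` L) = card L \<and>
        (\<forall>x\<in>M - inv \<alpha> ` K. \<pi> x \<in> inv \<beta> ` L)"
        using * subs(1)[of "inv \<alpha> ` K"] subs(2)[of "inv \<beta> ` L"] cards(1)[of "inv \<alpha> ` K"]
          cards(2)[of "inv \<beta> ` L"] key[of "inv \<alpha> ` K" "inv \<beta> ` L"] by (simp add: surj)
    qed
  qed
  then show ?thesis by (rule bij_betw_same_card)
qed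

text \<open>
  Reversing the factors replaces the factorizations of \<open>\<pi>\<close> by those of \<open>inv \<pi>\<close>. For fixed \<open>K\<close>
  and \<open>L\<close> the two numbers of factorizations can differ; they agree after summation over all
  \<open>K\<close> and \<open>L\<close> of given sizes.
\<close>

lemma sum_comp_overlapping_symmetric_groups:
  fixes F :: "('a \<Rightarrow> 'a) \<Rightarrow> 'r::ring_1"
  assumes fin: "finite A" "finite B" and dis: "A \<inter> B = {}"
  shows "(\<Sum>K | K \<subseteq> A \<and> card K = p. \<Sum>L | L \<subseteq> B \<and> card L = q.
      \<Sum>\<sigma> | \<sigma> permutes A \<union> L. \<Sum>\<tau> | \<tau> permutes B \<union> K. F (\<sigma> \<circ> \<tau>))
    = (\<Sum>K | K \<subseteq> A \<and> card K = p. \<Sum>L | L \<subseteq> B \<and> card L = q.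
      \<Sum>\<sigma> | \<sigma> permutes A \<union> L. \<Sum>\<tau> | \<tau> permutes B \<union> K. F (\<tau> \<circ> \<sigma>))"
proof -
  let ?P = "{\<pi>. \<pi> permutes A \<union> B}"
  let ?KK = "{K. K \<subseteq> A \<and> card K = p}" and ?LL = "{L. L \<subseteq> B \<and> card L = q}"
  have finP: "finite ?P" using fin by (simp add: finite_permutations)
  have finKL: "finite ?KK" "finite ?LL" using fin by auto
  define blk where "blk \<pi> K L \<longleftrightarrow> \<pi> ` (A - K) \<inter> (B - L) = {}" for \<pi> K L
  have group: "(\<Sum>\<sigma> | \<sigma> permutes A \<union> L. \<Sum>\<tau> | \<tau> permutes B \<union> K. F (c \<sigma> \<tau>))
      = (\<Sum>\<pi>\<in>?P. of_nat (card {(\<sigma>, \<tau>). \<sigma> permutes A \<union> L \<and> \<tau> permutes B \<union> K \<and> c \<sigma> \<tau> = \<pi>}) * F \<pi>)"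
    if KL: "K \<subseteq> A" "L \<subseteq> B" and c: "\<And>\<sigma> \<tau>. \<sigma> permutes A \<union> B \<Longrightarrow> \<tau> permutes A \<union> B \<Longrightarrow> c \<sigma> \<tau> permutes A \<union> B"
    for K L and c :: "('a \<Rightarrow> 'a) \<Rightarrow> ('a \<Rightarrow> 'a) \<Rightarrow> ('a \<Rightarrow> 'a)"
  proof -
    let ?S = "{\<sigma>. \<sigma> permutes A \<union> L} \<times> {\<tau>. \<tau> permutes B \<union> K}"
    have finS: "finite ?S"
      using fin KL by (auto intro!: finite_permutations intro: finite_subset)
    have sub: "\<sigma> permutes A \<union> B" "\<tau> permutes A \<union> B" if "(\<sigma>, \<tau>) \<in> ?S" for \<sigma> \<tau>
      using that KL by (auto elim!: permutes_subset)
    have "(\<Sum>\<sigma> | \<sigma> permutes A \<union> L. \<Sum>\<tau> | \<tau> permutes B \<union> K. F (c \<sigma> \<tau>))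
        = (\<Sum>(\<sigma>, \<tau>)\<in>?S. F (c \<sigma> \<tau>))"
      by (simp add: sum.cartesian_product)
    also have "\<dots> = (\<Sum>\<pi>\<in>?P. \<Sum>x\<in>{x\<in>?S. case_prod c x = \<pi>}. F (case_prod c x))"
      by (subst sum.group[OF finS finP]) (use sub c in \<open>auto simp: case_prod_beta\<close>)
    also have "\<dots> = (\<Sum>\<pi>\<in>?P. of_nat (card {x\<in>?S. case_prod c x = \<pi>}) * F \<pi>)"
      by (intro sum.cong refl) simp
    also have "(\<lambda>\<pi>. {x\<in>?S. case_prod c x = \<pi>})
        = (\<lambda>\<pi>. {(\<sigma>, \<tau>). \<sigma> permutes A \<union> L \<and> \<tau> permutes B \<union> K \<and> c \<sigma> \<tau> = \<pi>})"
      by auto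
    finally show ?thesis by (simp add: fun_eq_iff)
  qed
  have collect: "(\<Sum>K\<in>?KK. \<Sum>L\<in>?LL. \<Sum>\<pi>\<in>?P. of_nat (if blk (i \<pi>) K L then fact (card K + card L) else 0) * F \<pi>)
      = (\<Sum>\<pi>\<in>?P. of_nat (fact (p + q) * card {(K, L). K \<subseteq> A \<and> card K = p \<and> L \<subseteq> B \<and> card L = q \<and> blk (i \<pi>) K L}) * F \<pi>)"
    for i
  proof -
    have "(\<Sum>K\<in>?KK. \<Sum>L\<in>?LL. \<Sum>\<pi>\<in>?P. of_nat (if blk (i \<pi>) K L then fact (card K + card L) else 0) * F \<pi>)
        = (\<Sum>(K, L)\<in>?KK \<times> ?LL. \<Sum>\<pi>\<in>?P. of_nat (if blk (i \<pi>) K L then fact (p + q) else 0) * F \<pi>)"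
      by (subst sum.cartesian_product[symmetric]) (auto intro!: sum.cong)
    also have "\<dots> = (\<Sum>\<pi>\<in>?P. of_nat (\<Sum>(K, L)\<in>?KK \<times> ?LL. if blk (i \<pi>) K L then fact (p + q) else 0) * F \<pi>)"
      unfolding case_prod_beta by (subst sum.swap) (simp add: sum_distrib_right of_nat_sum)
    also have "\<dots> = (\<Sum>\<pi>\<in>?P. of_nat (fact (p + q) * card {(K, L). K \<subseteq> A \<and> card K = p \<and> L \<subseteq> B \<and> card L = q \<and> blk (i \<pi>) K L}) * F \<pi>)"
    proof (intro sum.cong refl arg_cong2[where f = "(*)"] arg_cong[where f = of_nat])
      fix \<pi>
      have "(\<Sum>(K, L)\<in>?KK \<times> ?LL. if blk (i \<pi>) K L then fact (p + q) else 0)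
          = (\<Sum>x\<in>{x\<in>?KK \<times> ?LL. blk (i \<pi>) (fst x) (snd x)}. fact (p + q) :: nat)"
        unfolding case_prod_beta by (rule sum.inter_filter[symmetric]) (use finKL in auto)
      also have "\<dots> = fact (p + q) * card {x\<in>?KK \<times> ?LL. blk (i \<pi>) (fst x) (snd x)}"
        by simp
      also have "{x\<in>?KK \<times> ?LL. blk (i \<pi>) (fst x) (snd x)}
          = {(K, L). K \<subseteq> A \<and> card K = p \<and> L \<subseteq> B \<and> card L = q \<and> blk (i \<pi>) K L}" by auto
      finally show "(\<Sum>(K, L)\<in>?KK \<times> ?LL. if blk (i \<pi>) K L then fact (p + q) else 0)
        = fact (p + q) * card {(K, L). K \<subseteq> A \<and> card K = p \<and> L \<subseteq> B \<and> card L = q \<and> blk (i \<pi>) K L}" .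
    qed
    finally show ?thesis .
  qed
  have L: "(\<Sum>K\<in>?KK. \<Sum>L\<in>?LL. \<Sum>\<sigma> | \<sigma> permutes A \<union> L. \<Sum>\<tau> | \<tau> permutes B \<union> K. F (\<sigma> \<circ> \<tau>))
      = (\<Sum>K\<in>?KK. \<Sum>L\<in>?LL. \<Sum>\<pi>\<in>?P. of_nat (if blk \<pi> K L then fact (card K + card L) else 0) * F \<pi>)"
  proof (rule sum.cong[OF refl], rule sum.cong[OF refl])
    fix K L assume KL: "K \<in> ?KK" "L \<in> ?LL"
    show "(\<Sum>\<sigma> | \<sigma> permutes A \<union> L. \<Sum>\<tau> | \<tau> permutes B \<union> K. F (\<sigma> \<circ> \<tau>))
      = (\<Sum>\<pi>\<in>?P. of_nat (if blk \<pi> K L then fact (card K + card L) else 0) * F \<pi>)"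
    proof -
      have "(\<Sum>\<sigma> | \<sigma> permutes A \<union> L. \<Sum>\<tau> | \<tau> permutes B \<union> K. F (\<sigma> \<circ> \<tau>))
        = (\<Sum>\<pi>\<in>?P. of_nat (card {(\<sigma>, \<tau>). \<sigma> permutes A \<union> L \<and> \<tau> permutes B \<union> K \<and> \<sigma> \<circ> \<tau> = \<pi>}) * F \<pi>)"
        by (rule group[where c = "(\<circ>)"]) (use KL in \<open>auto intro: permutes_compose\<close>)
      also have "\<dots> = (\<Sum>\<pi>\<in>?P. of_nat (if blk (\<pi>) K L then fact (card K + card L) else 0) * F \<pi>)"
        using KL by (intro sum.cong refl) (simp add: card_factorizations[OF fin dis] blk_def)
      finally show ?thesis .
    qed
  qed
  have flip: "card {(\<sigma>, \<tau>). \<sigma> permutes S \<and> \<tau> permutes T \<and> \<tau> \<circ> \<sigma> = \<pi>}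
      = card {(\<sigma>, \<tau>). \<sigma> permutes S \<and> \<tau> permutes T \<and> \<sigma> \<circ> \<tau> = inv \<pi>}" if "bij \<pi>" for S T and \<pi> :: "'a \<Rightarrow> 'a"
  proof -
    have "bij_betw (map_prod inv inv) {(\<sigma>, \<tau>). \<sigma> permutes S \<and> \<tau> permutes T \<and> \<tau> \<circ> \<sigma> = \<pi>}
       {(\<sigma>, \<tau>). \<sigma> permutes S \<and> \<tau> permutes T \<and> \<sigma> \<circ> \<tau> = inv \<pi>}"
    proof (rule bij_betw_byWitness[where f' = "map_prod inv inv"])
      show "map_prod inv inv ` {(\<sigma>, \<tau>). \<sigma> permutes S \<and> \<tau> permutes T \<and> \<tau> \<circ> \<sigma> = \<pi>}
        \<subseteq> {(\<sigma>, \<tau>). \<sigma> permutes S \<and> \<tau> permutes T \<and> \<sigma> \<circ> \<tau> = inv \<pi>}"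
        by (auto simp: permutes_inv o_inv_distrib permutes_bij)
      show "map_prod inv inv ` {(\<sigma>, \<tau>). \<sigma> permutes S \<and> \<tau> permutes T \<and> \<sigma> \<circ> \<tau> = inv \<pi>}
        \<subseteq> {(\<sigma>, \<tau>). \<sigma> permutes S \<and> \<tau> permutes T \<and> \<tau> \<circ> \<sigma> = \<pi>}"
      proof (rule image_subsetI)
        fix x assume "x \<in> {(\<sigma>, \<tau>). \<sigma> permutes S \<and> \<tau> permutes T \<and> \<sigma> \<circ> \<tau> = inv \<pi>}"
        then obtain \<sigma> \<tau> where *: "x = (\<sigma>, \<tau>)" "\<sigma> permutes S" "\<tau> permutes T" "\<sigma> \<circ> \<tau> = inv \<pi>"
          by blast
        have "inv \<tau> \<circ> inv \<sigma> = inv (\<sigma> \<circ> \<tau>)"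
          using *(2,3) by (simp add: o_inv_distrib permutes_bij)
        then have "inv \<tau> \<circ> inv \<sigma> = \<pi>" using *(4) that by (simp add: inv_inv_eq)
        then show "map_prod inv inv x \<in> {(\<sigma>, \<tau>). \<sigma> permutes S \<and> \<tau> permutes T \<and> \<tau> \<circ> \<sigma> = \<pi>}"
          using *(1-3) by (simp add: permutes_inv)
      qed
    qed (use that in \<open>auto simp: permutes_bij inv_inv_eq\<close>)
    then show ?thesis using that by (auto dest: bij_betw_same_card)
  qed
  have R: "(\<Sum>K\<in>?KK. \<Sum>L\<in>?LL. \<Sum>\<sigma> | \<sigma> permutes A \<union> L. \<Sum>\<tau> | \<tau> permutes B \<union> K. F (\<tau> \<circ> \<sigma>))
      = (\<Sum>K\<in>?KK. \<Sum>L\<in>?LL. \<Sum>\<pi>\<in>?P. of_nat (if blk (inv \<pi>) K L then fact (card K + card L) else 0) * F \<pi>)"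
  proof (rule sum.cong[OF refl], rule sum.cong[OF refl])
    fix K L assume KL: "K \<in> ?KK" "L \<in> ?LL"
    show "(\<Sum>\<sigma> | \<sigma> permutes A \<union> L. \<Sum>\<tau> | \<tau> permutes B \<union> K. F (\<tau> \<circ> \<sigma>))
      = (\<Sum>\<pi>\<in>?P. of_nat (if blk (inv \<pi>) K L then fact (card K + card L) else 0) * F \<pi>)"
    proof -
      have "(\<Sum>\<sigma> | \<sigma> permutes A \<union> L. \<Sum>\<tau> | \<tau> permutes B \<union> K. F (\<tau> \<circ> \<sigma>))
        = (\<Sum>\<pi>\<in>?P. of_nat (card {(\<sigma>, \<tau>). \<sigma> permutes A \<union> L \<and> \<tau> permutes B \<union> K \<and> \<tau> \<circ> \<sigma> = \<pi>}) * F \<pi>)"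
        by (rule group[where c = "\<lambda>\<sigma> \<tau>. \<tau> \<circ> \<sigma>"]) (use KL in \<open>auto intro: permutes_compose\<close>)
      also have "\<dots> = (\<Sum>\<pi>\<in>?P. of_nat (if blk (inv \<pi>) K L then fact (card K + card L) else 0) * F \<pi>)"
        using KL by (intro sum.cong refl) (simp add: flip permutes_bij permutes_inv card_factorizations[OF fin dis] blk_def)
      finally show ?thesis .
    qed
  qed
  show ?thesis
    unfolding L R collect collect[where i = id, simplified]
    by (intro sum.cong refl) (use card_blockers_inv[OF fin dis, of _ p q] in \<open>simp add: blk_def\<close>)
qed

section \<open>Products over overlapping index sets\<close>

text \<open>
  After multiplication by a power of \<open>\<omega> - \<zeta>\<close>, the hypothesis on \<open>x s * y s\<close> leaves for every
  index of \<open>S \<inter> S'\<close> either \<open>x s\<close> or \<open>y s\<close>. Collect the terms in which \<open>x\<close> runs over \<open>A\<close> and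
  \<open>y\<close> over \<open>B\<close>: with \<open>K\<close> and \<open>L\<close> the indices of \<open>S \<inter> S'\<close> that went to \<open>A\<close> and to \<open>B\<close>, one has
  \<open>S = A \<union> L\<close> and \<open>S' = B \<union> K\<close>. The sizes of \<open>K\<close> and \<open>L\<close> are determined by \<open>A\<close> and \<open>B\<close>, so the
  powers of \<open>\<omega>\<close> and \<open>\<zeta>\<close> are common factors and the sums that the last hypothesis controls
  remain.
\<close>

lemma sum_overlapping_products_eq_0:
  fixes x y :: "'a \<Rightarrow> 'r::idom" and d :: "'a set \<Rightarrow> 'a set \<Rightarrow> 'r"
  assumes V: "finite V" and neq: "\<omega> \<noteq> \<zeta>"
    and rel: "\<And>s. s \<in> V \<Longrightarrow> (\<omega> - \<zeta>) * (x s * y s) = \<zeta> * x s - \<omega> * y s"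
    and vanish: "\<And>A B p q. A \<subseteq> V \<Longrightarrow> B \<subseteq> V \<Longrightarrow> A \<inter> B = {} \<Longrightarrow>
      (\<Sum>K | K \<subseteq> A \<and> card K = p. \<Sum>L | L \<subseteq> B \<and> card L = q. d (A \<union> L) (B \<union> K)) = 0"
  shows "(\<Sum>S | S \<subseteq> V \<and> card S = j. \<Sum>S' | S' \<subseteq> V \<and> card S' = l. prod x S * prod y S' * d S S') = 0"
proof -
  let ?\<delta> = "\<omega> - \<zeta>" and ?n = "card V"
  let ?SS = "{S. S \<subseteq> V \<and> card S = j}" and ?TT = "{S. S \<subseteq> V \<and> card S = l}"
  \<comment> \<open>The contribution of one quadruple \<open>(A, B, K, L)\<close>, in the common multiple by \<open>(\<omega> - \<zeta>)\<close> to the power \<open>card V\<close>.\<close>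
  define W where "W A B K L = ?\<delta> ^ (?n - (card K + card L)) * \<zeta> ^ card K * (- \<omega>) ^ card L
    * prod x A * prod y B * d (A \<union> L) (B \<union> K)" for A B K L
  have step: "?\<delta> ^ ?n * (prod x S * prod y S' * d S S')
      = (\<Sum>K\<in>Pow (S \<inter> S'). W (S - (S \<inter> S' - K)) (S' - K) K (S \<inter> S' - K))"
    if "S \<subseteq> V" "S' \<subseteq> V" for S S'
  proof -
    let ?I = "S \<inter> S'"
    have fin: "finite S" "finite S'" using that V by (auto intro: finite_subset)
    have le: "card ?I \<le> ?n" using that V by (intro card_mono) auto
    have xS: "prod x S = prod x (S - ?I) * prod x ?I" "prod y S' = prod y (S' - ?I) * prod y ?I"
      using fin by (auto intro!: prod.subset_diff)
    have split: "?\<delta> ^ ?n = ?\<delta> ^ (?n - card ?I) * ?\<delta> ^ card ?I"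
      using le by (simp add: power_add[symmetric])
    have "?\<delta> ^ card ?I * (prod x ?I * prod y ?I) = (\<Prod>s\<in>?I. ?\<delta> * (x s * y s))"
      by (simp add: prod.distrib)
    also have "\<dots> = (\<Prod>s\<in>?I. \<zeta> * x s + (- \<omega>) * y s)"
      using that by (intro prod.cong refl) (subst rel, auto)
    also have "\<dots> = (\<Sum>K\<in>Pow ?I. (\<Prod>s\<in>K. \<zeta> * x s) * (\<Prod>s\<in>?I - K. (- \<omega>) * y s))"
      using fin by (intro prod_add) auto
    finally have expand: "(\<Sum>K\<in>Pow ?I. (\<Prod>s\<in>K. \<zeta> * x s) * (\<Prod>s\<in>?I - K. (- \<omega>) * y s))
      = ?\<delta> ^ card ?I * (prod x ?I * prod y ?I)" ..
    have "?\<delta> ^ ?n * (prod x S * prod y S' * d S S')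
        = ?\<delta> ^ (?n - card ?I) * prod x (S - ?I) * prod y (S' - ?I) * d S S'
          * (\<Sum>K\<in>Pow ?I. (\<Prod>s\<in>K. \<zeta> * x s) * (\<Prod>s\<in>?I - K. (- \<omega>) * y s))"
      unfolding expand xS split by (simp only: mult_ac)
    also have "\<dots> = (\<Sum>K\<in>Pow ?I. W (S - (?I - K)) (S' - K) K (?I - K))"
      unfolding sum_distrib_left
    proof (rule sum.cong[OF refl])
      fix K assume "K \<in> Pow ?I"
      then have K: "K \<subseteq> ?I" by simp
      have finK: "finite K" using K fin by (auto intro: finite_subset)
      have c: "card K + card (?I - K) = card ?I"
        using K fin by (metis card_Diff_subset card_mono finK finite_Int le_add_diff_inverse)
      have "S - (?I - K) = (S - ?I) \<union> K" "S' - K = (S' - ?I) \<union> (?I - K)" using K by auto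
      then have "prod x (S - (?I - K)) = prod x (S - ?I) * prod x K"
        "prod y (S' - K) = prod y (S' - ?I) * prod y (?I - K)"
        using K fin finK by (auto intro!: prod.union_disjoint)
      moreover have "S - (?I - K) \<union> (?I - K) = S" "S' - K \<union> K = S'" using K by auto
      ultimately show "?\<delta> ^ (?n - card ?I) * prod x (S - ?I) * prod y (S' - ?I) * d S S'
          * ((\<Prod>s\<in>K. \<zeta> * x s) * (\<Prod>s\<in>?I - K. (- \<omega>) * y s)) = W (S - (?I - K)) (S' - K) K (?I - K)"
        unfolding W_def c by (simp only: prod.distrib prod_constant mult_ac)
    qed
    finally show ?thesis .
  qed
  have fin: "finite ?SS" "finite ?TT" using V by auto
  have finS: "finite S" if "S \<subseteq> V" for S using V that by (rule finite_subset[rotated])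
  have finL: "finite {L. L \<subseteq> B \<and> card A + card L = j}" if "B \<subseteq> V - A" for A B
    using finS[of B] that by (auto intro: finite_subset[of _ "Pow B"])
  have "?\<delta> ^ ?n * (\<Sum>S\<in>?SS. \<Sum>S'\<in>?TT. prod x S * prod y S' * d S S')
      = (\<Sum>S\<in>?SS. \<Sum>S'\<in>?TT. \<Sum>K\<in>Pow (S \<inter> S'). W (S - (S \<inter> S' - K)) (S' - K) K (S \<inter> S' - K))"
    unfolding sum_distrib_left by (intro sum.cong refl step) auto
  also have "\<dots> = (\<Sum>(S, S', K)\<in>(SIGMA S:?SS. SIGMA S':?TT. Pow (S \<inter> S')).
      W (S - (S \<inter> S' - K)) (S' - K) K (S \<inter> S' - K))"
    using V by (simp add: sum.Sigma finite_subset finS)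
  also have "\<dots> = (\<Sum>(A, B, K, L)\<in>(SIGMA A:Pow V. SIGMA B:Pow (V - A).
      SIGMA K:{K. K \<subseteq> A \<and> card B + card K = l}. {L. L \<subseteq> B \<and> card A + card L = j}). W A B K L)"
  proof (rule sum.reindex_bij_witness[where j = "\<lambda>(S, S', K). (S - (S \<inter> S' - K), S' - K, K, S \<inter> S' - K)"
        and i = "\<lambda>(A, B, K, L). (A \<union> L, B \<union> K, K)"], goal_cases)
    case (1 a)
    then show ?case by auto
  next
    case (2 a)
    obtain S S' K where a: "a = (S, S', K)" by (cases a)
    with 2 have *: "S \<subseteq> V" "S' \<subseteq> V" "card S = j" "card S' = l" "K \<subseteq> S \<inter> S'" by auto
    then have "card (S - (S \<inter> S' - K)) + card (S \<inter> S' - K) = j" "card (S' - K) + card K = l"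
      by (metis (no_types, lifting) Diff_subset card_Diff_subset card_mono finS finite_Diff finite_Int
          inf_le1 le_add_diff_inverse2 order_trans,
          metis card_Diff_subset card_mono finS finite_subset inf_le2 le_add_diff_inverse2 order_trans)
    then show ?case using * a by auto
  next
    case (3 a)
    then show ?case by auto
  next
    case (4 a)
    then obtain A B K L where a: "a = (A, B, K, L)" and *: "A \<subseteq> V" "B \<subseteq> V - A"
        "K \<subseteq> A" "card B + card K = l" "L \<subseteq> B" "card A + card L = j" by auto
    have "card (A \<union> L) = card A + card L" "card (B \<union> K) = card B + card K"
      using * finS[of A] finS[of B]
      by (auto intro!: card_Un_disjoint intro: finite_subset)
    then show ?case using a * by auto
  next
    case (5 a)
    then show ?case by auto
  qed
  also have "\<dots> = (\<Sum>A\<in>Pow V. \<Sum>B\<in>Pow (V - A). \<Sum>K | K \<subseteq> A \<and> card B + card K = l.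
      \<Sum>L | L \<subseteq> B \<and> card A + card L = j. W A B K L)"
    using V finS finL by (auto simp add: sum.Sigma[symmetric] intro!: finite_SigmaI sum.Sigma[symmetric, THEN trans] sum.cong)
  also have "\<dots> = 0"
  proof (rule sum.neutral, rule ballI, rule sum.neutral, rule ballI)
    fix A B assume AB: "A \<in> Pow V" "B \<in> Pow (V - A)"
    show "(\<Sum>K | K \<subseteq> A \<and> card B + card K = l. \<Sum>L | L \<subseteq> B \<and> card A + card L = j. W A B K L) = 0"
    proof (cases "card B \<le> l \<and> card A \<le> j")
      case True
      let ?p = "l - card B" and ?q = "j - card A"
      have "{K. K \<subseteq> A \<and> card B + card K = l} = {K. K \<subseteq> A \<and> card K = ?p}"
        "{L. L \<subseteq> B \<and> card A + card L = j} = {L. L \<subseteq> B \<and> card L = ?q}" using True by auto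
      then have "(\<Sum>K | K \<subseteq> A \<and> card B + card K = l. \<Sum>L | L \<subseteq> B \<and> card A + card L = j. W A B K L)
        = ?\<delta> ^ (?n - (?p + ?q)) * \<zeta> ^ ?p * (- \<omega>) ^ ?q * prod x A * prod y B
          * (\<Sum>K | K \<subseteq> A \<and> card K = ?p. \<Sum>L | L \<subseteq> B \<and> card L = ?q. d (A \<union> L) (B \<union> K))"
        unfolding sum_distrib_left W_def by (simp add: mult.assoc)
      then show ?thesis using vanish[of A B] AB by (simp add: subset_Diff_insert) blast
    next
      case False
      then have "{K. K \<subseteq> A \<and> card B + card K = l} = {} \<or> {L. L \<subseteq> B \<and> card A + card L = j} = {}" by auto
      then show ?thesis by (metis (no_types, lifting) sum.empty sum.neutral)
    qed
  qed
  finally show ?thesis using neq by simp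
qed

section \<open>Operators on tensor powers\<close>

text \<open>
  A tensor in \<open>V\<^sup>\<otimes>\<^sup>n\<close> is given by its coordinates, a function on configurations \<open>'x\<close>, which
  assign a basis index to every slot. The linear operators on such functions form a type of
  class \<open>ring_1\<close>, so that power series of operators are available.
\<close>

typedef (overloaded) ('x, 'c) lop =
  "{T :: ('x \<Rightarrow> 'c::comm_ring_1) \<Rightarrow> 'x \<Rightarrow> 'c.
     (\<forall>f g. T (\<lambda>x. f x + g x) = (\<lambda>x. T f x + T g x)) \<and> (\<forall>c f. T (\<lambda>x. c * f x) = (\<lambda>x. c * T f x))}"
  morphisms app Lop
  by (rule exI[of _ id]) simp

setup_lifting type_definition_lop

lemma app_add_fun: "app T (\<lambda>x. f x + g x) = (\<lambda>x. app T f x + app T g x)"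
  and app_scale_fun: "app T (\<lambda>x. c * f x) = (\<lambda>x. c * app T f x)"
  using app[of T] by auto

lemma lop_eqI: "(\<And>f x. app S f x = app T f x) \<Longrightarrow> S = T"
  by (metis app_inject ext)

instantiation lop :: (type, comm_ring_1) ring_1
begin

lift_definition zero_lop :: "('a, 'b) lop" is "\<lambda>f x. 0" by simp
lift_definition one_lop :: "('a, 'b) lop" is "\<lambda>f. f" by simp
lift_definition plus_lop :: "('a, 'b) lop \<Rightarrow> ('a, 'b) lop \<Rightarrow> ('a, 'b) lop"
  is "\<lambda>S T f x. S f x + T f x" by (simp add: algebra_simps)
lift_definition uminus_lop :: "('a, 'b) lop \<Rightarrow> ('a, 'b) lop"
  is "\<lambda>S f x. - S f x" by (simp add: algebra_simps)
lift_definition minus_lop :: "('a, 'b) lop \<Rightarrow> ('a, 'b) lop \<Rightarrow> ('a, 'b) lop"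
  is "\<lambda>S T f x. S f x - T f x" by (simp add: algebra_simps)
lift_definition times_lop :: "('a, 'b) lop \<Rightarrow> ('a, 'b) lop \<Rightarrow> ('a, 'b) lop"
  is "\<lambda>S T f. S (T f)" by simp

instance
proof
  fix R S T :: "('a, 'b) lop"
  show "R * S * T = R * (S * T)" "R + S + T = R + (S + T)" "R + S = S + R" "0 + R = R"
    "1 * R = R" "R * 1 = R" "- R + R = 0" "R - S = R + - S" "(R + S) * T = R * T + S * T"
    by (transfer; simp add: fun_eq_iff algebra_simps)+
  show "R * (S + T) = R * S + R * T"
    by (rule lop_eqI) (simp add: times_lop.rep_eq plus_lop.rep_eq app_add_fun)
  show "(0 :: ('a, 'b) lop) \<noteq> 1"
    by transfer (metis zero_neq_one)
qed

end

lemma app_simps [simp]: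
  "app 0 f x = 0" "app 1 f x = f x" "app (S + T) f x = app S f x + app T f x"
  "app (S - T) f x = app S f x - app T f x" "app (- S) f x = - app S f x"
  "app (S * T) f x = app S (app T f) x"
  by (simp_all add: zero_lop.rep_eq one_lop.rep_eq plus_lop.rep_eq minus_lop.rep_eq
      uminus_lop.rep_eq times_lop.rep_eq)

lemma app_sum: "app (sum T A) f x = (\<Sum>a\<in>A. app (T a) f x)"
  by (induction A rule: infinite_finite_induct) simp_all

lemma app_of_nat [simp]: "app (of_nat n) f x = of_nat n * f x"
  by (induction n) (simp_all add: algebra_simps)

lift_definition scalar :: "'c::comm_ring_1 \<Rightarrow> ('x, 'c) lop" is "\<lambda>c f x. c * f x"
  by (simp add: algebra_simps)

lemma app_scalar [simp]: "app (scalar c) f x = c * f x"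
  by (simp add: scalar.rep_eq)

lemma scalar_comm: "T * scalar c = scalar c * T"
  by (rule lop_eqI) (simp add: scalar.rep_eq app_scale_fun)

lemma scalar_hom [simp]:
  "scalar 0 = 0" "scalar 1 = 1" "scalar (c + d) = scalar c + scalar d"
  "scalar (c * d) = scalar c * scalar d" "scalar (c - d) = scalar c - scalar d"
  by (rule lop_eqI; simp add: algebra_simps)+

lemma scalar_mult_swap: "scalar x * A * (scalar y * B) = scalar (x * y) * (A * B)"
proof -
  have "scalar x * A * (scalar y * B) = scalar x * (A * scalar y) * B" by (simp only: mult.assoc)
  then show ?thesis by (simp only: scalar_comm[of A] scalar_hom mult.assoc)
qed

lemma scalar_sum: "scalar (sum c A) = (\<Sum>a\<in>A. scalar (c a))"
  by (induction A rule: infinite_finite_induct) simp_all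

lemma scalar_of_nat [simp]: "scalar (of_nat n) = of_nat n"
  by (rule lop_eqI) simp

lift_definition munit :: "'s \<Rightarrow> 'n \<Rightarrow> 'n \<Rightarrow> ('s \<Rightarrow> 'n, 'c::comm_ring_1) lop"
  is "\<lambda>s i j f x. if x s = i then f (x(s := j)) else 0"
  by (auto simp: fun_eq_iff)

lemma app_munit: "app (munit s i j) f x = (if x s = i then f (x(s := j)) else 0)"
  by (simp add: munit.rep_eq)

lemma munit_mult: "munit s i j * munit s k l = (if j = k then munit s i l else 0)"
  by (rule lop_eqI) (auto simp: app_munit)

lemma munit_commute: "s \<noteq> s' \<Longrightarrow> munit s i j * munit s' k l = munit s' k l * munit s i j"
  by (rule lop_eqI) (auto simp: app_munit fun_upd_twist)

text \<open>
  The configuration \<open>x\<close> with the slots \<open>s p\<close>, for \<open>p\<close> in \<open>T\<close>, set to \<open>I p\<close>. It is meant for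
  \<open>s\<close> injective on \<open>T\<close>.
\<close>

definition overwrite :: "'p set \<Rightarrow> ('p \<Rightarrow> 's) \<Rightarrow> ('p \<Rightarrow> 'n) \<Rightarrow> ('s \<Rightarrow> 'n) \<Rightarrow> 's \<Rightarrow> 'n" where
  "overwrite T s I x r = (if r \<in> s ` T then I (inv_into T s r) else x r)"

lemma overwrite_image: "inj_on s T \<Longrightarrow> p \<in> T \<Longrightarrow> overwrite T s I x (s p) = I p"
  by (simp add: overwrite_def)

lemma overwrite_other: "r \<notin> s ` T \<Longrightarrow> overwrite T s I x r = x r"
  by (simp add: overwrite_def)

text \<open>
  The product over \<open>p\<close> in \<open>T\<close> of the matrix units \<open>munit (s p) (K p) (I p)\<close>. For \<open>s\<close> injective
  on \<open>T\<close> they act in different slots and commute; a direct formula avoids the choice of an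
  order.
\<close>

lift_definition munits :: "'p set \<Rightarrow> ('p \<Rightarrow> 's) \<Rightarrow> ('p \<Rightarrow> 'n) \<Rightarrow> ('p \<Rightarrow> 'n) \<Rightarrow> ('s \<Rightarrow> 'n, 'c::comm_ring_1) lop"
  is "\<lambda>T s K I f x. if \<forall>p\<in>T. x (s p) = K p then f (overwrite T s I x) else 0"
  by (auto simp: fun_eq_iff)

lemma app_munits: "app (munits T s K I) f x =
    (if \<forall>p\<in>T. x (s p) = K p then f (overwrite T s I x) else 0)"
  by (simp add: munits.rep_eq)

lemma munits_empty: "munits {} s K I = 1"
  by (rule lop_eqI) (simp add: app_munits overwrite_def[abs_def])

lemma munit_munits_new:
  assumes "q \<notin> T" "inj_on s (insert q T)"
  shows "munit (s q) (K q) (I q) * munits T s K I = munits (insert q T) s K I"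
proof (rule lop_eqI)
  fix f :: "('b \<Rightarrow> 'c) \<Rightarrow> 'd" and x
  have sq: "s q \<notin> s ` T" and injT: "inj_on s T" using assms by auto
  have "overwrite T s I (x(s q := I q)) r = overwrite (insert q T) s I x r" for r
  proof (cases "r \<in> s ` insert q T")
    case True
    then obtain p where p: "p \<in> insert q T" "r = s p" by auto
    then show ?thesis
      by (cases "p = q")
        (simp_all add: overwrite_image[OF assms(2)] overwrite_image[OF injT] overwrite_other[OF sq])
  qed (auto simp: overwrite_other)
  then have "overwrite T s I (x(s q := I q)) = overwrite (insert q T) s I x" by (rule ext)
  moreover have "(\<forall>p\<in>T. (x(s q := I q)) (s p) = K p) \<longleftrightarrow> (\<forall>p\<in>T. x (s p) = K p)"
    using sq by (metis fun_upd_other imageI)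
  ultimately show "app (munit (s q) (K q) (I q) * munits T s K I) f x = app (munits (insert q T) s K I) f x"
    by (simp add: app_munit app_munits)
qed

lemma munit_munits_old:
  assumes "p \<in> T" "inj_on s T"
  shows "munit (s p) i j * munits T s K I = (if j = K p then munits T s (K(p := i)) I else 0)"
proof (rule lop_eqI)
  fix f :: "('b \<Rightarrow> 'c) \<Rightarrow> 'd" and x
  have "overwrite T s I (x(s p := j)) r = overwrite T s I x r" for r
    using assms by (auto simp: overwrite_def)
  then have ov: "overwrite T s I (x(s p := j)) = overwrite T s I x" by (rule ext)
  have iff: "(x (s p) = i \<and> (\<forall>p'\<in>T. (x(s p := j)) (s p') = K p'))
      \<longleftrightarrow> j = K p \<and> (\<forall>p'\<in>T. x (s p') = (K(p := i)) p')"
  proof -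
    obtain T' where T': "T = insert p T'" "p \<notin> T'"
      using assms(1) by (rule Set.set_insert)
    have "(x(s p := j)) (s p') = x (s p')" "(K(p := i)) p' = K p'" if "p' \<in> T'" for p'
      using assms(2) that T' by (auto simp: inj_on_def)
    then have "(\<forall>p'\<in>T'. (x(s p := j)) (s p') = K p') \<longleftrightarrow> (\<forall>p'\<in>T'. x (s p') = (K(p := i)) p')"
      by (simp del: fun_upd_apply cong: ball_cong)
    then show ?thesis
      unfolding T'(1) ball_simps(7) by (simp only: fun_upd_same) blast
  qed
  have "app (munit (s p) i j * munits T s K I) f x
      = (if x (s p) = i \<and> (\<forall>p'\<in>T. (x(s p := j)) (s p') = K p') then f (overwrite T s I (x(s p := j))) else 0)"
    by (cases "x (s p) = i") (simp_all only: app_simps app_munit app_munits simp_thms if_True if_False)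
  also have "\<dots> = (if j = K p \<and> (\<forall>p'\<in>T. x (s p') = (K(p := i)) p') then f (overwrite T s I x) else 0)"
    by (simp only: iff ov)
  also have "\<dots> = app (if j = K p then munits T s (K(p := i)) I else 0) f x"
    by (cases "j = K p") (simp_all only: app_simps app_munits simp_thms if_True if_False)
  finally show "app (munit (s p) i j * munits T s K I) f x
      = app (if j = K p then munits T s (K(p := i)) I else 0) f x" .
qed

lift_definition permop :: "('s \<Rightarrow> 's) \<Rightarrow> ('s \<Rightarrow> 'n, 'c::comm_ring_1) lop"
  is "\<lambda>\<pi> f x. f (x \<circ> \<pi>)" by simp

lemma app_permop: "app (permop \<pi>) f x = f (x \<circ> \<pi>)"
  by (simp add: permop.rep_eq)

lemma permop_mult: "permop \<pi> * permop \<tau> = permop (\<pi> \<circ> \<tau>)"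
  by (rule lop_eqI) (simp add: app_permop[abs_def] comp_assoc)

text \<open>
  The row conditions force \<open>I p\<close> to be the entry of the configuration in slot \<open>s (inv \<sigma> p)\<close>,
  so exactly one summand is not zero at a given configuration, and it writes permuted entries
  back into the slots.
\<close>

lemma sum_munits_permuted_rows:
  fixes T :: "'p set"
  assumes T: "finite T" "inj_on s T" "\<sigma> permutes T"
  shows "(\<Sum>I\<in>T \<rightarrow>\<^sub>E UNIV. munits T s (I \<circ> \<sigma>) I :: ('s \<Rightarrow> 'n::finite, 'c::comm_ring_1) lop)
    = permop (map_permutation T s (inv \<sigma>))"
proof (rule lop_eqI)
  fix f :: "('s \<Rightarrow> 'n) \<Rightarrow> 'c" and x :: "'s \<Rightarrow> 'n"
  define J where "J = restrict (\<lambda>p. x (s (inv \<sigma> p))) T"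
  have mem: "\<sigma> p \<in> T \<longleftrightarrow> p \<in> T" "inv \<sigma> p \<in> T \<longleftrightarrow> p \<in> T" for p
    using permutes_in_image[OF T(3)] permutes_in_image[OF permutes_inv[OF T(3)]] by auto
  have iff: "(\<forall>p\<in>T. x (s p) = (I \<circ> \<sigma>) p) \<longleftrightarrow> I = J" if "I \<in> T \<rightarrow>\<^sub>E UNIV" for I
  proof
    assume *: "\<forall>p\<in>T. x (s p) = (I \<circ> \<sigma>) p"
    show "I = J"
    proof (rule PiE_ext[OF that])
      show "J \<in> T \<rightarrow>\<^sub>E UNIV" by (simp add: J_def)
      show "I p = J p" if "p \<in> T" for p
        using *[rule_format, of "inv \<sigma> p"] that mem permutes_inverses(1)[OF T(3)]
        by (simp add: J_def)
    qed
  next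
    assume "I = J"
    then show "\<forall>p\<in>T. x (s p) = (I \<circ> \<sigma>) p"
      using permutes_inverses(2)[OF T(3)] by (simp add: J_def mem)
  qed
  have fin: "finite (T \<rightarrow>\<^sub>E (UNIV :: 'n set))" using T(1) by (intro finite_PiE) auto
  have "overwrite T s J x r = (x \<circ> map_permutation T s (inv \<sigma>)) r" for r
  proof (cases "r \<in> s ` T")
    case True
    then show ?thesis using T(2)
      by (auto simp: overwrite_image J_def map_permutation_apply)
  next
    case False
    then show ?thesis by (simp add: overwrite_other map_permutation_def restrict_id_def)
  qed
  then have ov: "overwrite T s J x = x \<circ> map_permutation T s (inv \<sigma>)" by (rule ext)
  have "app (\<Sum>I\<in>T \<rightarrow>\<^sub>E UNIV. munits T s (I \<circ> \<sigma>) I) f x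
      = (\<Sum>I\<in>T \<rightarrow>\<^sub>E UNIV. if I = J then f (overwrite T s J x) else 0)"
    unfolding app_sum app_munits by (intro sum.cong refl) (simp only: iff, simp)
  also have "\<dots> = f (overwrite T s J x)"
    using fin by (simp add: J_def)
  finally show "app (\<Sum>I\<in>T \<rightarrow>\<^sub>E UNIV. munits T s (I \<circ> \<sigma>) I) f x
      = app (permop (map_permutation T s (inv \<sigma>))) f x"
    by (simp add: app_permop ov)
qed

definition antisymmetrizer :: "'s set \<Rightarrow> ('s \<Rightarrow> 'n, 'c::comm_ring_1) lop" where
  "antisymmetrizer S = (\<Sum>\<pi> | \<pi> permutes S. of_int (sign \<pi>) * permop \<pi>)"

lemma signed_trace_munits:
  assumes T: "finite T" "inj_on s T"
  shows "(\<Sum>I\<in>T \<rightarrow>\<^sub>E UNIV. \<Sum>\<sigma> | \<sigma> permutes T. of_int (sign \<sigma>) * munits T s (I \<circ> \<sigma>) I)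
    = (antisymmetrizer (s ` T) :: ('s \<Rightarrow> 'n::finite, 'c::comm_ring_1) lop)"
proof -
  have bij: "bij_betw s T (s ` T)" using T(2) by (simp add: bij_betw_def)
  have "(\<Sum>I\<in>T \<rightarrow>\<^sub>E UNIV. \<Sum>\<sigma> | \<sigma> permutes T. of_int (sign \<sigma>) * munits T s (I \<circ> \<sigma>) I)
      = (\<Sum>\<sigma> | \<sigma> permutes T. of_int (sign \<sigma>) * permop (map_permutation T s (inv \<sigma>)) :: ('s \<Rightarrow> 'n, 'c) lop)"
    by (subst sum.swap) (simp add: sum_distrib_left[symmetric] sum_munits_permuted_rows[OF T])
  also have "\<dots> = antisymmetrizer (s ` T)"
    unfolding antisymmetrizer_def
  proof (rule sum.reindex_bij_witness[where j = "\<lambda>\<sigma>. map_permutation T s (inv \<sigma>)"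
        and i = "\<lambda>\<pi>. inv (map_permutation (s ` T) (inv_into T s) \<pi>)"], goal_cases)
    case (1 \<sigma>)
    then have "map_permutation (s ` T) (inv_into T s) (map_permutation T s (inv \<sigma>)) = inv \<sigma>"
      using T by (intro map_permutation_compose_inv[OF bij]) (auto intro: permutes_inv)
    then show ?case using 1 by (simp add: permutes_inv_inv)
  next
    case (2 \<sigma>)
    then show ?case using map_permutation_permutes[OF bij] by (simp add: permutes_inv)
  next
    case (3 \<pi>)
    have bij': "bij_betw (inv_into T s) (s ` T) T" using bij by (rule bij_betw_inv_into)
    have "map_permutation T s (map_permutation (s ` T) (inv_into T s) \<pi>) = \<pi>"
      using 3 by (intro map_permutation_compose_inv[OF bij']) (auto simp: f_inv_into_f)
    then show ?case using 3 map_permutation_permutes[OF bij', of \<pi>]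
      by (simp add: permutes_inv_inv)
  next
    case (4 \<pi>)
    have bij': "bij_betw (inv_into T s) (s ` T) T" using bij by (rule bij_betw_inv_into)
    then show ?case using 4 map_permutation_permutes[OF bij', of \<pi>] by (simp add: permutes_inv)
  next
    case (5 \<sigma>)
    then have \<sigma>: "\<sigma> permutes T" by simp
    have "sign (map_permutation T s (inv \<sigma>)) = sign (inv \<sigma>)"
      by (rule sign_map_permutation[OF T(2) permutes_inv[OF \<sigma>] T(1)])
    also have "\<dots> = sign \<sigma>"
      using \<sigma> T(1) by (intro sign_inverse) (auto simp: permutation_permutes)
    finally have "sign (map_permutation T s (inv \<sigma>)) = sign \<sigma>" .
    then show ?case by simp
  qed
  finally show ?thesis .
qed

section \<open>Power series of operators\<close>

text \<open>
  The derivation \<open>w d/dw\<close>; for \<open>w = u\<^sup>-\<^sup>1\<close> it is \<open>- u d/du\<close>.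
\<close>

definition euler :: "'a::ring_1 fps \<Rightarrow> 'a fps" where
  "euler f = Abs_fps (\<lambda>n. of_nat n * fps_nth f n)"

lemma euler_nth: "fps_nth (euler f) n = of_nat n * fps_nth f n"
  by (simp add: euler_def)

lemma euler_add: "euler (f + g) = euler f + euler g"
  by (rule fps_ext) (simp add: euler_nth distrib_left)

lemma euler_0 [simp]: "euler 0 = 0" and euler_1 [simp]: "euler 1 = 0"
  by (rule fps_ext; simp add: euler_nth)+

lemma euler_sum: "euler (sum f A) = (\<Sum>a\<in>A. euler (f a))"
  by (induction A rule: infinite_finite_induct) (simp_all add: euler_add)

lemma euler_mult: "euler (f * g) = euler f * g + f * euler g"
proof (rule fps_ext)
  fix n
  have "of_nat n * (fps_nth f i * fps_nth g (n - i))
      = of_nat i * fps_nth f i * fps_nth g (n - i) + fps_nth f i * (of_nat (n - i) * fps_nth g (n - i))"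
    if "i \<in> {0..n}" for i
  proof -
    have "of_nat n * (fps_nth f i * fps_nth g (n - i))
        = of_nat (i + (n - i)) * (fps_nth f i * fps_nth g (n - i))" using that by simp
    also have "\<dots> = of_nat i * fps_nth f i * fps_nth g (n - i)
        + of_nat (n - i) * fps_nth f i * fps_nth g (n - i)"
      by (simp only: of_nat_add distrib_right mult.assoc)
    also have "of_nat (n - i) * fps_nth f i = fps_nth f i * of_nat (n - i)"
      by (rule mult_of_nat_commute)
    finally show ?thesis by (simp only: mult.assoc)
  qed
  then show "fps_nth (euler (f * g)) n = fps_nth (euler f * g + f * euler g) n"
    by (simp add: euler_nth fps_mult_nth sum_distrib_left sum.distrib[symmetric])
qed

lemma euler_prod:
  fixes f :: "'p \<Rightarrow> 'c::comm_ring_1 fps"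
  assumes "finite A"
  shows "euler (prod f A) = (\<Sum>p\<in>A. euler (f p) * prod f (A - {p}))"
  using assms
proof (induction A)
  case (insert a A)
  have "prod f (insert a A - {p}) = f a * prod f (A - {p})" if "p \<in> A" for p
  proof -
    have "insert a A - {p} = insert a (A - {p})" using insert(2) that by auto
    then show ?thesis using insert(1,2) by simp
  qed
  then show ?case
    using insert by (simp add: euler_mult sum_distrib_left mult_ac)
qed simp

text \<open>
  The series \<open>t/(u - t)\<close> in \<open>w = u\<^sup>-\<^sup>1\<close>, by which one slot with parameter \<open>t\<close> enters the
  generating matrix.
\<close>

definition geom :: "'c::comm_ring_1 \<Rightarrow> 'c fps" where
  "geom t = Abs_fps (\<lambda>a. if a = 0 then 0 else t ^ a)"

lemma geom_nth: "fps_nth (geom t) a = (if a = 0 then 0 else t ^ a)"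
  by (simp add: geom_def)

lemma geom_eq: "geom t = fps_const t * fps_X * (1 + geom t)"
proof (rule fps_ext)
  fix n
  show "fps_nth (geom t) n = fps_nth (fps_const t * fps_X * (1 + geom t)) n"
    by (cases n) (simp_all add: geom_nth mult.assoc)
qed

text \<open>
  Apply the derivation to \<open>g = t w (1 + g)\<close> and cancel \<open>1 - t w\<close>.
\<close>

lemma euler_geom: "euler (geom t) = geom t + geom t * geom (t :: 'c::idom)"
proof -
  define u where "u = fps_const t * fps_X"
  have eu: "euler u = u"
    by (rule fps_ext) (simp add: u_def euler_nth fps_X_def)
  have g: "geom t = u + u * geom t" using geom_eq[of t] by (simp add: u_def distrib_left)
  have "euler (geom t) = euler (u + u * geom t)" using g by simp
  also have "\<dots> = u + u * geom t + u * euler (geom t)"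
    by (simp add: euler_add euler_mult eu add.assoc)
  finally have e: "euler (geom t) = u + u * geom t + u * euler (geom t)" .
  have "(1 - u) * (euler (geom t) - (geom t + geom t * geom t)) = 0"
  proof -
    have "(1 - u) * (euler (geom t) - (geom t + geom t * geom t))
        = (euler (geom t) - (u + u * geom t + u * euler (geom t))) - (1 + geom t) * (geom t - (u + u * geom t))"
      by (simp add: algebra_simps)
    also have "\<dots> = 0" using e g by (metis cancel_comm_monoid_add_class.diff_cancel mult_zero_right)
    finally show ?thesis .
  qed
  moreover have "fps_nth (1 - u) 0 \<noteq> 0" by (simp add: u_def)
  then have "1 - u \<noteq> 0" by (metis fps_zero_nth)
  ultimately show ?thesis by simp
qed

text \<open>
  The relation \<open>(w - z) g(w) g(z) = z g(w) - w g(z)\<close> with two independent variables, the inner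
  one \<open>w\<close> and the outer one \<open>z\<close> of series of series. Both series satisfy
  \<open>(1 - t w) g(w) = t w\<close>, and after multiplication by the two denominators the relation is a
  polynomial identity.
\<close>

lemma geom_mult_geom:
  fixes t :: "'c::idom"
  defines "\<omega> \<equiv> fps_const (fps_X :: 'c fps)" and "\<zeta> \<equiv> (fps_X :: 'c fps fps)"
  shows "(\<omega> - \<zeta>) * (fps_const (geom t) * geom (fps_const t))
    = \<zeta> * fps_const (geom t) - \<omega> * geom (fps_const t)"
proof -
  define c where "c = fps_const (fps_const t)"
  define x where "x = fps_const (geom t)"
  define y where "y = geom (fps_const t)"
  have "x = fps_const (fps_const t * fps_X * (1 + geom t))"
    unfolding x_def by (subst geom_eq) simp
  also have "\<dots> = c * \<omega> * (1 + x)"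
    by (simp add: x_def c_def \<omega>_def fps_const_mult[symmetric] fps_const_add[symmetric]
        del: fps_const_mult fps_const_add)
  finally have x: "x = c * \<omega> * (1 + x)" .
  have y: "y = c * \<zeta> * (1 + y)"
    unfolding y_def c_def \<zeta>_def by (rule geom_eq)
  have "(1 - c * \<omega>) * (1 - c * \<zeta>) * ((\<omega> - \<zeta>) * (x * y) - (\<zeta> * x - \<omega> * y)) = 0"
  proof -
    have X: "(1 - c * \<omega>) * x = c * \<omega>" and Y: "(1 - c * \<zeta>) * y = c * \<zeta>"
      using x y by (simp_all add: left_diff_distrib distrib_left diff_eq_eq)
    have "(1 - c * \<omega>) * (1 - c * \<zeta>) * ((\<omega> - \<zeta>) * (x * y) - (\<zeta> * x - \<omega> * y))
        = (\<omega> - \<zeta>) * (((1 - c * \<omega>) * x) * ((1 - c * \<zeta>) * y))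
          - \<zeta> * ((1 - c * \<omega>) * x) * (1 - c * \<zeta>) + \<omega> * ((1 - c * \<zeta>) * y) * (1 - c * \<omega>)"
      by (simp only: algebra_simps)
    also have "\<dots> = 0"
      unfolding X Y by (simp add: algebra_simps)
    finally show ?thesis .
  qed
  moreover have "fps_nth (fps_nth (1 - c * \<omega>) 0) 0 \<noteq> 0" "fps_nth (fps_nth (1 - c * \<zeta>) 0) 0 \<noteq> 0"
    by (simp_all add: c_def \<omega>_def \<zeta>_def)
  then have "1 - c * \<omega> \<noteq> 0" "1 - c * \<zeta> \<noteq> 0" by (metis fps_zero_nth)+
  ultimately show ?thesis by (simp add: x_def y_def)
qed

lemma fps_const_sum: "fps_const (sum f A) = (\<Sum>a\<in>A. fps_const (f a))" for f :: "'z \<Rightarrow> 'c::ring_1"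
  by (rule fps_ext) (simp add: fps_sum_nth)

lemma fps_const_of_int: "fps_const (of_int z) = (of_int z :: 'a::ring_1 fps)"
  by (rule fps_ext) (simp add: fps_of_int[symmetric])

lemma fps_mult_commute_coeffs:
  fixes f g :: "'a::ring_1 fps"
  assumes "\<And>i j. fps_nth f i * fps_nth g j = fps_nth g j * fps_nth f i"
  shows "f * g = g * f"
proof (rule fps_ext)
  fix n
  show "fps_nth (f * g) n = fps_nth (g * f) n"
    unfolding fps_mult_nth
    by (rule sum.reindex_bij_witness[where i = "\<lambda>i. n - i" and j = "\<lambda>i. n - i"]) (auto simp: assms)
qed

definition scalars :: "'c::comm_ring_1 fps \<Rightarrow> ('x, 'c) lop fps" where
  "scalars f = Abs_fps (\<lambda>n. scalar (fps_nth f n))"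

lemma scalars_nth: "fps_nth (scalars f) n = scalar (fps_nth f n)"
  by (simp add: scalars_def)

lemma scalars_hom [simp]:
  "scalars 0 = 0" "scalars 1 = 1" "scalars (f + g) = scalars f + scalars g"
  by (rule fps_ext; simp add: scalars_nth)+

lemma scalars_mult: "scalars (f * g) = scalars f * scalars g"
  by (rule fps_ext) (simp add: scalars_nth fps_mult_nth scalar_sum)

lemma scalars_sum: "scalars (sum f A) = (\<Sum>a\<in>A. scalars (f a))"
  by (induction A rule: infinite_finite_induct) simp_all

lemma scalars_of_nat: "scalars (of_nat n) = of_nat n"
  by (induction n) simp_all

lemma scalars_commute: "F * scalars f = scalars f * F"
  by (rule fps_mult_commute_coeffs) (simp add: scalars_nth scalar_comm)

lemma euler_scalars: "euler (scalars f * fps_const E) = scalars (euler f) * fps_const E"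
  by (rule fps_ext) (simp add: euler_nth scalars_nth mult.assoc)

lemma scalars_const_mult:
  "(scalars f * fps_const A) * (scalars g * fps_const B) = scalars (f * g) * fps_const (A * B)"
proof -
  have "(scalars f * fps_const A) * (scalars g * fps_const B)
      = scalars f * (fps_const A * scalars g) * fps_const B" by (simp only: mult.assoc)
  also have "\<dots> = scalars f * scalars g * (fps_const A * fps_const B)"
    unfolding scalars_commute[of "fps_const A"] by (simp only: mult.assoc)
  finally show ?thesis by (simp add: scalars_mult)
qed

text \<open>
  The image of the \<open>(i, j)\<close> entry of the generating matrix in the representation on \<open>n\<close> slots
  with parameters \<open>t\<close>.
\<close>

definition lax :: "nat \<Rightarrow> (nat \<Rightarrow> 'c::comm_ring_1) \<Rightarrow> 'n \<Rightarrow> 'n \<Rightarrow> (nat \<Rightarrow> 'n, 'c) lop fps" where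
  "lax n t i j = (\<Sum>s<n. scalars (geom (t s)) * fps_const (munit s i j))"

definition lax_op :: "nat \<Rightarrow> (nat \<Rightarrow> 'c::comm_ring_1) \<Rightarrow> 'n \<Rightarrow> 'n \<Rightarrow>
    (nat \<Rightarrow> 'n, 'c) lop fps \<Rightarrow> (nat \<Rightarrow> 'n, 'c) lop fps" where
  "lax_op n t i j F = lax n t i j * F + (if i = j then euler F else 0)"

lemma lax_op_add: "lax_op n t i j (F + F') = lax_op n t i j F + lax_op n t i j F'"
  by (simp add: lax_op_def distrib_left euler_add)

lemma lax_op_0: "lax_op n t i j 0 = 0"
  by (simp add: lax_op_def)

definition injections :: "nat set \<Rightarrow> nat \<Rightarrow> (nat \<Rightarrow> nat) set" where
  "injections T n = {s \<in> T \<rightarrow>\<^sub>E {..<n}. inj_on s T}"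

lemma finite_injections: "finite T \<Longrightarrow> finite (injections T n)"
  unfolding injections_def by (rule finite_subset[of _ "T \<rightarrow>\<^sub>E {..<n}"]) (auto intro: finite_PiE)

definition weight :: "(nat \<Rightarrow> 'c::comm_ring_1) \<Rightarrow> nat set \<Rightarrow> (nat \<Rightarrow> nat) \<Rightarrow> 'c fps" where
  "weight t T s = (\<Prod>p\<in>T. geom (t (s p)))"

text \<open>
  Rows \<open>K\<close> and columns \<open>I\<close> are multi-indices over the tensor factors \<open>Q\<close> of the matrix
  product. The factors in \<open>T\<close> carry an entry of the generating matrix, in pairwise different
  slots \<open>s p\<close>, and the other ones carry the identity matrix.
\<close>

definition normal_term :: "nat \<Rightarrow> (nat \<Rightarrow> 'c::comm_ring_1) \<Rightarrow> nat set \<Rightarrow> nat set \<Rightarrow>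
    (nat \<Rightarrow> 'n) \<Rightarrow> (nat \<Rightarrow> 'n) \<Rightarrow> (nat \<Rightarrow> 'n, 'c) lop fps" where
  "normal_term n t Q T K I = (if \<forall>p\<in>Q - T. K p = I p
     then \<Sum>s\<in>injections T n. scalars (weight t T s) * fps_const (munits T s K I) else 0)"

lemma munits_cong:
  assumes "\<And>p. p \<in> T \<Longrightarrow> s p = s' p" "\<And>p. p \<in> T \<Longrightarrow> K p = K' p"
  shows "munits T s K I = munits T s' K' I"
proof -
  have "s ` T = s' ` T" using assms(1) by (auto simp: image_iff)
  moreover have "inv_into T s r = inv_into T s' r" for r
    unfolding inv_into_def using assms(1) by (intro arg_cong[where f = Eps]) auto
  ultimately have "overwrite T s I = overwrite T s' I" by (auto simp: overwrite_def fun_eq_iff)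
  then show ?thesis
    using assms by (intro lop_eqI) (simp add: app_munits cong: ball_cong)
qed

lemma sum_injections_insert:
  assumes "q \<notin> T"
  shows "(\<Sum>s\<in>injections T n. \<Sum>u\<in>{..<n} - s ` T. f s u)
    = (\<Sum>s\<in>injections (insert q T) n. f (s(q := undefined)) (s q))"
proof (cases "finite T")
  case True
  have "(\<Sum>s\<in>injections T n. \<Sum>u\<in>{..<n} - s ` T. f s u)
      = (\<Sum>(s, u)\<in>(SIGMA s:injections T n. {..<n} - s ` T). f s u)"
    using True by (intro sum.Sigma finite_injections) auto
  also have "\<dots> = (\<Sum>s\<in>injections (insert q T) n. f (s(q := undefined)) (s q))"
  proof (rule sum.reindex_bij_witness[where i = "\<lambda>s. (s(q := undefined), s q)"
        and j = "\<lambda>(s, u). s(q := u)"], goal_cases)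
    case (1 a)
    then show ?case using assms by (auto simp: injections_def PiE_def extensional_def)
  next
    case (2 a)
    obtain s u where a: "a = (s, u)" by (cases a)
    have s: "s \<in> T \<rightarrow>\<^sub>E {..<n}" "inj_on s T" "u < n" "u \<notin> s ` T"
      using 2 a by (auto simp: injections_def)
    have "inj_on (s(q := u)) (insert q T)"
      using s(2,4) assms by (auto simp: inj_on_def)
    moreover have "s(q := u) \<in> insert q T \<rightarrow>\<^sub>E {..<n}"
      using s(1,3) by (intro PiE_fun_upd) auto
    ultimately show ?case by (simp add: a injections_def)
  next
    case (3 s)
    then show ?case by simp
  next
    case (4 s)
    then have s: "s \<in> insert q T \<rightarrow>\<^sub>E {..<n}" "inj_on s (insert q T)" by (auto simp: injections_def)
    have "s(q := undefined) \<in> T \<rightarrow>\<^sub>E {..<n}"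
      using s(1) assms by (auto simp: PiE_def extensional_def Pi_def)
    moreover have "inj_on (s(q := undefined)) T" "s q \<notin> s(q := undefined) ` T"
      using s(2) assms by (auto simp: inj_on_def)
    ultimately show ?case using s(1) by (auto simp: injections_def)
  next
    case (5 a)
    then show ?case using assms
      by (auto simp: injections_def PiE_def extensional_def fun_upd_def intro!: arg_cong2[where f = f])
  qed
  finally show ?thesis .
next
  case False
  then have "\<not> inj_on s T" if "s \<in> T \<rightarrow>\<^sub>E {..<n}" for s
    using that finite_imageD finite_subset[of "s ` T" "{..<n}"] by (metis PiE_mem finite_lessThan image_subsetI)
  moreover have "\<not> inj_on s (insert q T)" if "s \<in> insert q T \<rightarrow>\<^sub>E {..<n}" for s
    using that False finite_imageD finite_subset[of "s ` insert q T" "{..<n}"]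
    by (metis PiE_mem finite_insert finite_lessThan image_subsetI)
  ultimately have "injections T n = {}" "injections (insert q T) n = {}"
    by (auto simp: injections_def)
  then show ?thesis by simp
qed

section \<open>A Capelli identity\<close>

text \<open>
  What is left over when the entry at the new factor \<open>q\<close> meets the entry at \<open>p\<close> in the same
  slot (first summand), and from the term \<open>g\<^sup>2\<close> of \<open>w d/dw g = g + g\<^sup>2\<close> at \<open>p\<close> (second
  summand).
\<close>

definition contraction :: "nat \<Rightarrow> (nat \<Rightarrow> 'c::comm_ring_1) \<Rightarrow> nat set \<Rightarrow> nat set \<Rightarrow> nat \<Rightarrow> nat \<Rightarrow>
    (nat \<Rightarrow> 'n) \<Rightarrow> (nat \<Rightarrow> 'n) \<Rightarrow> (nat \<Rightarrow> 'n, 'c) lop fps" where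
  "contraction n t Q T q p K I = (if \<forall>p\<in>Q - T. K p = I p
     then \<Sum>s\<in>injections T n. scalars (geom (t (s p)) * weight t T s) *
       fps_const ((if I q = K p then munits T s (K(p := K q)) I else 0)
         + (if K q = I q then munits T s K I else 0)) else 0)"

text \<open>
  The new entry at \<open>q\<close> acts in a slot that is still free, which enlarges \<open>T\<close>, or in the slot
  of some \<open>p\<close> in \<open>T\<close>. The derivation meets the weights: by \<open>w d/dw g = g + g\<^sup>2\<close> it reproduces
  the weight once for every \<open>p\<close> in \<open>T\<close> and adds the terms with \<open>g\<^sup>2\<close>.
\<close>

lemma lax_op_normal_term:
  fixes t :: "nat \<Rightarrow> 'c::idom" and K I :: "nat \<Rightarrow> 'n"
  assumes fin: "finite T" and TQ: "T \<subseteq> Q" and q: "q \<notin> Q"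
  shows "lax_op n t (K q) (I q) (normal_term n t Q T K I)
    = normal_term n t (insert q Q) (insert q T) K I
      + of_nat (card T) * normal_term n t (insert q Q) T K I
      + (\<Sum>p\<in>T. contraction n t Q T q p K I)"
proof (cases "\<forall>p\<in>Q - T. K p = I p")
  case False
  have "\<not> (\<forall>p\<in>insert q Q - insert q T. K p = I p)" "\<not> (\<forall>p\<in>insert q Q - T. K p = I p)"
    using False q by blast+
  with False have "normal_term n t Q T K I = 0" "normal_term n t (insert q Q) (insert q T) K I = 0"
    "normal_term n t (insert q Q) T K I = 0" "contraction n t Q T q p K I = 0" for p
    unfolding normal_term_def contraction_def by (simp_all only: if_False)
  then show ?thesis by (simp add: lax_op_0)
next
  case True
  have qT: "q \<notin> T" using q TQ by auto
  let ?\<delta> = "K q = I q"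
  let ?J = "injections T n"
  let ?g = "\<lambda>u. geom (t u)"
  have inj: "inj_on s T" "s ` T \<subseteq> {..<n}" if "s \<in> ?J" for s using that by (auto simp: injections_def)
  have new: "normal_term n t (insert q Q) (insert q T) K I
    = (\<Sum>s\<in>?J. \<Sum>u\<in>{..<n} - s ` T. scalars (?g u * weight t T s) * fps_const (munit u (K q) (I q) * munits T s K I))"
  proof -
    have "insert q Q - insert q T = Q - T" using q TQ by auto
    then have "normal_term n t (insert q Q) (insert q T) K I = (\<Sum>s\<in>injections (insert q T) n.
        scalars (weight t (insert q T) s) * fps_const (munits (insert q T) s K I))"
      using True by (simp add: normal_term_def)
    also have "\<dots> = (\<Sum>s\<in>injections (insert q T) n. scalars (?g (s q) * weight t T (s(q := undefined)))
        * fps_const (munit (s q) (K q) (I q) * munits T (s(q := undefined)) K I))"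
    proof (rule sum.cong[OF refl])
      fix s assume "s \<in> injections (insert q T) n"
      then have inj: "inj_on s (insert q T)" by (simp add: injections_def)
      have "munits T (s(q := undefined)) K I = (munits T s K I :: (nat \<Rightarrow> 'n, 'c) lop)"
        using qT by (intro munits_cong) auto
      moreover have "weight t (insert q T) s = ?g (s q) * weight t T (s(q := undefined))"
        using qT fin by (auto simp: weight_def intro!: prod.cong)
      ultimately show "scalars (weight t (insert q T) s) * fps_const (munits (insert q T) s K I)
        = scalars (?g (s q) * weight t T (s(q := undefined)))
          * fps_const (munit (s q) (K q) (I q) * munits T (s(q := undefined)) K I)"
        by (simp add: munit_munits_new[OF qT inj])
    qed
    finally show ?thesis
      using sum_injections_insert[OF qT, of "\<lambda>s u. scalars (?g u * weight t T s)
          * fps_const (munit u (K q) (I q) * munits T s K I)"] by simp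
  qed
  have old: "(\<Sum>u\<in>s ` T. scalars (?g u * weight t T s) * fps_const (munit u (K q) (I q) * munits T s K I))
      = (\<Sum>p\<in>T. scalars (?g (s p) * weight t T s)
          * fps_const (if I q = K p then munits T s (K(p := K q)) I else 0))" if "s \<in> ?J" for s
    using inj[OF that] by (subst sum.reindex) (auto simp: munit_munits_old intro!: sum.cong)
  have lax: "lax n t (K q) (I q) * normal_term n t Q T K I
      = (\<Sum>s\<in>?J. \<Sum>u<n. scalars (?g u * weight t T s) * fps_const (munit u (K q) (I q) * munits T s K I))"
    using True by (subst sum.swap) (simp add: lax_def normal_term_def sum_product scalars_const_mult)
  also have "\<dots> = (\<Sum>s\<in>?J. (\<Sum>u\<in>{..<n} - s ` T. scalars (?g u * weight t T s)
          * fps_const (munit u (K q) (I q) * munits T s K I))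
      + (\<Sum>p\<in>T. scalars (?g (s p) * weight t T s)
          * fps_const (if I q = K p then munits T s (K(p := K q)) I else 0)))"
    by (intro sum.cong refl, subst old[symmetric], assumption, rule sum.subset_diff) (use inj in auto)
  also have "\<dots> = normal_term n t (insert q Q) (insert q T) K I
      + (\<Sum>p\<in>T. \<Sum>s\<in>?J. scalars (?g (s p) * weight t T s)
          * fps_const (if I q = K p then munits T s (K(p := K q)) I else 0))"
    unfolding new sum.distrib by (subst (2) sum.swap) simp
  finally have L: "lax n t (K q) (I q) * normal_term n t Q T K I
    = normal_term n t (insert q Q) (insert q T) K I
      + (\<Sum>p\<in>T. \<Sum>s\<in>?J. scalars (?g (s p) * weight t T s)
          * fps_const (if I q = K p then munits T s (K(p := K q)) I else 0))" .
  have ew: "euler (weight t T s) = of_nat (card T) * weight t T s + (\<Sum>p\<in>T. ?g (s p) * weight t T s)" for s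
  proof -
    have "euler (weight t T s) = (\<Sum>p\<in>T. weight t T s + ?g (s p) * weight t T s)"
      unfolding weight_def euler_prod[OF fin]
    proof (rule sum.cong[OF refl])
      fix p assume "p \<in> T"
      then have "(\<Prod>p\<in>T. ?g (s p)) = ?g (s p) * (\<Prod>p\<in>T - {p}. ?g (s p))"
        using fin by (simp add: prod.remove)
      then show "euler (?g (s p)) * (\<Prod>p\<in>T - {p}. ?g (s p))
        = (\<Prod>p\<in>T. ?g (s p)) + ?g (s p) * (\<Prod>p\<in>T. ?g (s p))"
        by (simp add: euler_geom distrib_right mult.assoc)
    qed
    then show ?thesis by (simp add: sum.distrib)
  qed
  have E: "(if ?\<delta> then euler (normal_term n t Q T K I) else 0)
      = of_nat (card T) * normal_term n t (insert q Q) T K I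
      + (\<Sum>p\<in>T. \<Sum>s\<in>?J. scalars (?g (s p) * weight t T s) * fps_const (if ?\<delta> then munits T s K I else 0))"
  proof (cases ?\<delta>)
    case \<delta>: True
    have "insert q Q - T = insert q (Q - T)" using qT by auto
    then have nt: "normal_term n t (insert q Q) T K I = normal_term n t Q T K I"
      using \<delta> by (simp add: normal_term_def)
    have "euler (normal_term n t Q T K I)
        = (\<Sum>s\<in>?J. scalars (euler (weight t T s)) * fps_const (munits T s K I))"
      using True by (simp add: normal_term_def euler_sum euler_scalars)
    also have "\<dots> = (\<Sum>s\<in>?J. of_nat (card T) * (scalars (weight t T s) * fps_const (munits T s K I))
        + (\<Sum>p\<in>T. scalars (?g (s p) * weight t T s) * fps_const (munits T s K I)))"
      unfolding ew by (simp add: scalars_mult[of "of_nat _"] scalars_of_nat scalars_sum distrib_right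
          sum_distrib_right mult.assoc)
    also have "\<dots> = of_nat (card T) * normal_term n t Q T K I
        + (\<Sum>p\<in>T. \<Sum>s\<in>?J. scalars (?g (s p) * weight t T s) * fps_const (munits T s K I))"
      using True unfolding sum.distrib by (subst (2) sum.swap) (simp add: normal_term_def sum_distrib_left)
    finally show ?thesis using \<delta> nt by simp
  next
    case False
    then show ?thesis using qT by (force simp: normal_term_def)
  qed
  have C: "(\<Sum>p\<in>T. contraction n t Q T q p K I)
    = (\<Sum>p\<in>T. \<Sum>s\<in>?J. scalars (?g (s p) * weight t T s)
          * fps_const (if I q = K p then munits T s (K(p := K q)) I else 0))
    + (\<Sum>p\<in>T. \<Sum>s\<in>?J. scalars (?g (s p) * weight t T s) * fps_const (if ?\<delta> then munits T s K I else 0))"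
    using True unfolding contraction_def sum.distrib[symmetric]
    by (intro sum.cong refl) (simp add: distrib_left[symmetric] del: fps_const_add
        add: fps_const_add[symmetric] sum.distrib[symmetric])
  show ?thesis
    unfolding lax_op_def L E C by (simp only: add_ac)
qed

text \<open>
  The transposition of the rows \<open>p\<close> and \<open>q\<close> exchanges the two summands. This is why
  antisymmetrization removes the contractions.
\<close>

lemma contraction_symmetric:
  assumes "p \<in> T" "T \<subseteq> Q" "q \<notin> Q"
  shows "contraction n t Q T q p (K \<circ> transpose p q) I = contraction n t Q T q p K I"
proof -
  let ?K = "K \<circ> transpose p q"
  have pq: "p \<noteq> q" using assms by auto
  have K: "?K p = K q" "?K q = K p" by simp_all
  have other: "?K r = K r" if "r \<noteq> p" "r \<noteq> q" for r using that by simp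
  have 1: "munits T s (?K(p := ?K q)) I = munits T s K I" for s
    using assms by (intro munits_cong) (auto simp: transpose_def)
  have 2: "munits T s ?K I = munits T s (K(p := K q)) I" for s
    using assms by (intro munits_cong) (auto simp: transpose_def)
  have 3: "(\<forall>p\<in>Q - T. ?K p = I p) \<longleftrightarrow> (\<forall>p\<in>Q - T. K p = I p)"
    using assms by (intro ball_cong refl) (auto simp: transpose_def)
  have eq: "((if I q = ?K p then munits T s (?K(p := ?K q)) I else 0) + (if ?K q = I q then munits T s ?K I else 0))
    = ((if I q = K p then munits T s (K(p := K q)) I else 0) + (if K q = I q then munits T s K I else 0))" for s
    unfolding 1 2 unfolding K by (simp add: add.commute eq_commute)
  show ?thesis unfolding contraction_def 3 eq ..
qed

section \<open>Antisymmetrization and partial traces\<close>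

text \<open>
  Functions of \<open>(K, I)\<close> that, up to summands symmetric in two rows, are combinations of the
  terms \<open>normal_term n t Q T\<close> with coefficients independent of \<open>K\<close> and \<open>I\<close>. The
  antisymmetrizer over all factors kills the symmetric summands.
\<close>

inductive reducible :: "nat \<Rightarrow> (nat \<Rightarrow> 'c::comm_ring_1) \<Rightarrow> nat set \<Rightarrow>
    ((nat \<Rightarrow> 'n) \<Rightarrow> (nat \<Rightarrow> 'n) \<Rightarrow> (nat \<Rightarrow> 'n, 'c) lop fps) \<Rightarrow> bool" for n t Q where
  normal: "T \<subseteq> Q \<Longrightarrow> reducible n t Q (normal_term n t Q T)"
| symmetric: "p \<in> Q \<Longrightarrow> q \<in> Q \<Longrightarrow> p \<noteq> q \<Longrightarrow> (\<And>K I. Z (K \<circ> transpose p q) I = Z K I) \<Longrightarrow> reducible n t Q Z"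
| zero: "reducible n t Q (\<lambda>K I. 0)"
| add: "reducible n t Q Z \<Longrightarrow> reducible n t Q Z' \<Longrightarrow> reducible n t Q (\<lambda>K I. Z K I + Z' K I)"

lemma reducible_of_nat_mult: "reducible n t Q Z \<Longrightarrow> reducible n t Q (\<lambda>K I. of_nat k * Z K I)"
proof (induction k)
  case 0
  then show ?case by (simp add: reducible.zero)
next
  case (Suc k)
  then show ?case using reducible.add[of n t Q Z "\<lambda>K I. of_nat k * Z K I"]
    by (simp add: distrib_right)
qed

lemma reducible_sum:
  "(\<And>a. a \<in> A \<Longrightarrow> reducible n t Q (Z a)) \<Longrightarrow> reducible n t Q (\<lambda>K I. \<Sum>a\<in>A. Z a K I)"
  by (induction A rule: infinite_finite_induct) (simp_all add: reducible.zero reducible.add)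

lemma reducible_lax_op:
  fixes t :: "nat \<Rightarrow> 'c::idom"
  assumes "reducible n t Q Z" "finite Q" "q \<notin> Q"
  shows "reducible n t (insert q Q) (\<lambda>K I. lax_op n t (K q) (I q) (Z K I))"
  using assms(1)
proof induction
  case (normal T)
  then have T: "finite T" "T \<subseteq> Q" using assms(2) finite_subset by auto
  have contr: "reducible n t (insert q Q) (contraction n t Q T q p)" if "p \<in> T" for p
    using that T(2) assms(3) contraction_symmetric[OF that T(2) assms(3)]
    by (intro reducible.symmetric[of p _ q]) auto
  have "reducible n t (insert q Q) (\<lambda>K I. normal_term n t (insert q Q) (insert q T) K I
      + of_nat (card T) * normal_term n t (insert q Q) T K I + (\<Sum>p\<in>T. contraction n t Q T q p K I))"
    by (intro reducible.add reducible_sum contr reducible_of_nat_mult)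
      (use reducible.normal[of "insert q T" "insert q Q" n t] reducible.normal[of T "insert q Q" n t] T in auto)
  then show ?case
    by (simp add: lax_op_normal_term[OF T assms(3)])
next
  case (symmetric p p' Z)
  show ?case
  proof (rule reducible.symmetric[of p _ p'])
    fix K I :: "nat \<Rightarrow> 'a"
    have "(K \<circ> transpose p p') q = K q"
      using symmetric(1,2) assms(3) by (auto simp: transpose_def)
    then show "lax_op n t ((K \<circ> transpose p p') q) (I q) (Z (K \<circ> transpose p p') I)
        = lax_op n t (K q) (I q) (Z K I)"
      by (simp only: symmetric(4))
  qed (use symmetric(1-3) in auto)
next
  case zero
  then show ?case by (simp add: lax_op_0 reducible.zero)
next
  case (add Z Z')
  then show ?case by (simp add: lax_op_add reducible.add)
qed

text \<open>
  For \<open>U = {..<m}\<close> this is \<open>m!\<close> times the full trace of the skew-symmetrizer applied to \<open>Z\<close>.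
\<close>

definition signed_trace :: "nat set \<Rightarrow> ((nat \<Rightarrow> 'n) \<Rightarrow> (nat \<Rightarrow> 'n) \<Rightarrow> 'r::ring_1) \<Rightarrow> 'r" where
  "signed_trace U Z = (\<Sum>I\<in>U \<rightarrow>\<^sub>E UNIV. \<Sum>\<sigma> | \<sigma> permutes U. of_int (sign \<sigma>) * Z (I \<circ> \<sigma>) I)"

lemma signed_trace_add: "signed_trace U (\<lambda>K I. Z K I + Z' K I) = signed_trace U Z + signed_trace U Z'"
  by (simp add: signed_trace_def distrib_left sum.distrib)

text \<open>
  Composition with the transposition pairs even with odd permutations. Splitting by parity,
  instead of deriving that twice the sum is zero, works in every ring.
\<close>

lemma signed_trace_symmetric_eq_0:
  assumes U: "finite U" "p \<in> U" "q \<in> U" "p \<noteq> q"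
    and sym: "\<And>K I. Z (K \<circ> transpose p q) I = Z K I"
  shows "signed_trace U Z = (0 :: 'r::ring_1)"
proof -
  let ?P = "{\<sigma>. \<sigma> permutes U}"
  let ?E = "{\<sigma>\<in>?P. evenperm \<sigma>}" and ?O = "{\<sigma>\<in>?P. \<not> evenperm \<sigma>}"
  have finP: "finite ?P" using U(1) by (simp add: finite_permutations)
  have tr: "transpose p q permutes U" using U by (simp add: permutes_swap_id)
  have comp: "\<sigma> \<circ> transpose p q permutes U" if "\<sigma> permutes U" for \<sigma>
    using permutes_compose[OF tr that] .
  have perm: "permutation \<sigma>" if "\<sigma> permutes U" for \<sigma>
    unfolding permutation_permutes using that U(1) by blast
  have even: "evenperm (\<sigma> \<circ> transpose p q) \<longleftrightarrow> \<not> evenperm \<sigma>" if "\<sigma> permutes U" for \<sigma>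
    using evenperm_comp[OF perm[OF that] perm[OF tr]] U(4) by (simp add: evenperm_swap)
  have inv: "(\<sigma> \<circ> transpose p q) \<circ> transpose p q = \<sigma>" for \<sigma> :: "nat \<Rightarrow> nat"
    by (simp add: comp_assoc)
  have "(\<Sum>\<sigma>\<in>?P. of_int (sign \<sigma>) * Z (I \<circ> \<sigma>) I) = 0" for I
  proof -
    have "(\<Sum>\<sigma>\<in>?P. of_int (sign \<sigma>) * Z (I \<circ> \<sigma>) I)
        = (\<Sum>\<sigma>\<in>?E. of_int (sign \<sigma>) * Z (I \<circ> \<sigma>) I) + (\<Sum>\<sigma>\<in>?O. of_int (sign \<sigma>) * Z (I \<circ> \<sigma>) I)"
    proof -
      have "?P = ?E \<union> ?O" by blast
      moreover have "finite ?E" "finite ?O" "?E \<inter> ?O = {}" using finP by auto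
      then have "sum h (?E \<union> ?O) = sum h ?E + sum h ?O" for h :: "(nat \<Rightarrow> nat) \<Rightarrow> 'r"
        by (rule sum.union_disjoint)
      ultimately show ?thesis by (rule ssubst)
    qed
    also have "(\<Sum>\<sigma>\<in>?O. of_int (sign \<sigma>) * Z (I \<circ> \<sigma>) I) = (\<Sum>\<sigma>\<in>?E. - (of_int (sign \<sigma>) * Z (I \<circ> \<sigma>) I))"
    proof (rule sum.reindex_bij_witness[where i = "\<lambda>\<sigma>. \<sigma> \<circ> transpose p q" and j = "\<lambda>\<sigma>. \<sigma> \<circ> transpose p q"], goal_cases)
      case (1 \<sigma>)
      show ?case by (rule inv)
    next
      case (2 \<sigma>)
      then show ?case using comp[of \<sigma>] even[of \<sigma>] by simp
    next
      case (3 \<sigma>)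
      show ?case by (rule inv)
    next
      case (4 \<sigma>)
      then show ?case using comp[of \<sigma>] even[of \<sigma>] by simp
    next
      case (5 \<sigma>)
      have "Z (I \<circ> (\<sigma> \<circ> transpose p q)) I = Z (I \<circ> \<sigma>) I"
        using sym[of "I \<circ> \<sigma>" I] by (simp only: comp_assoc)
      then show ?case using 5 even[of \<sigma>] by (simp add: sign_def del: comp_apply)
    qed
    finally show ?thesis by (simp only: sum_negf add.right_inverse)
  qed
  then show ?thesis by (simp add: signed_trace_def)
qed

lemma sum_PiE_insert:
  assumes "q \<notin> U"
  shows "(\<Sum>I\<in>insert q U \<rightarrow>\<^sub>E A. f I) = (\<Sum>I\<in>U \<rightarrow>\<^sub>E A. \<Sum>c\<in>A. f (I(q := c)))"
proof -
  have "(\<Sum>I\<in>insert q U \<rightarrow>\<^sub>E A. f I) = (\<Sum>(c, I)\<in>A \<times> (U \<rightarrow>\<^sub>E A). f (I(q := c)))"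
    unfolding PiE_insert_eq using inj_combinator[OF assms, of "\<lambda>_. A"]
    by (subst sum.reindex) (auto simp: case_prod_beta)
  also have "\<dots> = (\<Sum>I\<in>U \<rightarrow>\<^sub>E A. \<Sum>c\<in>A. f (I(q := c)))"
    by (subst sum.swap) (simp add: sum.cartesian_product)
  finally show ?thesis .
qed

lemma sum_permutes_insert:
  assumes "q \<notin> U"
  shows "(\<Sum>\<sigma> | \<sigma> permutes insert q U. f \<sigma>)
    = (\<Sum>\<sigma> | \<sigma> permutes U. \<Sum>b\<in>insert q U. f (transpose q b \<circ> \<sigma>))"
proof -
  have "(\<Sum>\<sigma> | \<sigma> permutes insert q U. f \<sigma>)
      = (\<Sum>(\<sigma>, b)\<in>{\<sigma>. \<sigma> permutes U} \<times> insert q U. f (transpose q b \<circ> \<sigma>))"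
  proof (rule sum.reindex_bij_witness[where i = "\<lambda>(\<sigma>, b). transpose q b \<circ> \<sigma>"
        and j = "\<lambda>\<sigma>. (transpose q (\<sigma> q) \<circ> \<sigma>, \<sigma> q)"], goal_cases)
    case (1 \<sigma>)
    then show ?case by (simp add: comp_assoc[symmetric])
  next
    case (2 \<sigma>)
    then show ?case using permutes_insert_lemma[of \<sigma> q U] permutes_in_image[of \<sigma> "insert q U" q] by simp
  next
    case (3 a)
    then show ?case using assms by (auto simp: permutes_not_in comp_assoc[symmetric])
  next
    case (4 a)
    then show ?case
      by (auto simp: permutes_insert intro!: image_eqI[of _ _ "(snd a, fst a)"])
  next
    case (5 \<sigma>)
    then show ?case by (simp add: comp_assoc[symmetric])
  qed
  then show ?thesis by (simp add: sum.cartesian_product)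
qed

text \<open>
  The partial trace of an antisymmetrizer over one tensor factor is a multiple of the smaller
  antisymmetrizer. A permutation of \<open>insert q U\<close> is \<open>transpose q b \<circ> \<sigma>\<close> with \<open>\<sigma>\<close> a permutation
  of \<open>U\<close>. For \<open>b = q\<close> the index \<open>I q = c\<close> is free and there are \<open>CARD('n)\<close> choices; each of
  the \<open>card U\<close> other values of \<open>b\<close> forces \<open>c = I b\<close> and contributes with the opposite sign.
\<close>

lemma signed_trace_insert:
  fixes f :: "(nat \<Rightarrow> 'n::finite) \<Rightarrow> (nat \<Rightarrow> 'n) \<Rightarrow> 'r::ring_1"
  assumes U: "finite U" "q \<notin> U" "T \<subseteq> U"
    and dep: "\<And>K I K' I'. (\<And>p. p \<in> T \<Longrightarrow> K p = K' p \<and> I p = I' p) \<Longrightarrow> f K I = f K' I'"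
  shows "signed_trace (insert q U) (\<lambda>K I. if \<forall>p\<in>insert q U - T. K p = I p then f K I else 0)
    = of_int (int CARD('n) - int (card U)) * signed_trace U (\<lambda>K I. if \<forall>p\<in>U - T. K p = I p then f K I else 0)"
proof -
  let ?F = "\<lambda>K I. if \<forall>p\<in>U - T. K p = I p then f K I else 0"
  let ?F' = "\<lambda>K I. if \<forall>p\<in>insert q U - T. K p = I p then f K I else 0"
  \<comment> \<open>The factor \<open>q\<close> must return to its own column: for \<open>b \<noteq> q\<close> this says \<open>I b = c\<close>, and then the row of the factor mapped to \<open>q\<close> is also \<open>I b\<close>.\<close>
  have F': "?F' (I(q := c) \<circ> (transpose q b \<circ> \<sigma>)) (I(q := c))
      = (if b = q \<or> c = I b then ?F (I \<circ> \<sigma>) I else 0)"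
    if \<sigma>: "\<sigma> permutes U" and b: "b \<in> insert q U" for I c b \<sigma>
  proof -
    have \<sigma>q: "\<sigma> q = q" using \<sigma> U(2) by (simp add: permutes_not_in)
    have \<sigma>U: "\<sigma> p \<in> U" if "p \<in> U" for p using permutes_in_image[OF \<sigma>] that by simp
    let ?K = "I(q := c) \<circ> (transpose q b \<circ> \<sigma>)"
    have Kq: "?K q = (if b = q then c else I b)" by (simp add: \<sigma>q)
    show ?thesis
    proof (cases "b = q \<or> c = I b")
      case True
      have K: "?K p = (I \<circ> \<sigma>) p" if "p \<in> U" for p
        using True \<sigma>U[OF that] U(2) by (auto simp: transpose_def)
      have "f ?K (I(q := c)) = f (I \<circ> \<sigma>) I"
        by (rule dep, rule conjI, rule K) (use U in auto)
      moreover have "(\<forall>p\<in>insert q U - T. ?K p = (I(q := c)) p) \<longleftrightarrow> (\<forall>p\<in>U - T. (I \<circ> \<sigma>) p = I p)"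
      proof -
        have ins: "insert q U - T = insert q (U - T)" using U by auto
        have q: "?K q = (I(q := c)) q" unfolding Kq using True by auto
        have kk: "?K p = (I \<circ> \<sigma>) p" "(I(q := c)) p = I p" if "p \<in> U - T" for p
        proof -
          show "?K p = (I \<circ> \<sigma>) p" using that by (intro K) auto
        qed (use that U(2) in auto)
        have "(\<forall>p\<in>U - T. ?K p = (I(q := c)) p) \<longleftrightarrow> (\<forall>p\<in>U - T. (I \<circ> \<sigma>) p = I p)"
          by (intro ball_cong refl) (simp only: kk)
        with q show ?thesis unfolding ins ball_simps(7) by (simp only: simp_thms)
      qed
      ultimately show ?thesis using True by (simp only: if_True)
    next
      case False
      then have "?K q \<noteq> (I(q := c)) q" unfolding Kq by auto
      moreover have "q \<in> insert q U - T" using U by auto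
      ultimately have "\<not> (\<forall>p\<in>insert q U - T. ?K p = (I(q := c)) p)" by blast
      then show ?thesis using False by (simp only: if_False)
    qed
  qed
  have inner: "(\<Sum>c\<in>UNIV. \<Sum>b\<in>insert q U. of_int (sign (transpose q b \<circ> \<sigma>))
        * ?F' (I(q := c) \<circ> (transpose q b \<circ> \<sigma>)) (I(q := c)))
      = of_int (int CARD('n) - int (card U)) * (of_int (sign \<sigma>) * ?F (I \<circ> \<sigma>) I)"
    if \<sigma>: "\<sigma> permutes U" for \<sigma> I
  proof -
    let ?X = "of_int (sign \<sigma>) * ?F (I \<circ> \<sigma>) I"
    have perm: "permutation \<sigma>" unfolding permutation_permutes using \<sigma> U(1) by blast
    have sgn: "sign (transpose q b \<circ> \<sigma>) = (if b = q then sign \<sigma> else - sign \<sigma>)" for b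
      using sign_compose[OF permutation_swap_id perm, of q b] by (simp add: sign_swap_id)
    have "(\<Sum>c\<in>UNIV. \<Sum>b\<in>insert q U. of_int (sign (transpose q b \<circ> \<sigma>))
        * ?F' (I(q := c) \<circ> (transpose q b \<circ> \<sigma>)) (I(q := c)))
      = (\<Sum>c\<in>UNIV. \<Sum>b\<in>insert q U. if b = q then ?X else if c = I b then - ?X else 0)"
      by (intro sum.cong refl, subst F'[OF \<sigma>], assumption) (simp add: sgn)
    also have "\<dots> = (\<Sum>b\<in>insert q U. \<Sum>c\<in>UNIV. if b = q then ?X else if c = I b then - ?X else 0)"
      by (rule sum.swap)
    also have "\<dots> = of_nat CARD('n) * ?X + (\<Sum>b\<in>U. - ?X)"
    proof -
      have 1: "(\<Sum>c\<in>UNIV. if b = q then X else if c = I b then - X else 0) = - X"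
        if "b \<in> U" for b and X :: 'r
        using that U(2) by (cases "b = q") simp_all
      have 2: "(\<Sum>c\<in>UNIV. if q = q then X else if c = I q then - X else 0) = of_nat CARD('n) * X"
        for X :: 'r by simp
      have "(\<Sum>b\<in>insert q U. \<Sum>c\<in>UNIV. if b = q then X else if c = I b then - X else 0)
        = of_nat CARD('n) * X + (\<Sum>b\<in>U. - X)" for X :: 'r
        unfolding sum.insert[OF U(1,2)] 2 by (simp only: 1 cong: sum.cong)
      then show ?thesis .
    qed
    also have "\<dots> = of_int (int CARD('n) - int (card U)) * ?X"
      by (simp add: left_diff_distrib)
    finally show ?thesis .
  qed
  have "signed_trace (insert q U) ?F' = (\<Sum>I\<in>U \<rightarrow>\<^sub>E UNIV. \<Sum>c\<in>UNIV. \<Sum>\<sigma> | \<sigma> permutes U. \<Sum>b\<in>insert q U.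
      of_int (sign (transpose q b \<circ> \<sigma>)) * ?F' (I(q := c) \<circ> (transpose q b \<circ> \<sigma>)) (I(q := c)))"
    unfolding signed_trace_def sum_PiE_insert[OF U(2)] sum_permutes_insert[OF U(2)] ..
  also have "\<dots> = (\<Sum>I\<in>U \<rightarrow>\<^sub>E UNIV. \<Sum>\<sigma> | \<sigma> permutes U. \<Sum>c\<in>UNIV. \<Sum>b\<in>insert q U.
      of_int (sign (transpose q b \<circ> \<sigma>)) * ?F' (I(q := c) \<circ> (transpose q b \<circ> \<sigma>)) (I(q := c)))"
    by (rule sum.cong[OF refl]) (rule sum.swap)
  also have "\<dots> = (\<Sum>I\<in>U \<rightarrow>\<^sub>E UNIV. \<Sum>\<sigma> | \<sigma> permutes U.
      of_int (int CARD('n) - int (card U)) * (of_int (sign \<sigma>) * ?F (I \<circ> \<sigma>) I))"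
    by (rule sum.cong[OF refl], rule sum.cong[OF refl], rule inner) simp
  also have "\<dots> = of_int (int CARD('n) - int (card U)) * signed_trace U ?F"
    by (simp only: signed_trace_def sum_distrib_left)
  finally show ?thesis .
qed

text \<open>
  The constant \<open>c\<close> may depend on \<open>U\<close> and \<open>T\<close> but is the same for all functions of the indices
  in \<open>T\<close>.
\<close>

lemma signed_trace_partial:
  fixes U T :: "nat set"
  assumes "finite U" "T \<subseteq> U"
  obtains c :: int where "\<And>f :: (nat \<Rightarrow> 'n::finite) \<Rightarrow> (nat \<Rightarrow> 'n) \<Rightarrow> 'r::ring_1.
    (\<And>K I K' I'. (\<And>p. p \<in> T \<Longrightarrow> K p = K' p \<and> I p = I' p) \<Longrightarrow> f K I = f K' I') \<Longrightarrow>
    signed_trace U (\<lambda>K I. if \<forall>p\<in>U - T. K p = I p then f K I else 0) = of_int c * signed_trace T f"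
proof -
  have fin: "finite T" "finite (U - T)" using assms finite_subset by auto
  define local where "local f \<longleftrightarrow> (\<forall>K I K' I'. (\<forall>p\<in>T. K p = K' p \<and> I p = I' p) \<longrightarrow> f K I = f K' I')"
    for f :: "(nat \<Rightarrow> 'n) \<Rightarrow> (nat \<Rightarrow> 'n) \<Rightarrow> 'r"
  define good where "good V c \<longleftrightarrow> (\<forall>f. local f \<longrightarrow>
    signed_trace V (\<lambda>K I. if \<forall>p\<in>V - T. K p = I p then f K I else 0) = of_int c * signed_trace T f)"
    for V and c :: int
  have "\<exists>c. good (W \<union> T) c" if "finite W" "W \<inter> T = {}" for W
    using that
  proof (induction W)
    case empty
    show ?case by (intro exI[of _ 1]) (simp add: good_def)
  next
    case (insert q W)
    then obtain c where c: "good (W \<union> T) c" by blast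
    let ?c = "int CARD('n) - int (card (W \<union> T))"
    have W: "finite (W \<union> T)" "q \<notin> W \<union> T" "T \<subseteq> W \<union> T" using insert fin by auto
    have "good (insert q (W \<union> T)) (?c * c)"
      unfolding good_def
    proof (intro allI impI)
      fix f assume f: "local f"
      have "signed_trace (insert q (W \<union> T)) (\<lambda>K I. if \<forall>p\<in>insert q (W \<union> T) - T. K p = I p then f K I else 0)
        = of_int ?c * signed_trace (W \<union> T) (\<lambda>K I. if \<forall>p\<in>W \<union> T - T. K p = I p then f K I else 0)"
        by (rule signed_trace_insert[OF W]) (use f in \<open>unfold local_def, blast\<close>)
      also have "\<dots> = of_int ?c * (of_int c * signed_trace T f)"
        using c f unfolding good_def by (simp only: simp_thms)
      finally show "signed_trace (insert q (W \<union> T)) (\<lambda>K I. if \<forall>p\<in>insert q (W \<union> T) - T. K p = I p then f K I else 0)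
        = of_int (?c * c) * signed_trace T f"
        by (simp only: of_int_mult mult.assoc)
    qed
    then show ?case unfolding Un_insert_left by blast
  qed
  from this[OF fin(2)] obtain c where c: "good (U - T \<union> T) c" by blast
  have "U - T \<union> T = U" using assms(2) by auto
  with c have "good U c" by simp
  then show ?thesis
    unfolding good_def local_def by (intro that[of c]) blast
qed

text \<open>
  For numerical parameters these are generating series for Bethe subalgebras of the group
  algebra of the symmetric group, in the sense of Mukhin, Tarasov and Varchenko.
\<close>

definition bethe :: "nat \<Rightarrow> (nat \<Rightarrow> 'c::comm_ring_1) \<Rightarrow> nat \<Rightarrow> (nat \<Rightarrow> 'n, 'c) lop fps" where
  "bethe n t j = (\<Sum>S | S \<subseteq> {..<n} \<and> card S = j. scalars (\<Prod>u\<in>S. geom (t u)) * fps_const (antisymmetrizer S))"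

lemma sum_injections_image:
  fixes F :: "nat set \<Rightarrow> 'r::ring_1"
  assumes "finite T"
  shows "(\<Sum>s\<in>injections T n. F (s ` T)) = of_nat (fact (card T)) * (\<Sum>S | S \<subseteq> {..<n} \<and> card S = card T. F S)"
proof -
  let ?SS = "{S. S \<subseteq> {..<n} \<and> card S = card T}"
  have "(\<Sum>s\<in>injections T n. F (s ` T)) = (\<Sum>S\<in>?SS. \<Sum>s\<in>{s\<in>injections T n. s ` T = S}. F (s ` T))"
    by (rule sum.group[symmetric, OF finite_injections[OF assms]])
      (use assms in \<open>auto simp: injections_def card_image intro: finite_subset[of _ "Pow {..<n}"]\<close>)
  also have "\<dots> = (\<Sum>S\<in>?SS. of_nat (fact (card T)) * F S)"
  proof (rule sum.cong[OF refl])
    fix S assume S: "S \<in> ?SS"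
    have finS: "finite S" using S finite_subset by blast
    have "{s\<in>injections T n. s ` T = S} = {s\<in>T \<rightarrow>\<^sub>E S. inj_on s T}"
    proof (intro set_eqI iffI)
      fix s assume "s \<in> {s\<in>injections T n. s ` T = S}"
      then show "s \<in> {s\<in>T \<rightarrow>\<^sub>E S. inj_on s T}" by (auto simp: injections_def PiE_def)
    next
      fix s assume s: "s \<in> {s\<in>T \<rightarrow>\<^sub>E S. inj_on s T}"
      then have "s ` T = S"
        using S finS by (intro card_subset_eq) (auto simp: card_image)
      then show "s \<in> {s\<in>injections T n. s ` T = S}"
        using s S by (auto simp: injections_def PiE_def)
    qed
    then have "card {s\<in>injections T n. s ` T = S} = card {s\<in>T \<rightarrow>\<^sub>E S. inj_on s T}" by simp
    also have "\<dots> = prod ((-) (card T)) {0..<card T}"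
      using card_inj_on_subset_funcset[OF assms finS subset_refl] S by simp
    also have "\<dots> = fact (card T)"
      by (simp add: fact_prod_rev)
    finally have "card {s\<in>injections T n. s ` T = S} = fact (card T)" .
    moreover have "(\<Sum>s\<in>{s\<in>injections T n. s ` T = S}. F (s ` T)) = of_nat (card {s\<in>injections T n. s ` T = S}) * F S"
      by simp
    ultimately show "(\<Sum>s\<in>{s\<in>injections T n. s ` T = S}. F (s ` T)) = of_nat (fact (card T)) * F S"
      by simp
  qed
  finally show ?thesis by (simp add: sum_distrib_left)
qed

lemma signed_trace_normal_term:
  fixes t :: "nat \<Rightarrow> 'c::comm_ring_1"
  assumes U: "finite U" "T \<subseteq> U"
  obtains c :: int where
    "signed_trace U (normal_term n t U T :: (nat \<Rightarrow> 'n::finite) \<Rightarrow> _) = of_int c * bethe n t (card T)"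
proof -
  have finT: "finite T" using U finite_subset by blast
  obtain c :: int where c: "\<And>f :: (nat \<Rightarrow> 'n::finite) \<Rightarrow> (nat \<Rightarrow> 'n) \<Rightarrow> (nat \<Rightarrow> 'n, 'c) lop fps.
    (\<And>K I K' I'. (\<And>p. p \<in> T \<Longrightarrow> K p = K' p \<and> I p = I' p) \<Longrightarrow> f K I = f K' I') \<Longrightarrow>
    signed_trace U (\<lambda>K I. if \<forall>p\<in>U - T. K p = I p then f K I else 0) = of_int c * signed_trace T f"
    using signed_trace_partial[OF U] by blast
  let ?f = "\<lambda>K I. \<Sum>s\<in>injections T n. scalars (weight t T s) * fps_const (munits T s K I)
    :: (nat \<Rightarrow> 'n, 'c) lop fps"
  have "munits T s K I = (munits T s K' I' :: (nat \<Rightarrow> 'n, 'c) lop)"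
    if "\<And>p. p \<in> T \<Longrightarrow> K p = K' p \<and> I p = I' p" and "s \<in> injections T n" for K I K' I' s
  proof -
    have inj: "inj_on s T" using that(2) by (simp add: injections_def)
    have "overwrite T s I x r = overwrite T s I' x r" for x r
      using that(1) inj by (auto simp: overwrite_def)
    then have "overwrite T s I = overwrite T s I'" by (simp add: fun_eq_iff)
    then show ?thesis
      using that(1) by (intro lop_eqI) (simp add: app_munits cong: ball_cong)
  qed
  then have dep: "?f K I = ?f K' I'" if "\<And>p. p \<in> T \<Longrightarrow> K p = K' p \<and> I p = I' p" for K I K' I'
    using that by (intro sum.cong refl) metis
  have "signed_trace U (normal_term n t U T :: (nat \<Rightarrow> 'n) \<Rightarrow> _) = of_int c * signed_trace T ?f"
    unfolding normal_term_def[abs_def] by (rule c[OF dep])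
  also have "signed_trace T ?f = (\<Sum>s\<in>injections T n. scalars (weight t T s)
      * fps_const (\<Sum>I\<in>T \<rightarrow>\<^sub>E UNIV. \<Sum>\<sigma> | \<sigma> permutes T. of_int (sign \<sigma>) * munits T s (I \<circ> \<sigma>) I))"
    (is "_ = ?R")
  proof -
    have sc: "of_int z * (scalars w * fps_const E) = scalars w * fps_const (of_int z * E)"
      for z w and E :: "(nat \<Rightarrow> 'n, 'c) lop"
    proof (rule fps_ext)
      fix k
      show "fps_nth (of_int z * (scalars w * fps_const E)) k = fps_nth (scalars w * fps_const (of_int z * E)) k"
        by (simp add: fps_const_of_int[symmetric]) (metis mult.assoc mult_of_int_commute)
    qed
    have "signed_trace T ?f = (\<Sum>I\<in>T \<rightarrow>\<^sub>E UNIV. \<Sum>\<sigma> | \<sigma> permutes T. \<Sum>s\<in>injections T n.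
        scalars (weight t T s) * fps_const (of_int (sign \<sigma>) * munits T s (I \<circ> \<sigma>) I))"
      by (simp add: signed_trace_def sum_distrib_left sc)
    also have "\<dots> = (\<Sum>I\<in>T \<rightarrow>\<^sub>E UNIV. \<Sum>s\<in>injections T n. \<Sum>\<sigma> | \<sigma> permutes T.
        scalars (weight t T s) * fps_const (of_int (sign \<sigma>) * munits T s (I \<circ> \<sigma>) I))"
      by (rule sum.cong[OF refl]) (rule sum.swap)
    also have "\<dots> = (\<Sum>s\<in>injections T n. \<Sum>I\<in>T \<rightarrow>\<^sub>E UNIV. \<Sum>\<sigma> | \<sigma> permutes T.
        scalars (weight t T s) * fps_const (of_int (sign \<sigma>) * munits T s (I \<circ> \<sigma>) I))"
      by (rule sum.swap)
    also have "\<dots> = ?R" by (simp only: sum_distrib_left fps_const_sum)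
    finally show ?thesis .
  qed
  also have "?R = (\<Sum>s\<in>injections T n. scalars (\<Prod>u\<in>s ` T. geom (t u)) * fps_const (antisymmetrizer (s ` T)))"
  proof (rule sum.cong[OF refl])
    fix s assume "s \<in> injections T n"
    then have inj: "inj_on s T" by (simp add: injections_def)
    then have "weight t T s = (\<Prod>u\<in>s ` T. geom (t u))" by (simp add: weight_def prod.reindex)
    then show "scalars (weight t T s)
      * fps_const (\<Sum>I\<in>T \<rightarrow>\<^sub>E UNIV. \<Sum>\<sigma> | \<sigma> permutes T. of_int (sign \<sigma>) * munits T s (I \<circ> \<sigma>) I)
      = scalars (\<Prod>u\<in>s ` T. geom (t u)) * fps_const (antisymmetrizer (s ` T) :: (nat \<Rightarrow> 'n, 'c) lop)"
      unfolding signed_trace_munits[OF finT inj] by simp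
  qed
  also have "\<dots> = of_nat (fact (card T)) * bethe n t (card T)"
    unfolding bethe_def by (rule sum_injections_image[OF finT])
  finally have "signed_trace U (normal_term n t U T :: (nat \<Rightarrow> 'n) \<Rightarrow> _)
    = of_int (c * int (fact (card T))) * bethe n t (card T)"
    by (simp only: of_int_mult of_int_of_nat_eq mult.assoc)
  then show ?thesis by (rule that)
qed

lemma signed_trace_reducible:
  fixes t :: "nat \<Rightarrow> 'c::comm_ring_1" and Z :: "(nat \<Rightarrow> 'n::finite) \<Rightarrow> _"
  assumes "reducible n t U Z" "finite U"
  shows "\<exists>c :: nat \<Rightarrow> int. signed_trace U Z = (\<Sum>j\<le>card U. of_int (c j) * bethe n t j)"
  using assms(1)
proof induction
  case (normal T)
  obtain c :: int where c: "signed_trace U (normal_term n t U T :: (nat \<Rightarrow> 'n) \<Rightarrow> _) = of_int c * bethe n t (card T)"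
    using signed_trace_normal_term[OF assms(2) normal] by blast
  have "card T \<le> card U" using normal assms(2) by (rule card_mono[rotated])
  then have "(\<Sum>j\<le>card U. of_int (if j = card T then c else 0) * bethe n t j :: (nat \<Rightarrow> 'n, 'c) lop fps)
      = of_int c * bethe n t (card T)"
    by (subst sum.remove[of _ "card T"]) (auto intro!: sum.neutral)
  then show ?case using c by (intro exI[of _ "\<lambda>j. if j = card T then c else 0"]) simp
next
  case (symmetric p q Z)
  have "signed_trace U Z = 0" 
    by (rule signed_trace_symmetric_eq_0[OF assms(2) symmetric(1-3)]) (rule symmetric(4))
  then show ?case by (intro exI[of _ "\<lambda>_. 0"]) simp
next
  case zero
  show ?case by (intro exI[of _ "\<lambda>_. 0"]) (simp add: signed_trace_def)
next
  case (add Z Z')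
  then obtain c c' :: "nat \<Rightarrow> int" where
    "signed_trace U Z = (\<Sum>j\<le>card U. of_int (c j) * bethe n t j)"
    "signed_trace U Z' = (\<Sum>j\<le>card U. of_int (c' j) * bethe n t j)" by auto
  then show ?case
    by (intro exI[of _ "\<lambda>j. c j + c' j"]) (simp add: signed_trace_add distrib_right sum.distrib)
qed

section \<open>The commuting family\<close>

lemma antisymmetrizer_mult:
  assumes "finite S" "finite S'"
  shows "antisymmetrizer S * antisymmetrizer S' = (\<Sum>\<sigma> | \<sigma> permutes S. \<Sum>\<tau> | \<tau> permutes S'.
    of_int (sign (\<sigma> \<circ> \<tau>)) * permop (\<sigma> \<circ> \<tau>))"
proof -
  have "of_int (sign \<sigma>) * permop \<sigma> * (of_int (sign \<tau>) * permop \<tau>)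
      = (of_int (sign (\<sigma> \<circ> \<tau>)) * permop (\<sigma> \<circ> \<tau>) :: ('a \<Rightarrow> 'b, 'c) lop)"
    if "\<sigma> permutes S" "\<tau> permutes S'" for \<sigma> \<tau>
  proof -
    have perm: "permutation \<sigma>" "permutation \<tau>"
      unfolding permutation_permutes using that assms by blast+
    have "of_int (sign \<sigma>) * permop \<sigma> * (of_int (sign \<tau>) * permop \<tau>)
        = of_int (sign \<sigma>) * (permop \<sigma> * of_int (sign \<tau>)) * (permop \<tau> :: ('a \<Rightarrow> 'b, 'c) lop)"
      by (simp only: mult.assoc)
    also have "permop \<sigma> * of_int (sign \<tau>) = of_int (sign \<tau>) * (permop \<sigma> :: ('a \<Rightarrow> 'b, 'c) lop)"
      by (rule mult_of_int_commute[symmetric])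
    finally show ?thesis
      by (simp only: sign_compose[OF perm] of_int_mult mult.assoc permop_mult)
  qed
  then show ?thesis
    unfolding antisymmetrizer_def sum_product by (intro sum.cong refl) simp
qed

text \<open>
  Signs are multiplicative, so the product of two antisymmetrizers is a sum of a function of
  \<open>\<sigma> \<circ> \<tau>\<close>, and the count of factorizations applies.
\<close>

lemma sum_antisymmetrizer_commutators:
  assumes "finite A" "finite B" "A \<inter> B = {}"
  shows "(\<Sum>K | K \<subseteq> A \<and> card K = p. \<Sum>L | L \<subseteq> B \<and> card L = q.
    antisymmetrizer (A \<union> L) * antisymmetrizer (B \<union> K) - antisymmetrizer (B \<union> K) * antisymmetrizer (A \<union> L)) = 0"
proof -
  have fin: "finite (A \<union> L)" "finite (B \<union> K)" if "K \<subseteq> A" "L \<subseteq> B" for K L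
    using that assms finite_subset by auto
  let ?F = "\<lambda>\<pi>. of_int (sign \<pi>) * permop \<pi>"
  have "(\<Sum>K | K \<subseteq> A \<and> card K = p. \<Sum>L | L \<subseteq> B \<and> card L = q. antisymmetrizer (A \<union> L) * antisymmetrizer (B \<union> K))
      = (\<Sum>K | K \<subseteq> A \<and> card K = p. \<Sum>L | L \<subseteq> B \<and> card L = q.
          \<Sum>\<sigma> | \<sigma> permutes A \<union> L. \<Sum>\<tau> | \<tau> permutes B \<union> K. ?F (\<sigma> \<circ> \<tau>))"
    by (intro sum.cong[OF refl] antisymmetrizer_mult fin) auto
  also have "\<dots> = (\<Sum>K | K \<subseteq> A \<and> card K = p. \<Sum>L | L \<subseteq> B \<and> card L = q.
          \<Sum>\<sigma> | \<sigma> permutes A \<union> L. \<Sum>\<tau> | \<tau> permutes B \<union> K. ?F (\<tau> \<circ> \<sigma>))"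
    by (rule sum_comp_overlapping_symmetric_groups[OF assms])
  also have "\<dots> = (\<Sum>K | K \<subseteq> A \<and> card K = p. \<Sum>L | L \<subseteq> B \<and> card L = q.
      antisymmetrizer (B \<union> K) * antisymmetrizer (A \<union> L))"
  proof (rule sum.cong[OF refl], rule sum.cong[OF refl])
    fix K L assume "K \<in> {K. K \<subseteq> A \<and> card K = p}" "L \<in> {L. L \<subseteq> B \<and> card L = q}"
    then have "finite (A \<union> L)" "finite (B \<union> K)" using fin by auto
    then show "(\<Sum>\<sigma> | \<sigma> permutes A \<union> L. \<Sum>\<tau> | \<tau> permutes B \<union> K. ?F (\<tau> \<circ> \<sigma>))
        = antisymmetrizer (B \<union> K) * antisymmetrizer (A \<union> L)"
      by (subst antisymmetrizer_mult) (simp_all only: sum.swap[of _ "{\<sigma>. \<sigma> permutes A \<union> L}"])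
  qed
  finally have eq: "(\<Sum>K | K \<subseteq> A \<and> card K = p. \<Sum>L | L \<subseteq> B \<and> card L = q. antisymmetrizer (A \<union> L) * antisymmetrizer (B \<union> K))
    = (\<Sum>K | K \<subseteq> A \<and> card K = p. \<Sum>L | L \<subseteq> B \<and> card L = q. antisymmetrizer (B \<union> K) * antisymmetrizer (A \<union> L))" .
  show ?thesis unfolding sum_subtractf eq by (rule diff_self)
qed

lemma fps_const_prod: "fps_const (prod f A) = (\<Prod>a\<in>A. fps_const (f a))" for f :: "'z \<Rightarrow> 'c::comm_ring_1"
  by (induction A rule: infinite_finite_induct) (simp_all add: fps_const_mult[symmetric] del: fps_const_mult)

lemma prod_geom_fps_const:
  "fps_nth (\<Prod>s\<in>S. geom (fps_const (t s))) b = fps_const (fps_nth (\<Prod>s\<in>S. geom (t s)) b)"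
proof (induction S arbitrary: b rule: infinite_finite_induct)
  case (insert s S)
  have g: "fps_nth (geom (fps_const (t s))) i = fps_const (fps_nth (geom (t s)) i)" for i
    by (simp add: geom_nth fps_const_power)
  show ?case
    using insert(1,2) by (simp add: fps_mult_nth insert(3) g fps_const_sum)
qed simp_all

text \<open>
  The matrix coefficients of the commutators of antisymmetrizers lie in a commutative ring,
  where the identity for overlapping products applies, with \<open>x\<close> and \<open>y\<close> the series \<open>geom\<close> in
  two independent variables.
\<close>

lemma bethe_commute:
  fixes t :: "nat \<Rightarrow> 'c::idom"
  shows "fps_nth (bethe n t j) a * fps_nth (bethe n t l) b
    = fps_nth (bethe n t l) b * (fps_nth (bethe n t j) a :: (nat \<Rightarrow> 'n, 'c) lop)"
proof -
  let ?SS = "\<lambda>j. {S. S \<subseteq> {..<n} \<and> card S = j}"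
  let ?g = "\<lambda>S. \<Prod>u\<in>S. geom (t u)"
  define D :: "nat set \<Rightarrow> nat set \<Rightarrow> (nat \<Rightarrow> 'n, 'c) lop"
    where "D S S' = antisymmetrizer S * antisymmetrizer S' - antisymmetrizer S' * antisymmetrizer S" for S S'
  have nth: "fps_nth (bethe n t j) a = (\<Sum>S\<in>?SS j. scalar (fps_nth (?g S) a) * (antisymmetrizer S :: (nat \<Rightarrow> 'n, 'c) lop))"
    for j a
    by (simp add: bethe_def fps_sum_nth scalars_nth)
  have LR: "fps_nth (bethe n t j) a * fps_nth (bethe n t l) b
      - fps_nth (bethe n t l) b * (fps_nth (bethe n t j) a :: (nat \<Rightarrow> 'n, 'c) lop)
      = (\<Sum>S\<in>?SS j. \<Sum>S'\<in>?SS l. scalar (fps_nth (?g S) a * fps_nth (?g S') b) * D S S')"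
  proof -
    have 1: "fps_nth (bethe n t j) a * fps_nth (bethe n t l) b
        = (\<Sum>S\<in>?SS j. \<Sum>S'\<in>?SS l. scalar (fps_nth (?g S) a * fps_nth (?g S') b) * (antisymmetrizer S * antisymmetrizer S' :: (nat \<Rightarrow> 'n, 'c) lop))"
      unfolding nth sum_product by (simp only: scalar_mult_swap)
    have 2: "fps_nth (bethe n t l) b * fps_nth (bethe n t j) a
        = (\<Sum>S\<in>?SS j. \<Sum>S'\<in>?SS l. scalar (fps_nth (?g S) a * fps_nth (?g S') b) * (antisymmetrizer S' * antisymmetrizer S :: (nat \<Rightarrow> 'n, 'c) lop))"
      unfolding nth sum_product
      by (subst sum.swap) (simp only: scalar_mult_swap mult.commute[of "fps_nth (?g _) b"])
    show ?thesis unfolding 1 2 D_def by (simp only: right_diff_distrib sum_subtractf)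
  qed
  have "app (\<Sum>S\<in>?SS j. \<Sum>S'\<in>?SS l. scalar (fps_nth (?g S) a * fps_nth (?g S') b) * D S S') f x = 0" for f x
  proof -
    define x' where "x' s = fps_const (geom (t s))" for s
    define y' where "y' s = geom (fps_const (t s))" for s
    define d where "d S S' = fps_const (fps_const (app (D S S') f x))" for S S'
    have "(\<Sum>S\<in>?SS j. \<Sum>S'\<in>?SS l. prod x' S * prod y' S' * d S S') = 0"
    proof (rule sum_overlapping_products_eq_0[where \<omega> = "fps_const fps_X" and \<zeta> = fps_X])
      show "finite {..<n}" by simp
      show "fps_const (fps_X :: 'c fps) \<noteq> fps_X"
      proof
        assume "fps_const (fps_X :: 'c fps) = fps_X"
        then have "fps_nth (fps_const (fps_X :: 'c fps)) 1 = fps_nth (fps_X :: 'c fps fps) 1" by simp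
        then show False by simp
      qed
      show "(fps_const fps_X - fps_X) * (x' s * y' s) = fps_X * x' s - fps_const fps_X * y' s" for s
        unfolding x'_def y'_def by (rule geom_mult_geom)
      show "(\<Sum>K | K \<subseteq> A \<and> card K = p. \<Sum>L | L \<subseteq> B \<and> card L = q. d (A \<union> L) (B \<union> K)) = 0"
        if "A \<subseteq> {..<n}" "B \<subseteq> {..<n}" "A \<inter> B = {}" for A B p q
      proof -
        have "finite A" "finite B" using that by (auto intro: finite_subset)
        then have "app (\<Sum>K | K \<subseteq> A \<and> card K = p. \<Sum>L | L \<subseteq> B \<and> card L = q. D (A \<union> L) (B \<union> K)) f x = 0"
          unfolding D_def by (subst sum_antisymmetrizer_commutators) (use that(3) in simp_all)
        then show ?thesis unfolding d_def app_sum by (simp add: fps_const_sum[symmetric])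
      qed
    qed
    then have "fps_nth (fps_nth (\<Sum>S\<in>?SS j. \<Sum>S'\<in>?SS l. prod x' S * prod y' S' * d S S') b) a = 0"
      by simp
    then show ?thesis
      unfolding x'_def y'_def d_def
      by (simp add: fps_sum_nth app_sum fps_const_prod[symmetric] prod_geom_fps_const mult.assoc)
  qed
  then have "(\<Sum>S\<in>?SS j. \<Sum>S'\<in>?SS l. scalar (fps_nth (?g S) a * fps_nth (?g S') b) * D S S') = 0"
    by (intro lop_eqI) simp
  then show ?thesis using LR by simp
qed

section \<open>Evaluation representations of the enveloping algebra\<close>

text \<open>
  The polynomials over \<open>'k\<close> in variables indexed by natural numbers.
\<close>

type_synonym 'k pol = "(nat \<Rightarrow>\<^sub>0 nat) \<Rightarrow>\<^sub>0 'k"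

lemma poly_mapping_additive_induct [case_names zero single add]:
  assumes "P 0" "\<And>w c. P (Poly_Mapping.single w c)" "\<And>f g. P f \<Longrightarrow> P g \<Longrightarrow> P (f + g)"
  shows "P (f :: 'w \<Rightarrow>\<^sub>0 'c::comm_monoid_add)"
proof -
  have "P (\<Sum>w\<in>A. Poly_Mapping.single w (Poly_Mapping.lookup f w))" for A
    by (induction A rule: infinite_finite_induct) (auto intro: assms)
  moreover have "f = (\<Sum>w\<in>Poly_Mapping.keys f. Poly_Mapping.single w (Poly_Mapping.lookup f w))"
    by (rule poly_mapping_eqI) (auto simp: lookup_sum lookup_single when_def in_keys_iff sum.delta)
  ultimately show ?thesis by metis
qed

definition cst :: "'k::comm_ring_1 \<Rightarrow> 'k pol" where
  "cst c = Poly_Mapping.single 0 c"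

lemma cst_hom: "cst 0 = 0" "cst 1 = 1" "cst (c + d) = cst c + cst d" "cst (c * d) = cst c * cst d"
  by (simp_all add: cst_def single_add mult_single)

definition var :: "nat \<Rightarrow> 'k::comm_ring_1 pol" where
  "var s = Poly_Mapping.single (Poly_Mapping.single s 1) 1"

definition weighted :: "'k::comm_ring_1 \<Rightarrow> ('x, 'k pol) lop \<Rightarrow> ('x, 'k pol) lop" where
  "weighted c T = scalar (cst c) * T"

lemma weighted_add: "weighted (c + d) T = weighted c T + weighted d T"
  and weighted_0: "weighted 0 T = 0" and weighted_1: "weighted 1 T = T"
  and weighted_mult: "weighted c S * weighted d T = weighted (c * d) (S * T)"
  and weighted_weighted: "weighted c (weighted d T) = weighted (c * d) T"
proof -
  show "weighted c S * weighted d T = weighted (c * d) (S * T)"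
  proof -
    have "weighted c S * weighted d T = scalar (cst c) * (S * scalar (cst d)) * T"
      by (simp only: weighted_def mult.assoc)
    then show ?thesis by (simp only: scalar_comm[of S] weighted_def cst_hom scalar_hom mult.assoc)
  qed
qed (simp_all add: weighted_def cst_hom distrib_right distrib_left mult.assoc)

definition extend :: "('w \<Rightarrow> ('x, 'k::comm_ring_1 pol) lop) \<Rightarrow> ('w \<Rightarrow>\<^sub>0 'k) \<Rightarrow> ('x, 'k pol) lop" where
  "extend F f = (\<Sum>w\<in>Poly_Mapping.keys f. weighted (Poly_Mapping.lookup f w) (F w))"

lemma extend_superset:
  assumes "finite A" "Poly_Mapping.keys f \<subseteq> A"
  shows "extend F f = (\<Sum>w\<in>A. weighted (Poly_Mapping.lookup f w) (F w))"
  unfolding extend_def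
  by (rule sum.mono_neutral_left) (use assms in \<open>auto simp: in_keys_iff weighted_0\<close>)

lemma extend_add: "extend F (f + g) = extend F f + extend F g"
proof -
  let ?A = "Poly_Mapping.keys f \<union> Poly_Mapping.keys g"
  show ?thesis
    by (subst (1 2 3) extend_superset[where A = ?A])
       (use Poly_Mapping.keys_add[of f g] in \<open>auto simp: lookup_add weighted_add sum.distrib\<close>)
qed

lemma extend_0: "extend F 0 = 0"
  by (simp add: extend_def)

lemma extend_uminus: "extend F (- f) = - extend F f"
  using extend_add[of F f "- f"] by (simp add: extend_0 eq_neg_iff_add_eq_0 add.commute)

lemma extend_diff: "extend F (f - g) = extend F f - extend F g"
  using extend_add[of F f "- g"] by (simp add: extend_uminus)

lemma extend_single: "extend F (Poly_Mapping.single w c) = weighted c (F w)"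
  by (subst extend_superset[where A = "{w}"]) (auto simp: lookup_single)

text \<open>
  The key \<open>(a, i, j)\<close> stands for \<open>E\<^sub>i\<^sub>j t\<^sup>a\<^sup>+\<^sup>1\<close>.
\<close>

definition rep_basis :: "nat \<Rightarrow> nat \<times> 'n \<times> 'n \<Rightarrow> (nat \<Rightarrow> 'n, 'k::comm_ring_1 pol) lop" where
  "rep_basis n = (\<lambda>(a, i, j). \<Sum>s<n. scalar (var s ^ Suc a) * munit s i j)"

definition rep_gtrig :: "nat \<Rightarrow> ('k::field, 'n::finite) gtrig \<Rightarrow> (nat \<Rightarrow> 'n, 'k pol) lop" where
  "rep_gtrig n = extend (rep_basis n)"

lemma rep_gtrig_Lt: "a \<ge> 1 \<Longrightarrow> rep_gtrig n (Lt a i j) = (\<Sum>s<n. scalar (var s ^ a) * munit s i j)"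
  by (cases a) (auto simp: rep_gtrig_def Lt_def extend_single weighted_1 rep_basis_def)

lemma rep_gtrig_scale: "rep_gtrig n (gscale c x) = weighted c (rep_gtrig n x)"
proof (induction x rule: poly_mapping_additive_induct)
  case (single w d)
  have "gscale c (Poly_Mapping.single w d) = Poly_Mapping.single w (c * d)"
    by (rule poly_mapping_eqI) (simp add: lookup_single when_def)
  then show ?case by (simp add: rep_gtrig_def extend_single weighted_weighted)
qed (simp_all add: rep_gtrig_def extend_0 extend_add gs.scale_right_distrib weighted_def distrib_left)

text \<open>
  Contributions of two different slots commute, and within one slot the matrix units satisfy
  the bracket of \<open>gl\<^sub>N\<close> while the powers of the parameter multiply.
\<close>

lemma rep_gtrig_br_Lt:
  assumes "a \<ge> 1" "b \<ge> 1"
  shows "rep_gtrig n (gbr (Lt a i j) (Lt b p q))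
    = rep_gtrig n (Lt a i j) * rep_gtrig n (Lt b p q)
      - rep_gtrig n (Lt b p q) * (rep_gtrig n (Lt a i j) :: (nat \<Rightarrow> 'n::finite, 'k::field pol) lop)"
proof -
  let ?z = "\<lambda>s. scalar (var s ^ (a + b)) :: (nat \<Rightarrow> 'n, 'k pol) lop"
  have prod: "(\<Sum>s<n. scalar (var s ^ a) * munit s i j) * (\<Sum>s<n. scalar (var s ^ b) * munit s p q)
      - (\<Sum>s<n. scalar (var s ^ b) * munit s p q) * (\<Sum>s<n. scalar (var s ^ a) * munit s i j)
      = (\<Sum>s<n. ?z s * (munit s i j * munit s p q - munit s p q * munit s i j))"
  proof -
    have "(\<Sum>s<n. scalar (var s ^ a) * munit s i j) * (\<Sum>s<n. scalar (var s ^ b) * munit s p q)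
      - (\<Sum>s<n. scalar (var s ^ b) * munit s p q) * (\<Sum>s<n. scalar (var s ^ a) * munit s i j)
      = (\<Sum>s<n. \<Sum>s'<n. scalar (var s ^ a * var s' ^ b) * (munit s i j * munit s' p q - munit s' p q * munit s i j)
          :: (nat \<Rightarrow> 'n, 'k pol) lop)"
    proof -
      have "(\<Sum>s<n. scalar (var s ^ b) * munit s p q) * (\<Sum>s<n. scalar (var s ^ a) * munit s i j)
        = (\<Sum>s<n. \<Sum>s'<n. scalar (var s ^ a * var s' ^ b) * (munit s' p q * munit s i j)
          :: (nat \<Rightarrow> 'n, 'k pol) lop)"
        unfolding sum_product
        by (subst sum.swap) (simp only: scalar_mult_swap mult.commute[of "var _ ^ b"])
      moreover have "(\<Sum>s<n. scalar (var s ^ a) * munit s i j) * (\<Sum>s<n. scalar (var s ^ b) * munit s p q)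
        = (\<Sum>s<n. \<Sum>s'<n. scalar (var s ^ a * var s' ^ b) * (munit s i j * munit s' p q)
          :: (nat \<Rightarrow> 'n, 'k pol) lop)"
        unfolding sum_product by (simp only: scalar_mult_swap)
      ultimately show ?thesis by (simp only: right_diff_distrib sum_subtractf)
    qed
    also have "\<dots> = (\<Sum>s<n. \<Sum>s'<n. if s' = s
        then ?z s * (munit s i j * munit s p q - munit s p q * munit s i j) else 0)"
      by (intro sum.cong refl) (auto simp: power_add munit_commute)
    also have "\<dots> = (\<Sum>s<n. ?z s * (munit s i j * munit s p q - munit s p q * munit s i j))"
      by (intro sum.cong refl) simp
    finally show ?thesis .
  qed
  have minus: "rep_gtrig n (x - y) = rep_gtrig n x - rep_gtrig n y"
    and zero: "rep_gtrig n 0 = 0" for x y :: "('k, 'n) gtrig"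
    by (simp_all add: rep_gtrig_def extend_diff extend_0)
  have ab: "a + b \<ge> 1" using assms by simp
  show ?thesis
    unfolding gbr_Lt_explicit[OF assms] minus rep_gtrig_Lt[OF assms(1)] rep_gtrig_Lt[OF assms(2)] prod
    by (auto simp: munit_mult zero rep_gtrig_Lt[OF ab] right_diff_distrib sum_subtractf sum_negf)
qed

lemma rep_gtrig_br:
  fixes x y :: "('k::field, 'n::finite) gtrig"
  shows "rep_gtrig n (gbr x y) = rep_gtrig n x * rep_gtrig n y - rep_gtrig n y * rep_gtrig n x"
proof -
  have add: "rep_gtrig n (x + y) = rep_gtrig n x + rep_gtrig n y" for x y :: "('k, 'n) gtrig"
    by (simp add: rep_gtrig_def extend_add)
  have w1: "weighted c S * T = weighted c (S * T)" and w2: "T * weighted c S = weighted c (T * S)"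
    for c :: 'k and S T :: "(nat \<Rightarrow> 'n, 'k pol) lop"
    using weighted_mult[of c S 1 T] weighted_mult[of 1 T c S] by (simp_all add: weighted_1)
  have wd: "weighted c (S - T) = weighted c S - weighted c T"
    for c :: 'k and S T :: "(nat \<Rightarrow> 'n, 'k pol) lop" by (simp add: weighted_def right_diff_distrib)
  show ?thesis
  proof (induction x rule: gtrig_induct)
    case (Lt a i j)
    note a = this
    show ?case
    proof (induction y rule: gtrig_induct)
      case (Lt b p q)
      then show ?case using a by (rule rep_gtrig_br_Lt[rotated])
    qed (simp_all only: gbr_add_right gbr_scale_right add rep_gtrig_scale w1 w2 wd distrib_left distrib_right add_diff_add)
  qed (simp_all only: gbr_add_left gbr_scale_left add rep_gtrig_scale w1 w2 wd distrib_left distrib_right add_diff_add)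
qed

definition rep_free :: "nat \<Rightarrow> (('k::field, 'n::finite) gtrig, 'k) free_algebra \<Rightarrow> (nat \<Rightarrow> 'n, 'k pol) lop" where
  "rep_free n = extend (\<lambda>w. prod_list (map (rep_gtrig n) (letters w)))"

lemma rep_free_mult: "rep_free n (f * g) = rep_free n f * rep_free n g"
proof (induction f rule: poly_mapping_additive_induct)
  case (single v c)
  show ?case
  proof (induction g rule: poly_mapping_additive_induct)
    case (single w d)
    show ?case
      by (simp add: rep_free_def mult_single extend_single weighted_mult plus_word_monoid_def)
  qed (simp_all add: rep_free_def extend_0 extend_add distrib_left)
qed (simp_all add: rep_free_def extend_0 extend_add distrib_right)

lemma rep_free_add: "rep_free n (f + g) = rep_free n f + rep_free n g"
  and rep_free_diff: "rep_free n (f - g) = rep_free n f - rep_free n g"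
  and rep_free_0: "rep_free n 0 = 0"
  and rep_free_gen: "rep_free n (gen x) = rep_gtrig n x"
  and rep_free_const: "rep_free n (const c) = scalar (cst c)"
  by (simp_all add: rep_free_def extend_add extend_diff extend_0 extend_single gen_def const_def
      weighted_1 zero_word_monoid_def) (simp add: weighted_def)

lemma rep_free_1: "rep_free n 1 = 1"
  using rep_free_const[of n 1] by (simp add: const_def cst_hom)

lemma rep_free_env_ideal: "a \<in> env_ideal gscale gbr \<Longrightarrow> rep_free n a = 0"
proof (induction rule: env_ideal.induct)
  case (gen_add x y)
  then show ?case by (simp add: rep_free_diff rep_free_gen rep_gtrig_def extend_add)
next
  case (gen_scale c x)
  then show ?case
    by (simp add: rep_free_diff rep_free_gen rep_free_mult rep_free_const rep_gtrig_scale weighted_def)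
next
  case (gen_br x y)
  then show ?case by (simp add: rep_free_diff rep_free_gen rep_free_mult rep_gtrig_br)
qed (simp_all add: rep_free_0 rep_free_add rep_free_mult)

lift_definition rep :: "nat \<Rightarrow> ('k::field, 'n::finite) U_gtrig \<Rightarrow> (nat \<Rightarrow> 'n, 'k pol) lop" is rep_free
proof -
  fix n and a b :: "(('k, 'n) gtrig, 'k) free_algebra"
  assume "env_rel a b"
  then show "rep_free n a = rep_free n b"
    using rep_free_env_ideal[of "a - b" n] by (simp add: env_rel_def rep_free_diff)
qed

lemma rep_add: "rep n (x + y) = rep n x + rep n y"
  by transfer (rule rep_free_add)

lemma rep_diff: "rep n (x - y) = rep n x - rep n y"
  by transfer (rule rep_free_diff)

lemma rep_mult: "rep n (x * y) = rep n x * rep n y"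
  by transfer (rule rep_free_mult)

lemma rep_0: "rep n 0 = 0"
  by transfer (rule rep_free_0)

lemma rep_1: "rep n 1 = 1"
  by transfer (rule rep_free_1)

lemma rep_U_of: "rep n (U_of x) = rep_gtrig n x"
  unfolding U_of_def by (simp add: rep.abs_eq rep_free_gen)

lemma rep_U_const: "rep n (U_const c) = scalar (cst c)"
  unfolding U_const_def by (simp add: rep.abs_eq rep_free_const)

lemma rep_sum: "rep n (sum f A) = (\<Sum>a\<in>A. rep n (f a))"
  by (induction A rule: infinite_finite_induct) (simp_all add: rep_0 rep_add)

lemma rep_prod_list: "rep n (prod_list xs) = prod_list (map (rep n) xs)"
  by (induction xs) (simp_all add: rep_1 rep_mult)

section \<open>Filtration of the enveloping algebra by degree\<close>

definition basis_monomial :: "(nat \<times> 'n \<times> 'n) list \<Rightarrow> ('k::field, 'n::finite) U_gtrig" where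
  "basis_monomial l = prod_list (map (\<lambda>b. U_of (Poly_Mapping.single b 1)) l)"

lemma basis_monomial_Nil: "basis_monomial [] = 1"
  and basis_monomial_append: "basis_monomial (l @ l') = basis_monomial l * basis_monomial l'"
  and basis_monomial_Cons: "basis_monomial (b # l) = U_of (Poly_Mapping.single b 1) * basis_monomial l"
  by (simp_all add: basis_monomial_def)

lemma U_const_add: "U_const (c + d) = U_const c + U_const d"
  unfolding U_const_def const_def by (simp add: plus_U_gtrig.abs_eq single_add)

lemma U_const_mult: "U_const (c * d) = U_const c * U_const d"
  unfolding U_const_def const_def by (simp add: times_U_gtrig.abs_eq mult_single)

lemma U_const_0: "U_const 0 = 0"
  unfolding U_const_def const_def by (simp add: zero_U_gtrig_def)

lemma U_const_sum: "U_const (sum f A) = (\<Sum>a\<in>A. U_const (f a))"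
  by (induction A rule: infinite_finite_induct) (simp_all add: U_const_0 U_const_add)

lemma U_const_1: "U_const 1 = 1"
  unfolding U_const_def const_def by (simp add: one_U_gtrig_def)

lemma const_central: "const c * f = f * const c"
proof (induction f rule: poly_mapping_additive_induct)
  case (single w d)
  show ?case by (simp add: const_def mult_single mult.commute)
qed (simp_all add: distrib_left distrib_right)

lemma U_const_central: "U_const c * x = x * U_const c"
  unfolding U_const_def by (induct x rule: U_gtrig.abs_induct) (simp add: times_U_gtrig.abs_eq const_central)

lemma abs_U_gtrig_eqI: "a - b \<in> env_ideal gscale gbr \<Longrightarrow> abs_U_gtrig a = abs_U_gtrig b"
  using U_gtrig.abs_eq_iff[of a b] by (simp add: env_rel_def)

lemma U_of_add: "U_of (x + y) = U_of x + U_of y"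
  unfolding U_of_def plus_U_gtrig.abs_eq
  by (rule abs_U_gtrig_eqI) (use env_ideal.gen_add[of x y] in \<open>simp add: diff_diff_add\<close>)

lemma U_of_scale: "U_of (gscale c x) = U_const c * U_of x"
  unfolding U_of_def U_const_def times_U_gtrig.abs_eq
  by (rule abs_U_gtrig_eqI) (rule env_ideal.gen_scale)

lemma U_of_br: "U_of (gbr x y) = U_of x * U_of y - U_of y * U_of x"
proof -
  have "abs_U_gtrig (gen x * gen y - gen y * gen x) = abs_U_gtrig (gen (gbr x y))"
    by (rule abs_U_gtrig_eqI) (rule env_ideal.gen_br)
  then show ?thesis
    unfolding U_of_def by (simp add: times_U_gtrig.abs_eq minus_U_gtrig.abs_eq)
qed

text \<open>
  Spanned by the monomials of length at most \<open>d\<close> in the basis of the Lie algebra, in any order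
  of the letters.
\<close>

inductive filtered :: "nat \<Rightarrow> ('k::field, 'n::finite) U_gtrig \<Rightarrow> bool" for d where
  zero: "filtered d 0"
| monomial: "length l \<le> d \<Longrightarrow> filtered d (U_const c * basis_monomial l)"
| add: "filtered d x \<Longrightarrow> filtered d y \<Longrightarrow> filtered d (x + y)"

lemma filtered_basis_monomial: "length l \<le> d \<Longrightarrow> filtered d (basis_monomial l)"
  using filtered.monomial[of l d 1] by (simp add: U_const_1)

lemma filtered_sum: "(\<And>a. a \<in> A \<Longrightarrow> filtered d (f a)) \<Longrightarrow> filtered d (sum f A)"
  by (induction A rule: infinite_finite_induct) (simp_all add: filtered.zero filtered.add)

lemma filtered_mono: "filtered d x \<Longrightarrow> d \<le> e \<Longrightarrow> filtered e x"
  by (induction rule: filtered.induct) (auto intro: filtered.intros)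

lemma filtered_mult: "filtered d x \<Longrightarrow> filtered e y \<Longrightarrow> filtered (d + e) (x * y)"
proof (induction rule: filtered.induct)
  case (monomial l c)
  note l = this(1)
  from monomial(2) show ?case
  proof (induction rule: filtered.induct)
    case (monomial l' c')
    have "U_const c * basis_monomial l * (U_const c' * basis_monomial l')
        = U_const c * (basis_monomial l * U_const c') * basis_monomial l'"
      by (simp only: mult.assoc)
    also have "\<dots> = U_const (c * c') * basis_monomial (l @ l')"
      by (simp only: U_const_central[of c' "basis_monomial l", symmetric] U_const_mult basis_monomial_append mult.assoc)
    finally show ?case using l monomial by (simp add: filtered.monomial)
  qed (simp_all add: filtered.zero filtered.add distrib_left)
qed (simp_all add: filtered.zero filtered.add distrib_right)

lemma filtered_uminus: "filtered d x \<Longrightarrow> filtered d (- x)"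
proof (induction rule: filtered.induct)
  case (monomial l c)
  have "U_const (- c) + U_const c = (0 :: ('a, 'b) U_gtrig)"
    by (simp add: U_const_add[symmetric] U_const_0)
  then have "U_const (- c) = (- U_const c :: ('a, 'b) U_gtrig)" by (rule eq_neg_iff_add_eq_0[THEN iffD2])
  then have "- (U_const c * basis_monomial l) = (U_const (- c) * basis_monomial l :: ('a, 'b) U_gtrig)"
    by simp
  then show ?case using filtered.monomial[OF monomial, of "- c"] by (simp only:)
next
  case (add x y)
  then show ?case using filtered.add[of d "- x" "- y"] by simp
qed (simp add: filtered.zero)

lemma filtered_diff: "filtered d x \<Longrightarrow> filtered d y \<Longrightarrow> filtered d (x - y)"
  using filtered.add[of d x "- y"] filtered_uminus[of d y] by simp

lemma filtered_U_of: "filtered 1 (U_of x :: ('k::field, 'n::finite) U_gtrig)"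
proof (induction x rule: gtrig_induct)
  case (Lt k i j)
  then have "basis_monomial [(k - 1, i, j)] = (U_of (Lt k i j) :: ('k, 'n) U_gtrig)"
    by (simp add: basis_monomial_def Lt_def)
  moreover have "filtered 1 (basis_monomial [(k - 1, i, j)] :: ('k, 'n) U_gtrig)"
    by (rule filtered_basis_monomial) simp
  ultimately show ?case by simp
next
  case (add x y)
  then show ?case by (simp add: U_of_add filtered.add)
next
  case (scale c x)
  have "filtered 0 (U_const c :: ('k, 'n) U_gtrig)"
    using filtered.monomial[of "[]" 0 c] by (simp add: basis_monomial_Nil)
  then show ?case using filtered_mult[of 0 "U_const c" 1] scale by (simp add: U_of_scale)
qed

lemma exists_filtered: "\<exists>d. filtered d (x :: ('k::field, 'n::finite) U_gtrig)"
proof (induct x rule: U_gtrig.abs_induct)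
  fix f :: "(('k, 'n) gtrig, 'k) free_algebra"
  have const: "filtered 0 (U_const c :: ('k, 'n) U_gtrig)" for c
    using filtered.monomial[of "[]" 0 c] by (simp add: basis_monomial_Nil)
  show "\<exists>d. filtered d (abs_U_gtrig f)"
  proof (induction f rule: poly_mapping_additive_induct)
    case zero
    have "filtered 0 (abs_U_gtrig 0 :: ('k, 'n) U_gtrig)"
      unfolding zero_U_gtrig_def[symmetric] by (rule filtered.zero)
    then show ?case by blast
  next
    case (single w c)
    have word: "\<exists>d. filtered d (abs_U_gtrig (Poly_Mapping.single (Word xs) 1) :: ('k, 'n) U_gtrig)" for xs
    proof (induction xs)
      case Nil
      have "abs_U_gtrig (Poly_Mapping.single (Word []) 1) = (U_const 1 :: ('k, 'n) U_gtrig)"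
        by (simp add: U_const_def const_def zero_word_monoid_def)
      then show ?case using const[of 1] by auto
    next
      case (Cons x xs)
      then obtain d where d: "filtered d (abs_U_gtrig (Poly_Mapping.single (Word xs) 1) :: ('k, 'n) U_gtrig)" ..
      have "abs_U_gtrig (Poly_Mapping.single (Word (x # xs)) 1)
          = (U_of x * abs_U_gtrig (Poly_Mapping.single (Word xs) 1) :: ('k, 'n) U_gtrig)"
        by (simp add: U_of_def times_U_gtrig.abs_eq gen_def mult_single plus_word_monoid_def)
      then show ?case using filtered_mult[OF filtered_U_of d] by auto
    qed
    then obtain d where d: "filtered d (abs_U_gtrig (Poly_Mapping.single (Word (letters w)) 1) :: ('k, 'n) U_gtrig)" ..
    have "abs_U_gtrig (Poly_Mapping.single w c)
        = (U_const c * abs_U_gtrig (Poly_Mapping.single (Word (letters w)) 1) :: ('k, 'n) U_gtrig)"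
      by (simp add: U_const_def const_def times_U_gtrig.abs_eq mult_single)
    then show ?case using filtered_mult[OF const d] by auto
  next
    case (add f g)
    then obtain d e where "filtered d (abs_U_gtrig f)" "filtered e (abs_U_gtrig g)" by blast
    then have "filtered (max d e) (abs_U_gtrig f)" "filtered (max d e) (abs_U_gtrig g)"
      by (auto elim: filtered_mono)
    then have "filtered (max d e) (abs_U_gtrig (f + g))"
      unfolding plus_U_gtrig.abs_eq[symmetric] by (rule filtered.add)
    then show ?case by blast
  qed
qed

lemma basis_monomial_swap:
  "filtered (Suc (length u + length v)) (basis_monomial (u @ x # y # v) - basis_monomial (u @ y # x # v) :: ('k::field, 'n::finite) U_gtrig)"
proof -
  let ?x = "Poly_Mapping.single x 1" and ?y = "Poly_Mapping.single y 1"
  have "basis_monomial (u @ x # y # v) - basis_monomial (u @ y # x # v)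
      = (basis_monomial u * U_of (gbr ?x ?y) * basis_monomial v :: ('k, 'n) U_gtrig)"
    by (simp add: basis_monomial_append basis_monomial_Cons U_of_br left_diff_distrib right_diff_distrib mult.assoc)
  moreover have "filtered (length u + 1 + length v) (basis_monomial u * U_of (gbr ?x ?y) * basis_monomial v :: ('k, 'n) U_gtrig)"
    by (intro filtered_mult filtered_basis_monomial filtered_U_of) simp_all
  ultimately show ?thesis by simp
qed

lemma basis_monomial_move_front:
  "filtered (length u + length v) (basis_monomial (u @ x # v) - basis_monomial (x # u @ v) :: ('k::field, 'n::finite) U_gtrig)"
proof (induction u arbitrary: v rule: rev_induct)
  case (snoc y u)
  have 1: "filtered (Suc (length u + length v)) (basis_monomial (u @ y # x # v) - basis_monomial (u @ x # y # v) :: ('k, 'n) U_gtrig)"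
    by (rule basis_monomial_swap)
  have 2: "filtered (Suc (length u + length v)) (basis_monomial (u @ x # y # v) - basis_monomial (x # u @ y # v) :: ('k, 'n) U_gtrig)"
    using snoc.IH[of "y # v"] by simp
  show ?case using filtered.add[OF 1 2] by simp
qed (simp add: filtered.zero)

text \<open>
  Interchanging two neighbouring letters costs a commutator, which is one letter shorter. So
  in top degree only the multiset of letters matters.
\<close>

lemma basis_monomial_mset:
  "mset l = mset l' \<Longrightarrow> filtered (length l - 1) (basis_monomial l - basis_monomial l' :: ('k::field, 'n::finite) U_gtrig)"
proof (induction l arbitrary: l')
  case Nil
  then show ?case by (simp add: filtered.zero)
next
  case (Cons x l)
  note IH = Cons.IH
  have "x \<in> set l'" using Cons.prems by (metis list.set_intros(1) set_mset_mset)
  then obtain u v where l': "l' = u @ x # v" by (meson split_list)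
  then have m: "mset l = mset (u @ v)" using Cons.prems by simp
  have len: "length l = length u + length v" using mset_eq_length[OF m] by simp
  have 1: "filtered (length l) (basis_monomial l' - basis_monomial (x # u @ v) :: ('k, 'n) U_gtrig)"
    using basis_monomial_move_front[of u v x] by (simp add: l' len)
  have 2: "filtered (length l) (basis_monomial (x # l) - basis_monomial (x # u @ v) :: ('k, 'n) U_gtrig)"
  proof (cases l)
    case Nil
    then show ?thesis using len by (simp add: filtered.zero)
  next
    case (Cons y ys)
    have "basis_monomial (x # l) - basis_monomial (x # u @ v)
        = (U_of (Poly_Mapping.single x 1) * (basis_monomial l - basis_monomial (u @ v)) :: ('k, 'n) U_gtrig)"
      by (simp add: basis_monomial_Cons right_diff_distrib)
    moreover have "filtered (1 + (length l - 1)) (U_of (Poly_Mapping.single x 1) * (basis_monomial l - basis_monomial (u @ v) :: ('k, 'n) U_gtrig))"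
      by (rule filtered_mult[OF filtered_U_of IH[OF m]])
    ultimately show ?thesis using Cons by simp
  qed
  have "basis_monomial (x # l) - basis_monomial l' = (basis_monomial (x # l) - basis_monomial (x # u @ v))
      - (basis_monomial l' - basis_monomial (x # u @ v) :: ('k, 'n) U_gtrig)" by simp
  then show ?case using filtered_diff[OF 2 1] by simp
qed

section \<open>Joint faithfulness\<close>

definition combination :: "((nat \<times> 'n \<times> 'n) list \<Rightarrow>\<^sub>0 'k) \<Rightarrow> ('k::field, 'n::finite) U_gtrig" where
  "combination c = (\<Sum>l\<in>Poly_Mapping.keys c. U_const (Poly_Mapping.lookup c l) * basis_monomial l)"

lemma combination_superset:
  assumes "finite A" "Poly_Mapping.keys c \<subseteq> A"
  shows "combination c = (\<Sum>l\<in>A. U_const (Poly_Mapping.lookup c l) * basis_monomial l)"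
  unfolding combination_def
  by (rule sum.mono_neutral_left) (use assms in \<open>auto simp: in_keys_iff U_const_0\<close>)

lemma combination_add: "combination (c + d) = combination c + combination d"
proof -
  let ?A = "Poly_Mapping.keys c \<union> Poly_Mapping.keys d"
  show ?thesis
    by (subst (1 2 3) combination_superset[where A = ?A])
       (use Poly_Mapping.keys_add[of c d] in \<open>auto simp: lookup_add U_const_add distrib_right sum.distrib\<close>)
qed

lemma filtered_combination:
  assumes "filtered d x"
  obtains c where "\<And>l. l \<in> Poly_Mapping.keys c \<Longrightarrow> length l \<le> d" "x = combination c"
proof -
  have "\<exists>c. (\<forall>l\<in>Poly_Mapping.keys c. length l \<le> d) \<and> x = combination c"
    using assms
  proof induction
    case zero
    show ?case by (intro exI[of _ 0]) (simp add: combination_def)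
  next
    case (monomial l c)
    have "combination (Poly_Mapping.single l c) = U_const c * basis_monomial l"
      by (subst combination_superset[of "{l}"]) auto
    then show ?case using monomial
      by (intro exI[of _ "Poly_Mapping.single l c"]) (auto split: if_splits)
  next
    case (add x y)
    then obtain c d' where "\<forall>l\<in>Poly_Mapping.keys c. length l \<le> d" "x = combination c"
      "\<forall>l\<in>Poly_Mapping.keys d'. length l \<le> d" "y = combination d'" by blast
    then show ?case
      using Poly_Mapping.keys_add[of c d'] by (intro exI[of _ "c + d'"]) (auto simp: combination_add)
  qed
  then show ?thesis using that by blast
qed

text \<open>
  Truncated subtraction of exponents is harmless here because the case distinction excludes a
  negative exponent.
\<close>

lemma lookup_var_power_mult:
  "Poly_Mapping.lookup (var s ^ e * F) \<gamma>
    = (if e \<le> Poly_Mapping.lookup \<gamma> s then Poly_Mapping.lookup F (\<gamma> - Poly_Mapping.single s e) else 0)"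
proof -
  have var: "var s ^ e = Poly_Mapping.single (Poly_Mapping.single s e) (1 :: 'a)"
  proof (induction e)
    case (Suc e)
    have "Poly_Mapping.single s (Suc 0) + Poly_Mapping.single s e = Poly_Mapping.single s (Suc e)"
      by (simp add: single_add[symmetric])
    then show ?case using Suc by (simp add: var_def mult_single)
  qed simp
  have eq: "Poly_Mapping.single s e + w = \<gamma> \<longleftrightarrow> e \<le> Poly_Mapping.lookup \<gamma> s \<and> w = \<gamma> - Poly_Mapping.single s e"
    for w :: "nat \<Rightarrow>\<^sub>0 nat"
  proof (intro iffI conjI)
    assume *: "Poly_Mapping.single s e + w = \<gamma>"
    show "e \<le> Poly_Mapping.lookup \<gamma> s" unfolding *[symmetric] by (simp add: lookup_add)
    show "w = \<gamma> - Poly_Mapping.single s e" unfolding *[symmetric] by simp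
  next
    assume "e \<le> Poly_Mapping.lookup \<gamma> s \<and> w = \<gamma> - Poly_Mapping.single s e"
    then show "Poly_Mapping.single s e + w = \<gamma>"
      by (intro poly_mapping_eqI) (auto simp: lookup_add lookup_minus lookup_single when_def)
  qed
  show ?thesis unfolding var
  proof (induction F rule: poly_mapping_additive_induct)
    case (single w c)
    show ?case by (auto simp: mult_single lookup_single when_def eq)
  qed (simp_all add: distrib_left lookup_add)
qed

lemma rep_basis_monomial: "rep n (basis_monomial l) = prod_list (map (rep_basis n) l)"
  unfolding basis_monomial_def rep_prod_list map_map
  by (simp add: comp_def rep_U_of rep_gtrig_def extend_single weighted_1)

lemma app_rep_basis_mult:
  "app (rep_basis n (a, i, j) * R) f x
    = (\<Sum>s<n. var s ^ Suc a * (if x s = i then app R f (x(s := j)) else 0))"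
  by (simp add: rep_basis_def app_sum app_munit del: power_Suc)

text \<open>
  The basis tensor with the column indices of the letters \<open>b s\<close> in the slots \<open>s < D\<close>. A
  product of letters is tested by its matrix coefficients at this tensor.
\<close>

definition target :: "nat \<Rightarrow> (nat \<Rightarrow> nat \<times> 'n \<times> 'n) \<Rightarrow> (nat \<Rightarrow> 'n) \<Rightarrow> 'k::field pol" where
  "target D b x = (if \<forall>s<D. x s = snd (snd (b s)) then 1 else 0)"

text \<open>
  Reading a product of letters from the left, every letter changes the configuration and the
  exponents in one slot. A slot is unfinished as long as its entry differs from the target or
  its exponent is not \<open>0\<close>; fewer letters than unfinished slots cannot finish them all.
\<close>

lemma lookup_rep_eq_0:
  assumes "length l < card {s. s < D \<and> (x s \<noteq> snd (snd (b s)) \<or> Poly_Mapping.lookup \<gamma> s \<noteq> 0)}"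
  shows "Poly_Mapping.lookup (app (prod_list (map (rep_basis D) l)) (target D b) x) \<gamma> = (0 :: 'k::field)"
  using assms
proof (induction l arbitrary: x \<gamma>)
  case Nil
  then have "{s. s < D \<and> (x s \<noteq> snd (snd (b s)) \<or> Poly_Mapping.lookup \<gamma> s \<noteq> 0)} \<noteq> {}"
    by (metis card.empty less_irrefl list.size(3))
  then obtain s where "s < D" "x s \<noteq> snd (snd (b s)) \<or> Poly_Mapping.lookup \<gamma> s \<noteq> 0" by blast
  then show ?case by (auto simp: target_def lookup_one when_def)
next
  case (Cons y l)
  obtain a i j where y: "y = (a, i, j)" by (cases y)
  let ?U = "\<lambda>x \<gamma>. {s. s < D \<and> (x s \<noteq> snd (snd (b s)) \<or> Poly_Mapping.lookup \<gamma> s \<noteq> 0)}"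
  have "Poly_Mapping.lookup (app (prod_list (map (rep_basis D) l)) (target D b) (x(s := j)))
      (\<gamma> - Poly_Mapping.single s (Suc a)) = (0 :: 'k)" for s
  proof (rule Cons.IH)
    have fin: "finite (?U x' \<gamma>')" for x' \<gamma>' by simp
    have "?U x \<gamma> - {s} \<subseteq> ?U (x(s := j)) (\<gamma> - Poly_Mapping.single s (Suc a))"
      by (auto simp: lookup_minus lookup_single when_def)
    then have "card (?U x \<gamma> - {s}) \<le> card (?U (x(s := j)) (\<gamma> - Poly_Mapping.single s (Suc a)))"
      using fin by (rule card_mono[rotated])
    moreover have "card (?U x \<gamma>) - 1 \<le> card (?U x \<gamma> - {s})"
      by (simp add: card_Diff_singleton_if)
    ultimately show "length l < card (?U (x(s := j)) (\<gamma> - Poly_Mapping.single s (Suc a)))"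
      using Cons.prems by simp
  qed
  then have "Poly_Mapping.lookup (var s ^ Suc a * (if x s = i
      then app (prod_list (map (rep_basis D) l)) (target D b) (x(s := j)) else 0)) \<gamma> = (0 :: 'k)" for s
    by (cases "x s = i") (simp_all add: lookup_var_power_mult del: power_Suc)
  then show ?case
    by (simp only: list.map prod_list.Cons y app_rep_basis_mult lookup_sum sum.neutral_const)
qed

text \<open>
  The number of bijections from the positions of the word to \<open>T\<close> under which letters agree
  with \<open>b\<close>, when the length of the word is the cardinality of \<open>T\<close>.
\<close>

fun matchings :: "(nat \<Rightarrow> 'b) \<Rightarrow> 'b list \<Rightarrow> nat set \<Rightarrow> nat" where
  "matchings b [] T = 1"
| "matchings b (y # l) T = (\<Sum>s\<in>{s\<in>T. b s = y}. matchings b l (T - {s}))"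

text \<open>
  With as many letters as slots, every slot of \<open>T\<close> has to be finished by a single letter,
  since all exponents in \<open>T\<close> are positive. A letter that does not finish its slot leaves more
  slots than letters.
\<close>

lemma lookup_rep_matchings:
  fixes b :: "nat \<Rightarrow> nat \<times> 'n \<times> 'n"
  assumes "T \<subseteq> {..<D}" "length l = card T"
  shows "Poly_Mapping.lookup (app (prod_list (map (rep_basis D) l)) (target D b)
        (\<lambda>s. if s \<in> T then fst (snd (b s)) else snd (snd (b s))))
      (\<Sum>s\<in>T. Poly_Mapping.single s (Suc (fst (b s))))
    = (of_nat (matchings b l T) :: 'k::field)"
  using assms
proof (induction l arbitrary: T)
  case Nil
  then have "T = {}" using finite_subset[of T "{..<D}"] by auto
  then show ?case by (simp add: target_def)
next
  case (Cons y l)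
  obtain a i j where y: "y = (a, i, j)" by (cases y)
  define x where "x T s = (if s \<in> T then fst (snd (b s)) else snd (snd (b s)))" for T s
  define \<gamma> where "\<gamma> T = (\<Sum>s\<in>T. Poly_Mapping.single s (Suc (fst (b s))))" for T
  have fin: "finite T" using Cons.prems(1) finite_subset by blast
  have lg: "Poly_Mapping.lookup (\<gamma> T') s = (if s \<in> T' then Suc (fst (b s)) else 0)" if "finite T'" for T' s
    using that by (simp add: \<gamma>_def lookup_sum lookup_single when_def sum.delta)
  let ?R = "prod_list (map (rep_basis D) l) :: (nat \<Rightarrow> 'n, 'k pol) lop"
  have summand: "Poly_Mapping.lookup (var s ^ Suc a * (if x T s = i then app ?R (target D b) ((x T)(s := j)) else 0)) (\<gamma> T)
      = (if s \<in> T \<and> b s = y then of_nat (matchings b l (T - {s})) else (0 :: 'k))" if "s < D" for s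
  proof (cases "s \<in> T \<and> x T s = i \<and> a \<le> fst (b s)")
    case False
    then have "\<not> (s \<in> T \<and> b s = y)" by (auto simp: x_def y)
    moreover have "s \<notin> T \<or> x T s \<noteq> i \<or> \<not> a \<le> fst (b s)" using False by auto
    ultimately show ?thesis
      by (auto simp: lookup_var_power_mult lg[OF fin] simp del: power_Suc)
  next
    case s: True
    then have eq: "Poly_Mapping.lookup (var s ^ Suc a * (if x T s = i then app ?R (target D b) ((x T)(s := j)) else 0)) (\<gamma> T)
      = Poly_Mapping.lookup (app ?R (target D b) ((x T)(s := j))) (\<gamma> T - Poly_Mapping.single s (Suc a))"
      by (simp add: lookup_var_power_mult lg[OF fin] del: power_Suc)
    have ci: "fst (snd (b s)) = i" using s by (auto simp: x_def split: if_splits)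
    show ?thesis
    proof (cases "b s = y")
      case True
      have "(x T)(s := j) = x (T - {s})"
        using True y by (auto simp: x_def fun_eq_iff)
      moreover have "\<gamma> T - Poly_Mapping.single s (Suc a) = \<gamma> (T - {s})"
        using True y s fin by (intro poly_mapping_eqI) (auto simp: lookup_minus lg lookup_single when_def)
      moreover have "length l = card (T - {s})" using Cons.prems(2) s fin by simp
      moreover have "T - {s} \<subseteq> {..<D}" using Cons.prems(1) by auto
      ultimately show ?thesis
        unfolding eq using Cons.IH[of "T - {s}"] True s by (simp add: x_def[abs_def] \<gamma>_def)
    next
      case False
      then have ne: "j \<noteq> snd (snd (b s)) \<or> a < fst (b s)"
        using ci s by (cases "b s") (auto simp: y)
      \<comment> \<open>A wrong letter leaves all slots of \<open>T\<close> unfinished.\<close>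
      have "T \<subseteq> {r. r < D \<and> (((x T)(s := j)) r \<noteq> snd (snd (b r))
          \<or> Poly_Mapping.lookup (\<gamma> T - Poly_Mapping.single s (Suc a)) r \<noteq> 0)}"
      proof
        fix r assume "r \<in> T"
        then show "r \<in> {r. r < D \<and> (((x T)(s := j)) r \<noteq> snd (snd (b r))
          \<or> Poly_Mapping.lookup (\<gamma> T - Poly_Mapping.single s (Suc a)) r \<noteq> 0)}"
          using Cons.prems(1) ne s by (cases "r = s") (auto simp: lookup_minus lg[OF fin] lookup_single when_def)
      qed
      then have "card T \<le> card {r. r < D \<and> (((x T)(s := j)) r \<noteq> snd (snd (b r))
          \<or> Poly_Mapping.lookup (\<gamma> T - Poly_Mapping.single s (Suc a)) r \<noteq> 0)}"
        by (intro card_mono) auto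
      then have "length l < card {r. r < D \<and> (((x T)(s := j)) r \<noteq> snd (snd (b r))
          \<or> Poly_Mapping.lookup (\<gamma> T - Poly_Mapping.single s (Suc a)) r \<noteq> 0)}"
        using Cons.prems(2) by simp
      then show ?thesis unfolding eq using False by (simp only: lookup_rep_eq_0) simp
    qed
  qed
  have "Poly_Mapping.lookup (app (prod_list (map (rep_basis D) (y # l))) (target D b) (x T)) (\<gamma> T)
      = (\<Sum>s<D. Poly_Mapping.lookup (var s ^ Suc a * (if x T s = i then app ?R (target D b) ((x T)(s := j)) else 0)) (\<gamma> T))"
    by (simp add: y app_rep_basis_mult lookup_sum del: power_Suc app_simps)
  also have "\<dots> = (\<Sum>s<D. if s \<in> T \<and> b s = y then of_nat (matchings b l (T - {s})) else 0)"
    by (intro sum.cong refl summand) simp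
  also have "\<dots> = (\<Sum>s\<in>{s\<in>{..<D}. s \<in> T \<and> b s = y}. of_nat (matchings b l (T - {s})))"
    by (rule sum.inter_filter[symmetric]) simp
  also have "{s\<in>{..<D}. s \<in> T \<and> b s = y} = {s\<in>T. b s = y}" using Cons.prems(1) by auto
  finally show ?case by (simp add: x_def[abs_def] \<gamma>_def)
qed

text \<open>
  The number of permutations that fix a word with this multiset of letters.
\<close>

definition symmetry_factor :: "'b multiset \<Rightarrow> nat" where
  "symmetry_factor M = (\<Prod>y\<in>set_mset M. fact (count M y))"

lemma symmetry_factor_add: "symmetry_factor (add_mset y M) = Suc (count M y) * symmetry_factor M"
proof (cases "y \<in># M")
  case True
  have "symmetry_factor (add_mset y M) = fact (Suc (count M y)) * (\<Prod>z\<in>set_mset M - {y}. fact (count (add_mset y M) z))"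
    unfolding symmetry_factor_def using True by (simp add: insert_absorb prod.remove)
  also have "(\<Prod>z\<in>set_mset M - {y}. fact (count (add_mset y M) z)) = (\<Prod>z\<in>set_mset M - {y}. fact (count M z) :: nat)"
    by (rule prod.cong) auto
  also have "fact (Suc (count M y)) * \<dots> = Suc (count M y) * (\<Prod>z\<in>set_mset M. fact (count M z))"
    using True by (simp add: prod.remove[of "set_mset M" y] algebra_simps)
  finally show ?thesis by (simp add: symmetry_factor_def)
next
  case False
  have "(\<Prod>z\<in>set_mset M. fact (count (add_mset y M) z)) = (\<Prod>z\<in>set_mset M. fact (count M z) :: nat)"
    by (rule prod.cong) (use False in auto)
  then show ?thesis
    using False by (simp add: symmetry_factor_def not_in_iff)
qed

lemma symmetry_factor_pos: "symmetry_factor M > 0"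
  by (simp add: symmetry_factor_def prod_pos)

lemma matchings_eq:
  assumes "finite T" "length l = card T"
  shows "matchings b l T = (if mset l = image_mset b (mset_set T) then symmetry_factor (mset l) else 0)"
  using assms
proof (induction l arbitrary: T)
  case Nil
  then show ?case by (simp add: symmetry_factor_def)
next
  case (Cons y l)
  let ?M = "image_mset b (mset_set T)"
  let ?S = "{s\<in>T. b s = y}"
  have M: "?M = add_mset y (image_mset b (mset_set (T - {s})))" if "s \<in> ?S" for s
    using that Cons.prems(1) by (auto simp: mset_set.remove)
  have "matchings b (y # l) T = (\<Sum>s\<in>?S. if mset (y # l) = ?M then symmetry_factor (mset l) else 0)"
    unfolding matchings.simps
  proof (rule sum.cong[OF refl])
    fix s assume s: "s \<in> ?S"
    have "length l = card (T - {s})" using Cons.prems s by simp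
    then have "matchings b l (T - {s}) = (if mset l = image_mset b (mset_set (T - {s})) then symmetry_factor (mset l) else 0)"
      using Cons.IH Cons.prems(1) by simp
    then show "matchings b l (T - {s}) = (if mset (y # l) = ?M then symmetry_factor (mset l) else 0)"
      unfolding M[OF s] by simp
  qed
  also have "\<dots> = card ?S * (if mset (y # l) = ?M then symmetry_factor (mset l) else 0)" by simp
  also have "\<dots> = (if mset (y # l) = ?M then symmetry_factor (mset (y # l)) else 0)"
  proof (cases "mset (y # l) = ?M")
    case True
    have "card ?S = count ?M y"
      using Cons.prems(1) by (simp add: count_image_mset vimage_def Int_def conj_commute)
    then have "card ?S = Suc (count (mset l) y)" unfolding True[symmetric] by simp
    then have "card ?S * symmetry_factor (mset l) = symmetry_factor (mset (y # l))"
      by (simp only: mset.simps symmetry_factor_add)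
    then show ?thesis by (simp only: if_P[OF True])
  qed simp
  finally show ?case .
qed

text \<open>
  On \<open>Suc d\<close> slots, the matrix coefficient that belongs to a word \<open>l0\<close> of that length kills
  all shorter words. On words of full length it gives the symmetry factor if the letters are
  those of \<open>l0\<close>, and \<open>0\<close> otherwise. So for each multiset of letters the coefficients of \<open>x\<close>
  sum to \<open>0\<close>, and then its words contribute only differences of rearranged words, which have
  lower degree.
\<close>

lemma filtered_kernel_step:
  fixes x :: "('k::field_char_0, 'n::finite) U_gtrig"
  assumes x: "filtered (Suc d) x" and kernel: "rep (Suc d) x = 0"
  shows "filtered d x"
proof -
  let ?D = "Suc d"
  obtain c where c: "\<And>l. l \<in> Poly_Mapping.keys c \<Longrightarrow> length l \<le> ?D" "x = combination c"
    using filtered_combination[OF x] by blast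
  let ?K = "Poly_Mapping.keys c"
  let ?lk = "Poly_Mapping.lookup c"
  define top where "top = {l\<in>?K. length l = ?D}"
  have fin: "finite ?K" "finite top" by (simp_all add: top_def)
  have coeff: "(\<Sum>l\<in>{l\<in>top. mset l = mset l0}. ?lk l) = 0" if "length l0 = ?D" for l0
  proof -
    define b where "b s = l0 ! s" for s
    let ?x = "\<lambda>s. if s \<in> {..<?D} then fst (snd (b s)) else snd (snd (b s))"
    let ?\<gamma> = "\<Sum>s\<in>{..<?D}. Poly_Mapping.single s (Suc (fst (b s)))"
    have M: "image_mset b (mset_set {..<?D}) = mset l0"
    proof -
      have "map b [0..<?D] = l0" using map_nth[of l0] by (simp only: that b_def[abs_def])
      then have "mset l0 = image_mset b (mset [0..<?D])" by (metis mset_map)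
      then show ?thesis by (simp add: mset_upt atLeast0LessThan del: upt_Suc)
    qed
    have val: "Poly_Mapping.lookup (app (rep ?D (basis_monomial l)) (target ?D b) ?x) ?\<gamma>
        = (if mset l = mset l0 then of_nat (symmetry_factor (mset l0)) else (0 :: 'k))" if "l \<in> ?K" for l
    proof (cases "length l = ?D")
      case True
      then show ?thesis
        unfolding rep_basis_monomial
        by (subst lookup_rep_matchings) (auto simp: matchings_eq M)
    next
      case False
      then have "length l < ?D" using c(1)[OF that] by simp
      moreover have "mset l \<noteq> mset l0" using False \<open>length l0 = ?D\<close> mset_eq_length by metis
      moreover have "{s. s < ?D \<and> (?x s \<noteq> snd (snd (b s)) \<or> Poly_Mapping.lookup ?\<gamma> s \<noteq> 0)} = {..<?D}"
        by (auto simp: lookup_sum lookup_single when_def sum.delta simp del: sum.lessThan_Suc)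
      then have "card {s. s < ?D \<and> (?x s \<noteq> snd (snd (b s)) \<or> Poly_Mapping.lookup ?\<gamma> s \<noteq> 0)} = ?D"
        by (simp only: card_lessThan)
      ultimately show ?thesis
        unfolding rep_basis_monomial by (subst lookup_rep_eq_0) (simp_all only: if_False)
    qed
    have lw: "Poly_Mapping.lookup (cst z * F) m = z * Poly_Mapping.lookup F m" for z :: 'k and F m
    proof (induction F rule: poly_mapping_additive_induct)
      case (single w e)
      show ?case by (simp add: cst_def mult_single lookup_single when_def)
    qed (simp_all add: distrib_left lookup_add)
    have "0 = Poly_Mapping.lookup (app (rep ?D x) (target ?D b) ?x) ?\<gamma>"
      using kernel by simp
    also have "\<dots> = (\<Sum>l\<in>?K. ?lk l * Poly_Mapping.lookup (app (rep ?D (basis_monomial l)) (target ?D b) ?x) ?\<gamma>)"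
      unfolding c(2) combination_def rep_sum rep_mult rep_U_const app_sum lookup_sum
      by (simp only: app_simps app_scalar lw)
    also have "\<dots> = (\<Sum>l\<in>?K. if mset l = mset l0 then ?lk l * of_nat (symmetry_factor (mset l0)) else 0)"
      by (intro sum.cong refl) (simp only: val, simp)
    also have "\<dots> = (\<Sum>l\<in>{l\<in>?K. mset l = mset l0}. ?lk l * of_nat (symmetry_factor (mset l0)))"
      by (rule sum.inter_filter[symmetric]) (rule fin)
    also have "{l\<in>?K. mset l = mset l0} = {l\<in>top. mset l = mset l0}"
    proof -
      have "length l = ?D" if "mset l = mset l0" for l using that \<open>length l0 = ?D\<close> mset_eq_length by metis
      then show ?thesis by (auto simp: top_def)
    qed
    also have "(\<Sum>l\<in>{l\<in>top. mset l = mset l0}. ?lk l * of_nat (symmetry_factor (mset l0)))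
        = (\<Sum>l\<in>{l\<in>top. mset l = mset l0}. ?lk l) * of_nat (symmetry_factor (mset l0))"
      by (simp only: sum_distrib_right)
    finally have "(\<Sum>l\<in>{l\<in>top. mset l = mset l0}. ?lk l) * of_nat (symmetry_factor (mset l0)) = 0" by (rule sym)
    then show ?thesis using symmetry_factor_pos[of "mset l0"] by simp
  qed
  let ?m = "\<lambda>l. U_const (?lk l) * basis_monomial l :: ('k, 'n) U_gtrig"
  have split: "x = (\<Sum>l\<in>?K - top. ?m l) + (\<Sum>l\<in>top. ?m l)"
    unfolding c(2) combination_def by (rule sum.subset_diff) (auto simp: top_def)
  have "filtered d (\<Sum>l\<in>?K - top. ?m l)"
  proof (intro filtered_sum filtered.monomial)
    fix l assume "l \<in> ?K - top"
    then show "length l \<le> d" using c(1)[of l] by (auto simp: top_def le_Suc_eq)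
  qed
  moreover have "filtered d (\<Sum>l\<in>top. ?m l)"
  proof -
    have "(\<Sum>l\<in>top. ?m l) = (\<Sum>M\<in>mset ` top. \<Sum>l\<in>{l\<in>top. mset l = M}. ?m l)"
      by (rule sum.group[symmetric]) (use fin in auto)
    moreover have "filtered d (\<Sum>l\<in>{l\<in>top. mset l = M}. ?m l)" if M: "M \<in> mset ` top" for M
    proof -
      obtain l0 where l0: "l0 \<in> top" "M = mset l0" using M by blast
      then have len: "length l0 = ?D" by (simp add: top_def)
      have "(\<Sum>l\<in>{l\<in>top. mset l = M}. ?m l)
          = (\<Sum>l\<in>{l\<in>top. mset l = M}. U_const (?lk l) * (basis_monomial l - basis_monomial l0))
            + (\<Sum>l\<in>{l\<in>top. mset l = M}. U_const (?lk l)) * basis_monomial l0"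
        by (simp only: sum_distrib_right sum.distrib[symmetric]) (simp add: right_diff_distrib)
      also have "(\<Sum>l\<in>{l\<in>top. mset l = M}. U_const (?lk l)) = (0 :: ('k, 'n) U_gtrig)"
        unfolding U_const_sum[symmetric] l0(2) coeff[OF len] by (rule U_const_0)
      finally have eq: "(\<Sum>l\<in>{l\<in>top. mset l = M}. ?m l)
          = (\<Sum>l\<in>{l\<in>top. mset l = M}. U_const (?lk l) * (basis_monomial l - basis_monomial l0))" by simp
      show ?thesis unfolding eq
      proof (rule filtered_sum)
        fix l assume l: "l \<in> {l\<in>top. mset l = M}"
        then have "mset l = mset l0" "length l - 1 = d" using l0 by (auto simp: top_def)
        then have "filtered d (basis_monomial l - basis_monomial l0 :: ('k, 'n) U_gtrig)"
          using basis_monomial_mset[of l l0] by metis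
        moreover have "filtered 0 (U_const (?lk l) :: ('k, 'n) U_gtrig)"
          using filtered.monomial[of "[]" 0 "?lk l"] by (simp add: basis_monomial_Nil)
        ultimately show "filtered d (U_const (?lk l) * (basis_monomial l - basis_monomial l0) :: ('k, 'n) U_gtrig)"
          using filtered_mult[of 0 "U_const (?lk l)" d] by (metis add_0)
      qed
    qed
    ultimately show ?thesis by (metis (mono_tags, lifting) filtered_sum)
  qed
  ultimately show ?thesis unfolding split by (rule filtered.add)
qed

theorem rep_jointly_faithful:
  fixes x :: "('k::field_char_0, 'n::finite) U_gtrig"
  assumes "\<And>n. rep n x = 0"
  shows "x = 0"
proof -
  have "filtered d x \<Longrightarrow> x = 0" for d
  proof (induction d)
    case 0
    then obtain c where c: "\<And>l. l \<in> Poly_Mapping.keys c \<Longrightarrow> length l \<le> 0" "x = combination c"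
      using filtered_combination by blast
    then have "Poly_Mapping.keys c \<subseteq> {[]}" by fastforce
    then have x: "x = U_const (Poly_Mapping.lookup c [])"
      unfolding c(2) by (subst combination_superset[of "{[]}"]) (auto simp: basis_monomial_Nil)
    have "app (scalar (cst (Poly_Mapping.lookup c [])) :: (nat \<Rightarrow> 'n, 'k pol) lop) (\<lambda>_. 1) (\<lambda>_. undefined) = 0"
      using assms[of 0] unfolding x rep_U_const by simp
    then have "Poly_Mapping.lookup (cst (Poly_Mapping.lookup c [])) 0 = 0" by simp
    then show ?case by (simp add: x cst_def U_const_0)
  next
    case (Suc d)
    then show ?case using filtered_kernel_step assms by blast
  qed
  then show ?thesis using exists_filtered by blast
qed

section \<open>The elements \<open>QH\<^sub>k\<close> in the representations\<close>

definition rep_fps :: "nat \<Rightarrow> ('k::field, 'n::finite) U_gtrig fps \<Rightarrow> (nat \<Rightarrow> 'n, 'k pol) lop fps" where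
  "rep_fps n F = Abs_fps (\<lambda>a. rep n (fps_nth F a))"

lemma rep_fps_nth: "fps_nth (rep_fps n F) a = rep n (fps_nth F a)"
  by (simp add: rep_fps_def)

lemma rep_of_nat: "rep n (of_nat j) = of_nat j"
  by (induction j) (simp_all add: rep_0 rep_1 rep_add)

lemma rep_uminus: "rep n (- x) = - rep n x"
  using rep_diff[of n 0 x] by (simp add: rep_0)

lemma rep_of_int: "rep n (of_int z) = of_int z"
  by (cases z) (simp_all add: rep_of_nat rep_uminus rep_diff rep_1)

lemma rep_fps_0: "rep_fps n 0 = 0" and rep_fps_1: "rep_fps n 1 = 1"
  by (rule fps_ext; simp add: rep_fps_nth rep_0 rep_1)+

lemma rep_fps_sum: "rep_fps n (sum F A) = (\<Sum>a\<in>A. rep_fps n (F a))"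
  by (rule fps_ext) (simp add: rep_fps_nth fps_sum_nth rep_sum)

lemma rep_fps_mult: "rep_fps n (F * G) = rep_fps n F * rep_fps n G"
  by (rule fps_ext) (simp add: rep_fps_nth fps_mult_nth rep_sum rep_mult)

lemma rep_fps_of_int: "rep_fps n (of_int z) = of_int z"
  by (rule fps_ext) (simp add: rep_fps_nth fps_of_int[symmetric] rep_of_int rep_0)

lemma rep_fps_LD: "rep_fps n (LD i j F) = lax_op n var i j (rep_fps n F)"
proof -
  have lax: "rep_fps n (Lser i j) = lax n var i j"
  proof (rule fps_ext)
    fix a
    show "fps_nth (rep_fps n (Lser i j)) a = fps_nth (lax n var i j) a"
    proof (cases "a = 0")
      case True
      then show ?thesis
        by (simp add: rep_fps_nth Lser_def lax_def Lt_def rep_U_of rep_gtrig_def extend_0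
            fps_sum_nth scalars_nth geom_nth)
    next
      case False
      then show ?thesis
        by (simp add: rep_fps_nth Lser_def lax_def rep_U_of rep_gtrig_Lt fps_sum_nth scalars_nth geom_nth)
    qed
  qed
  have "rep_fps n (LD i j F) = rep_fps n (Lser i j * F) + (if i = j then euler (rep_fps n F) else 0)"
    by (rule fps_ext)
      (simp add: LD_def rep_fps_nth u_deriv_def euler_nth rep_diff rep_mult rep_uminus rep_of_nat rep_0)
  then show ?thesis unfolding rep_fps_mult lax lax_op_def .
qed

lemma LD_0: "LD i j 0 = 0"
  by (rule fps_ext) (simp add: LD_def u_deriv_def)

lemma finite_multi_idx: "finite (multi_idx m :: 'n::finite list set)"
  using finite_lists_length_eq[of "UNIV :: 'n set" m] by (simp add: multi_idx_def)

text \<open>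
  Leg \<open>p\<close> only changes the index in position \<open>p\<close>, so a single chain of intermediate indices
  contributes to the matrix product.
\<close>

lemma LD_prod_entry:
  fixes K I :: "'n::finite list"
  assumes "r \<le> k" "k \<le> m" "K \<in> multi_idx m" "I \<in> multi_idx m"
  shows "foldr (\<lambda>p. op_mult m (op_leg m p LD)) [r..<k] op_id K I f
    = (if \<forall>p<m. p \<notin> {r..<k} \<longrightarrow> K ! p = I ! p
       then foldr (\<lambda>p. LD (K ! p) (I ! p)) [r..<k] (f :: ('k::field, 'n) U_gtrig fps) else 0)"
  using assms(1,3)
proof (induction r arbitrary: K rule: inc_induct)
  case base
  have "K = I \<longleftrightarrow> (\<forall>p<m. K ! p = I ! p)"
    using base assms(4) by (auto simp: multi_idx_def list_eq_iff_nth_eq)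
  then show ?case by (cases "K = I") (auto simp: op_id_def)
next
  case (step r)
  let ?B = "foldr (\<lambda>p. op_mult m (op_leg m p LD)) [Suc r..<k] op_id :: (('k, 'n) U_gtrig, 'n) op_matrix"
  let ?J = "K[r := I ! r]"
  have r: "r < m" using step.hyps assms(2) by simp
  have K: "length K = m" and I: "length I = m" using step.prems assms(4) by (auto simp: multi_idx_def)
  have J: "?J \<in> multi_idx m" using K by (simp add: multi_idx_def)
  have other: "op_leg m r LD K J (?B J I f) = 0" if "J \<in> multi_idx m - {?J}" for J
  proof (rule ccontr)
    assume nz: "op_leg m r LD K J (?B J I f) \<noteq> 0"
    then have 1: "\<forall>p<m. p \<noteq> r \<longrightarrow> K ! p = J ! p"
      by (auto simp: op_leg_def split: if_splits)
    have "op_leg m r LD K J (0 :: ('k, 'n) U_gtrig fps) = 0" by (simp add: op_leg_def LD_0)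
    then have "?B J I f \<noteq> 0" using nz by (intro notI) (simp only: simp_thms)
    then have "\<forall>p<m. p \<notin> {Suc r..<k} \<longrightarrow> J ! p = I ! p"
      using step.IH[of J] that by (auto split: if_splits)
    then have "J ! r = I ! r" using r by auto
    then have "J ! i = ?J ! i" if "i < m" for i
      using 1 that K r by (cases "i = r") auto
    moreover have "length J = m" using that by (simp add: multi_idx_def)
    ultimately have "J = ?J" using K by (intro nth_equalityI) simp_all
    then show False using that by simp
  qed
  have upt: "[r..<k] = r # [Suc r..<k]" using step.hyps by (simp add: upt_conv_Cons)
  then have "foldr (\<lambda>p. op_mult m (op_leg m p LD)) [r..<k] op_id K I f
      = (\<Sum>J\<in>multi_idx m. op_leg m r LD K J (?B J I f))"
    by (simp add: op_mult_def)
  also have "\<dots> = op_leg m r LD K ?J (?B ?J I f)"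
    using J other by (subst sum.remove[OF finite_multi_idx J]) (simp add: sum.neutral)
  also have "\<dots> = LD (K ! r) (I ! r) (?B ?J I f)"
    using r K by (simp add: op_leg_def)
  also have "?B ?J I f = (if \<forall>p<m. p \<notin> {Suc r..<k} \<longrightarrow> ?J ! p = I ! p
       then foldr (\<lambda>p. LD (?J ! p) (I ! p)) [Suc r..<k] f else 0)"
    by (rule step.IH[OF J])
  also have "foldr (\<lambda>p. LD (?J ! p) (I ! p)) [Suc r..<k] f = foldr (\<lambda>p. LD (K ! p) (I ! p)) [Suc r..<k] f"
    by (intro foldr_cong) auto
  also have "(\<forall>p<m. p \<notin> {Suc r..<k} \<longrightarrow> ?J ! p = I ! p) \<longleftrightarrow> (\<forall>p<m. p \<notin> {r..<k} \<longrightarrow> K ! p = I ! p)"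
    using r K step.hyps by (auto simp: nth_list_update)
  also have "LD (K ! r) (I ! r) (if \<forall>p<m. p \<notin> {r..<k} \<longrightarrow> K ! p = I ! p
      then foldr (\<lambda>p. LD (K ! p) (I ! p)) [Suc r..<k] f else 0)
    = (if \<forall>p<m. p \<notin> {r..<k} \<longrightarrow> K ! p = I ! p
      then foldr (\<lambda>p. LD (K ! p) (I ! p)) [r..<k] f else 0)"
    unfolding upt by (simp only: if_distrib[of "LD (K ! r) (I ! r)"] LD_0 foldr.simps comp_apply)
  finally show ?case .
qed

lemma sum_multi_idx:
  "(\<Sum>I\<in>multi_idx m. g I) = (\<Sum>J\<in>{..<m} \<rightarrow>\<^sub>E UNIV. g (map J [0..<m]))"
  by (rule sum.reindex_bij_witness[where i = "\<lambda>J. map J [0..<m]" and j = "\<lambda>I. restrict (nth I) {..<m}"])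
    (auto simp: multi_idx_def fun_eq_iff PiE_def extensional_def intro!: nth_equalityI arg_cong[where f = g])

lemma U_const_of_int: "U_const (of_int z) = of_int z"
proof -
  have nat: "U_const (of_nat j) = of_nat j" for j
    by (induction j) (simp_all add: U_const_0 U_const_1 U_const_add)
  have neg: "U_const (- c) = - U_const c" for c
    using U_const_add[of "- c" c] by (simp add: U_const_0 eq_neg_iff_add_eq_0)
  show ?thesis
  proof (cases z)
    case (neg j)
    then have "of_int z = - (of_nat (Suc j) :: 'a)" by simp
    then show ?thesis using nat[of "Suc j"] neg by (metis \<open>\<And>c. U_const (- c) = - U_const c\<close> of_int_minus of_int_of_nat_eq)
  qed (simp add: nat)
qed

lemma QH_eq:
  fixes m k :: nat
  assumes "k \<le> m"
  shows "(QH m k :: ('k::field_char_0, 'n::finite) U_gtrig fps) = fps_const (U_const (1 / fact m)) *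
    signed_trace {..<m} (\<lambda>K I. if \<forall>p\<in>{k..<m}. K p = I p
      then foldr (\<lambda>p. LD (K p) (I p)) [0..<k] 1 else 0)"
proof -
  let ?P = "{\<sigma>. \<sigma> permutes {..<m}}"
  define X where "X K I = (if \<forall>p\<in>{k..<m}. K p = I p
      then foldr (\<lambda>p. LD (K p) (I p)) [0..<k] (1 :: ('k, 'n) U_gtrig fps) else 0)" for K I
  have Xcong: "X K I = X K' I'" if "\<And>p. p < m \<Longrightarrow> K p = K' p" "\<And>p. p < m \<Longrightarrow> I p = I' p" for K I K' I'
  proof -
    have "foldr (\<lambda>p. LD (K p) (I p)) [0..<k] (1 :: ('k, 'n) U_gtrig fps)
        = foldr (\<lambda>p. LD (K' p) (I' p)) [0..<k] 1"
      using that assms by (intro foldr_cong) auto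
    moreover have "(\<forall>p\<in>{k..<m}. K p = I p) \<longleftrightarrow> (\<forall>p\<in>{k..<m}. K' p = I' p)"
      using that by (intro ball_cong) auto
    ultimately show ?thesis by (simp add: X_def)
  qed
  have entry: "LD_prod m k K I 1 = X (nth K) (nth I)" if "K \<in> multi_idx m" "I \<in> multi_idx m" for K I
  proof -
    have "(\<forall>p<m. p \<notin> {0..<k} \<longrightarrow> K ! p = I ! p) \<longleftrightarrow> (\<forall>p\<in>{k..<m}. K ! p = I ! p)" by auto
    then show ?thesis
      unfolding LD_prod_def LD_prod_entry[OF le0 assms that] X_def by simp
  qed
  have skew: "fps_const (U_const (skew_entry m I K)) = fps_const (U_const (1 / fact m)) *
      (\<Sum>\<sigma>\<in>?P. (if \<forall>r<m. I ! \<sigma> r = K ! r then of_int (sign \<sigma>) else 0) :: ('k, 'n) U_gtrig fps)" for I K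
  proof -
    have "U_const (skew_entry m I K) = U_const (1 / fact m) *
      (\<Sum>\<sigma>\<in>?P. (if \<forall>r<m. I ! \<sigma> r = K ! r then of_int (sign \<sigma>) else 0) :: ('k, 'n) U_gtrig)"
      unfolding skew_entry_def U_const_mult U_const_sum perm_entry_def U_const_of_int
      by (intro arg_cong2[where f = "(*)"] sum.cong refl)
        (simp_all only: U_const_0 U_const_1 mult_1_right mult_zero_right if_distrib[of U_const] if_distrib[of "(*) _"])
    then show ?thesis
      by (simp add: fps_const_mult[symmetric] fps_const_sum fps_const_of_int if_distrib[of fps_const] del: fps_const_mult cong: if_cong)
  qed
  have inner: "(\<Sum>K\<in>multi_idx m. (if \<forall>r<m. I ! \<sigma> r = K ! r then of_int (sign \<sigma>) else 0) * X (nth K) (nth I))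
      = of_int (sign \<sigma>) * X (nth I \<circ> \<sigma>) (nth I)" if "I \<in> multi_idx m" for I \<sigma>
  proof -
    let ?K = "map (\<lambda>r. I ! \<sigma> r) [0..<m]"
    have K: "?K \<in> multi_idx m" by (simp add: multi_idx_def)
    have iff: "(\<forall>r<m. I ! \<sigma> r = K ! r) \<longleftrightarrow> K = ?K" if "K \<in> multi_idx m" for K
      using that by (auto simp: multi_idx_def list_eq_iff_nth_eq)
    have "(\<Sum>K\<in>multi_idx m. (if \<forall>r<m. I ! \<sigma> r = K ! r then of_int (sign \<sigma>) else 0) * X (nth K) (nth I))
        = (\<Sum>K\<in>multi_idx m. if K = ?K then of_int (sign \<sigma>) * X (nth ?K) (nth I) else 0)"
      by (intro sum.cong refl) (simp add: iff)
    also have "\<dots> = of_int (sign \<sigma>) * X (nth ?K) (nth I)"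
      by (subst sum.delta[OF finite_multi_idx]) (simp only: K if_True)
    also have "X (nth ?K) (nth I) = X (nth I \<circ> \<sigma>) (nth I)" by (rule Xcong) auto
    finally show ?thesis .
  qed
  have "QH m k = (\<Sum>I\<in>multi_idx m. \<Sum>K\<in>multi_idx m. fps_const (U_const (skew_entry m I K)) * X (nth K) (nth I))"
    unfolding QH_def op_mult_def skew_symmetrizer_def by (intro sum.cong refl) (simp add: entry)
  also have "\<dots> = (\<Sum>I\<in>multi_idx m. fps_const (U_const (1 / fact m)) * (\<Sum>\<sigma>\<in>?P. of_int (sign \<sigma>) * X (nth I \<circ> \<sigma>) (nth I)))"
  proof (rule sum.cong[OF refl])
    fix I :: "'n list" assume I: "I \<in> multi_idx m"
    have "(\<Sum>K\<in>multi_idx m. fps_const (U_const (skew_entry m I K)) * X (nth K) (nth I))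
        = fps_const (U_const (1 / fact m)) * (\<Sum>K\<in>multi_idx m. \<Sum>\<sigma>\<in>?P.
            (if \<forall>r<m. I ! \<sigma> r = K ! r then of_int (sign \<sigma>) else 0) * X (nth K) (nth I))"
      unfolding skew by (simp only: sum_distrib_left sum_distrib_right mult.assoc)
    also have "\<dots> = fps_const (U_const (1 / fact m)) * (\<Sum>\<sigma>\<in>?P. of_int (sign \<sigma>) * X (nth I \<circ> \<sigma>) (nth I))"
      by (subst sum.swap) (simp only: inner[OF I])
    finally show "(\<Sum>K\<in>multi_idx m. fps_const (U_const (skew_entry m I K)) * X (nth K) (nth I))
        = fps_const (U_const (1 / fact m)) * (\<Sum>\<sigma>\<in>?P. of_int (sign \<sigma>) * X (nth I \<circ> \<sigma>) (nth I))" .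
  qed
  also have "\<dots> = fps_const (U_const (1 / fact m)) * signed_trace {..<m} X"
    unfolding signed_trace_def sum_multi_idx sum_distrib_left[symmetric]
  proof (intro arg_cong2[where f = "(*)"] refl sum.cong)
    fix J :: "nat \<Rightarrow> 'n" and \<sigma> assume "\<sigma> \<in> ?P"
    then have "\<sigma> p < m" if "p < m" for p using permutes_in_image[of \<sigma> "{..<m}" p] that by simp
    then show "X (nth (map J [0..<m]) \<circ> \<sigma>) (nth (map J [0..<m])) = X (J \<circ> \<sigma>) J"
      by (intro Xcong) auto
  qed
  finally show ?thesis unfolding X_def[abs_def] .
qed

text \<open>
  The Capelli identity is applied once per factor, starting with the innermost operator. The
  identity legs \<open>k, \<dots>, m - 1\<close> enter as factors outside of \<open>T\<close>.
\<close>

lemma reducible_chain: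
  fixes t :: "nat \<Rightarrow> 'c::idom"
  assumes "r \<le> k" "k \<le> m"
  shows "reducible n t {r..<m} (\<lambda>K I. if \<forall>p\<in>{k..<m}. K p = I p
    then foldr (\<lambda>p. lax_op n t (K p) (I p)) [r..<k] 1 else 0)"
  using assms(1)
proof (induction r rule: inc_induct)
  case base
  have "normal_term n t {k..<m} {} K I = (if \<forall>p\<in>{k..<m}. K p = I p then 1 else 0)" for K I
    by (simp add: normal_term_def injections_def weight_def munits_empty)
  then have eq: "normal_term n t {k..<m} {} = (\<lambda>K I. if \<forall>p\<in>{k..<m}. K p = I p then 1 else 0)"
    by (intro ext)
  show ?case
    unfolding upt_conv_Nil[OF order_refl] foldr.simps id_apply eq[symmetric]
    by (rule reducible.normal) simp
next
  case (step r)
  have "[r..<k] = r # [Suc r..<k]" using step.hyps by (simp add: upt_conv_Cons)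
  moreover have "insert r {Suc r..<m} = {r..<m}" using step.hyps assms(2) by auto
  ultimately show ?case
    using reducible_lax_op[OF step.IH, of r] by (simp add: if_distrib[of "lax_op n t _ _"] lax_op_0 cong: if_cong)
qed

lemma rep_fps_foldr_LD:
  "rep_fps n (foldr (\<lambda>p. LD (K p) (I p)) ps F) = foldr (\<lambda>p. lax_op n var (K p) (I p)) ps (rep_fps n F)"
  by (induction ps) (simp_all add: rep_fps_LD)

lemma rep_QH:
  fixes m k n :: nat
  assumes "k \<le> m"
  obtains c :: "nat \<Rightarrow> int" where "rep_fps n (QH m k :: ('k::field_char_0, 'n::finite) U_gtrig fps)
    = fps_const (scalar (cst (1 / fact m))) * (\<Sum>j\<le>m. of_int (c j) * bethe n var j)"
proof -
  let ?Z = "\<lambda>K I. if \<forall>p\<in>{k..<m}. K p = I p then foldr (\<lambda>p. lax_op n var (K p) (I p)) [0..<k] 1 else 0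
    :: (nat \<Rightarrow> 'n, 'k pol) lop fps"
  have const: "rep_fps n (fps_const x) = fps_const (rep n x)" for x :: "('k, 'n) U_gtrig"
    by (rule fps_ext) (simp add: rep_fps_nth rep_0)
  have "rep_fps n (QH m k :: ('k, 'n) U_gtrig fps) = fps_const (scalar (cst (1 / fact m))) * signed_trace {..<m} ?Z"
    unfolding QH_eq[OF assms] rep_fps_mult const rep_U_const signed_trace_def rep_fps_sum rep_fps_of_int
    by (simp add: if_distrib[of "rep_fps n"] rep_fps_foldr_LD rep_fps_0 rep_fps_1 cong: if_cong)
  moreover have "reducible n var {..<m} ?Z"
    using reducible_chain[of 0 k m n var] assms by (simp add: atLeast0LessThan)
  then obtain c :: "nat \<Rightarrow> int" where "signed_trace {..<m} ?Z = (\<Sum>j\<le>m. of_int (c j) * bethe n var j)"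
    using signed_trace_reducible[of n var "{..<m}" ?Z] by auto
  ultimately show ?thesis using that by simp
qed

theorem proposition12:
  fixes m k l a b :: nat
  assumes "m = CARD('n)"
    and "1 \<le> k" "k \<le> m" "1 \<le> l" "l \<le> m"
  shows "fps_nth (QH m k :: ('k::real_normed_field, 'n::finite) U_gtrig fps) a * fps_nth (QH m l) b
       - fps_nth (QH m l) b * fps_nth (QH m k) a = 0"
proof (rule rep_jointly_faithful)
  fix n
  let ?z = "scalar (cst (1 / fact m)) :: (nat \<Rightarrow> 'n, 'k pol) lop"
  let ?b = "\<lambda>j a. fps_nth (bethe n var j) a :: (nat \<Rightarrow> 'n, 'k pol) lop"
  have coeff: "\<exists>c :: nat \<Rightarrow> int. \<forall>a. rep n (fps_nth (QH m k :: ('k, 'n) U_gtrig fps) a)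
      = ?z * (\<Sum>j\<le>m. of_int (c j) * ?b j a)" if "k \<le> m" for k
  proof -
    obtain c :: "nat \<Rightarrow> int" where c: "rep_fps n (QH m k :: ('k, 'n) U_gtrig fps)
        = fps_const ?z * (\<Sum>j\<le>m. of_int (c j) * bethe n var j)"
      using rep_QH[OF \<open>k \<le> m\<close>] by blast
    have "fps_nth (of_int z * F) a = of_int z * fps_nth F a" for z a and F :: "(nat \<Rightarrow> 'n, 'k pol) lop fps"
      by (simp add: fps_of_int[symmetric])
    then have "rep n (fps_nth (QH m k :: ('k, 'n) U_gtrig fps) a) = ?z * (\<Sum>j\<le>m. of_int (c j) * ?b j a)" for a
      unfolding rep_fps_nth[symmetric] c by (simp add: fps_sum_nth)
    then show ?thesis by blast
  qed
  obtain c d :: "nat \<Rightarrow> int" where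
    c: "\<And>a. rep n (fps_nth (QH m k :: ('k, 'n) U_gtrig fps) a) = ?z * (\<Sum>j\<le>m. of_int (c j) * ?b j a)" and
    d: "\<And>a. rep n (fps_nth (QH m l :: ('k, 'n) U_gtrig fps) a) = ?z * (\<Sum>j\<le>m. of_int (d j) * ?b j a)"
    using coeff[OF assms(3)] coeff[OF assms(5)] by blast
  have commute_sum: "X * (\<Sum>j\<le>m. of_int (e j) * Y j) = (\<Sum>j\<le>m. of_int (e j) * Y j) * X"
    if "\<And>j. X * Y j = Y j * X" for X and Y :: "nat \<Rightarrow> (nat \<Rightarrow> 'n, 'k pol) lop" and e :: "nat \<Rightarrow> int"
  proof -
    have "X * (of_int (e j) * Y j) = of_int (e j) * Y j * X" for j
    proof -
      have "X * (of_int (e j) * Y j) = (X * of_int (e j)) * Y j" by (simp only: mult.assoc)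
      also have "X * of_int (e j) = of_int (e j) * X" by (rule mult_of_int_commute[symmetric])
      finally show ?thesis by (simp only: mult.assoc that)
    qed
    then show ?thesis by (simp only: sum_distrib_left sum_distrib_right)
  qed
  have "(\<Sum>j\<le>m. of_int (c j) * ?b j a) * (\<Sum>j\<le>m. of_int (d j) * ?b j b)
      = (\<Sum>j\<le>m. of_int (d j) * ?b j b) * (\<Sum>j\<le>m. of_int (c j) * ?b j a)"
    by (rule commute_sum, rule commute_sum[symmetric], rule bethe_commute)
  then show "rep n (fps_nth (QH m k :: ('k, 'n) U_gtrig fps) a * fps_nth (QH m l) b
      - fps_nth (QH m l) b * fps_nth (QH m k) a) = 0"
    unfolding rep_diff rep_mult c d scalar_mult_swap by (simp add: mult.commute)
qed

end
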